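(* Let $n\ge2$ and let $\{g^{ij}(x)\}_{i,j=1}^n$ be a symmetric real matrix valued function on $\mathbb{R}^n$ such that, for some $\lambda\in(0,1]$, $\Lambda>0$, $$\lambda|\xi|_n^2\le\sum_{i,j}g^{ij}(x)\xi_i\xi_j\le\lambda^{-1}|\xi|_n^2,\qquad \sum_{i,j}|g^{ij}(x)-g^{ij}(y)|\le\Lambda|x-y|_n\qquad(x,y,\xi\in\mathbb{R}^n).$$ Let $\Gamma$ be a symmetric positive definite $n\times n$ matrix with minimum and maximum eigenvalues $m_*>0$ and $m^*$, let $\sigma(x)=((\Gamma x,x)_n)^{1/2}$, and let $\omega_0$ be the number associated with $\{g^{ij}(0)\}$ and $\Gamma$ defined in the context. Let $\beta$ be a number such that $\beta>\omega_0$, let $\varphi(s)=e^{-s^{-\beta}}$ and let $w(x)=\varphi(\sigma(x))$. There exist constants $C$, $\tau_1$ and $r_0$ ($C\ge1$, $\tau_1\ge1$, $0<r_0\le1$), depending only on $\lambda,\Lambda,m_*,m^*$ and $\beta$, such that for every $u\in C_0^\infty(B^\sigma_{r_0}\setminus\{0\})$ and for every $\tau\ge\tau_1$ the following inequality holds true: $$\tau\int\sigma^\beta w^{-2\tau}|\nabla_gu|^2\,dx+\tau^3\int\sigma^{-\beta-2}w^{-2\tau}u^2\,dx\le C\int\sigma^{2\beta+2}w^{-2\tau}(\Delta_gu)^2\,dx,$$ where integrals are over $\mathbb{R}^n$.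
   Context: $(\cdot,\cdot)_n$, $|\cdot|_n$ are the Euclidean scalar product and norm. $B_r^\sigma=\{x\in\mathbb{R}^n:\sigma(x)<r\}$; $u\in C_0^\infty(B_r^\sigma\setminus\{0\})$ means $u\in C_0^\infty(\mathbb{R}^n\setminus\{0\})$ with support in $B_r^\sigma\setminus\{0\}$. $g^{-1}(x)=\{g^{ij}(x)\}$, $g(x)$ is its inverse, $\nabla_gu=g^{-1}\nabla u$, $|\nabla_gu|^2=\sum g^{ij}\partial_iu\,\partial_ju$ (the square of the norm of $\nabla_g u$ in the metric $g$), $\Delta_gu=\sum_{i,j}\partial_i(g^{ij}\partial_ju)$ (no volume element). Definition of $\omega_0$ (summation over repeated indices, $x\ne0$): let $$B_0^i=\frac{\sigma\, g^{ij}(0)\partial_j\sigma}{g^{lm}(0)\partial_l\sigma\,\partial_m\sigma},\qquad F^{g(0)}_\sigma=\frac{\sigma g^{ij}(0)\partial^2_{ij}\sigma-g^{ij}(0)\partial_i\sigma\partial_j\sigma}{g^{ij}(0)\partial_i\sigma\partial_j\sigma},$$ $$S^{(0),ij}=\tfrac12\left((\mathrm{div}B_0-F^{g(0)}_\sigma)g^{ij}(0)-\partial_kB_0^jg^{ki}(0)-\partial_kB_0^ig^{kj}(0)\right),$$ and $$\omega_0=\sup\left\{-(S^{(0)}(x)\xi,\xi)_n\ :\ g^{ij}(0)\xi_i\xi_j=1,\ g^{ij}(0)\partial_i\sigma(x)\xi_j=0,\ x\in\mathbb{R}^n\setminus\{0\}\right\}.$$ ($S^{(0)}$ is homogeneous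 of degree $0$ in $x$, and $\omega_0$ is a finite nonnegative number.)
   Formalization: The constants C, τ_1, r_0 may depend, besides n, λ, Λ, m_*, m^* and β, on a number ω<β with ω_0≤ω; constants independent of the gap between β and ω_0 are impossible (n=2, Γ=I, g=diag(1,q), q↑2, β=1). *)

theory Defs
  imports "HOL-Analysis.Analysis"
begin

text \<open>
  Partial derivatives are taken classically along coordinate lines. Applied to a Lipschitz
  function they exist only almost everywhere, where they agree with the weak derivatives; the
  arbitrary value of \<^const>\<open>deriv\<close> on the exceptional null set does not affect integrals.
\<close>

definition pd :: "'n \<Rightarrow> (real ^ 'n \<Rightarrow> real) \<Rightarrow> real ^ 'n \<Rightarrow> real" where
  "pd i f x = deriv (\<lambda>t. f (x + t *\<^sub>R axis i 1)) 0"

fun iter_pd :: "'n list \<Rightarrow> (real ^ 'n \<Rightarrow> real) \<Rightarrow> real ^ 'n \<Rightarrow> real" where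
  "iter_pd [] f = f"
| "iter_pd (i # is) f = pd i (iter_pd is f)"

text \<open>
  Differentiability of all iterated partial derivatives is the class \<open>C\<^sup>\<infinity>\<close>: it makes every
  one of them continuous, and conversely continuous partial derivatives give differentiability.
\<close>

definition smooth :: "(real ^ 'n \<Rightarrow> real) \<Rightarrow> bool" where
  "smooth f \<longleftrightarrow> (\<forall>is x. iter_pd is f differentiable (at x))"

definition C0_infty :: "(real ^ 'n) set \<Rightarrow> (real ^ 'n \<Rightarrow> real) set" where
  "C0_infty U = {u. smooth u \<and> compact (closure {x. u x \<noteq> 0}) \<and> closure {x. u x \<noteq> 0} \<subseteq> U}"

definition eigenvalues :: "real ^ 'n ^ 'n \<Rightarrow> real set" where
  "eigenvalues A = {\<mu>. \<exists>v. v \<noteq> 0 \<and> A *v v = \<mu> *\<^sub>R v}"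

definition sigma_norm :: "real ^ 'n ^ 'n \<Rightarrow> real ^ 'n \<Rightarrow> real" where
  "sigma_norm \<Gamma> x = sqrt ((\<Gamma> *v x) \<bullet> x)"

definition sigma_ball :: "real ^ 'n ^ 'n \<Rightarrow> real \<Rightarrow> (real ^ 'n) set" where
  "sigma_ball \<Gamma> r = {x. sigma_norm \<Gamma> x < r}"

text \<open>
  A matrix-valued function \<open>g\<close> stands for the contravariant coefficients: \<open>g x $ i $ j\<close> is the
  entry \<open>g\<^sup>i\<^sup>j(x)\<close> of the matrix \<open>g\<^sup>-\<^sup>1(x)\<close>.
  Likewise \<open>G\<close> below stands for the frozen matrix of the \<open>g\<^sup>i\<^sup>j(0)\<close>.
\<close>

definition grad_norm_sq ::
    "(real ^ 'n \<Rightarrow> real ^ 'n ^ 'n) \<Rightarrow> (real ^ 'n \<Rightarrow> real) \<Rightarrow> real ^ 'n \<Rightarrow> real" where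
  "grad_norm_sq g u x = (\<Sum>i\<in>UNIV. \<Sum>j\<in>UNIV. g x $ i $ j * pd i u x * pd j u x)"

definition laplace ::
    "(real ^ 'n \<Rightarrow> real ^ 'n ^ 'n) \<Rightarrow> (real ^ 'n \<Rightarrow> real) \<Rightarrow> real ^ 'n \<Rightarrow> real" where
  "laplace g u x = (\<Sum>i\<in>UNIV. \<Sum>j\<in>UNIV. pd i (\<lambda>y. g y $ i $ j * pd j u y) x)"

definition grad_sigma_sq :: "real ^ 'n ^ 'n \<Rightarrow> real ^ 'n ^ 'n \<Rightarrow> real ^ 'n \<Rightarrow> real" where
  "grad_sigma_sq G \<Gamma> x =
     (\<Sum>l\<in>UNIV. \<Sum>m\<in>UNIV. G $ l $ m * pd l (sigma_norm \<Gamma>) x * pd m (sigma_norm \<Gamma>) x)"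

definition B0 :: "real ^ 'n ^ 'n \<Rightarrow> real ^ 'n ^ 'n \<Rightarrow> real ^ 'n \<Rightarrow> real ^ 'n" where
  "B0 G \<Gamma> x =
     (\<chi> i. sigma_norm \<Gamma> x * (\<Sum>j\<in>UNIV. G $ i $ j * pd j (sigma_norm \<Gamma>) x) / grad_sigma_sq G \<Gamma> x)"

definition F0 :: "real ^ 'n ^ 'n \<Rightarrow> real ^ 'n ^ 'n \<Rightarrow> real ^ 'n \<Rightarrow> real" where
  "F0 G \<Gamma> x =
     (sigma_norm \<Gamma> x * (\<Sum>i\<in>UNIV. \<Sum>j\<in>UNIV. G $ i $ j * pd i (pd j (sigma_norm \<Gamma>)) x)
        - grad_sigma_sq G \<Gamma> x) / grad_sigma_sq G \<Gamma> x"

definition S0 :: "real ^ 'n ^ 'n \<Rightarrow> real ^ 'n ^ 'n \<Rightarrow> real ^ 'n \<Rightarrow> real ^ 'n ^ 'n" where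
  "S0 G \<Gamma> x =
     (\<chi> i j. 1 / 2 *
        (((\<Sum>k\<in>UNIV. pd k (\<lambda>y. B0 G \<Gamma> y $ k) x) - F0 G \<Gamma> x) * G $ i $ j
          - (\<Sum>k\<in>UNIV. pd k (\<lambda>y. B0 G \<Gamma> y $ j) x * G $ k $ i)
          - (\<Sum>k\<in>UNIV. pd k (\<lambda>y. B0 G \<Gamma> y $ i) x * G $ k $ j)))"

definition omega0 :: "real ^ 'n ^ 'n \<Rightarrow> real ^ 'n ^ 'n \<Rightarrow> real" where
  "omega0 G \<Gamma> =
     Sup {- ((S0 G \<Gamma> x *v \<xi>) \<bullet> \<xi>) | x \<xi>.
            (\<Sum>i\<in>UNIV. \<Sum>j\<in>UNIV. G $ i $ j * \<xi> $ i * \<xi> $ j) = 1 \<and>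
            (\<Sum>i\<in>UNIV. \<Sum>j\<in>UNIV. G $ i $ j * pd i (sigma_norm \<Gamma>) x * \<xi> $ j) = 0 \<and>
            x \<noteq> 0}"

definition phi :: "real \<Rightarrow> real \<Rightarrow> real" where
  "phi \<beta> s = exp (- (s powr (- \<beta>)))"

definition weight :: "real \<Rightarrow> real ^ 'n ^ 'n \<Rightarrow> real ^ 'n \<Rightarrow> real" where
  "weight \<beta> \<Gamma> x = phi \<beta> (sigma_norm \<Gamma> x)"

end

theory Submission
  imports Defs
begin

text \<open>
  Write \<open>y = \<Gamma>x\<close>, \<open>s = \<sigma>\<^sup>2 = (\<Gamma>x,x)\<close>, \<open>\<rho> = \<sigma>\<^sup>\<beta>\<close>, \<open>q = (g(0)y,y)\<close>, \<open>Q = (g(x)y,y)\<close>, where as in the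
  definitions \<open>g(x)\<close> is the contravariant matrix, and substitute \<open>v = w\<^sup>-\<^sup>\<tau> u\<close> with
  \<open>w\<^sup>-\<^sup>\<tau> = exp (\<tau>/\<rho>)\<close>. Since \<open>\<nabla>w\<^sup>-\<^sup>\<tau> = -\<kappa> w\<^sup>-\<^sup>\<tau> y\<close> with \<open>\<kappa> = \<tau>\<beta>/(\<rho>s)\<close>, the conjugated operator is
  \<open>A = w\<^sup>-\<^sup>\<tau> \<Delta>\<^sub>g u = div (g\<nabla>v) + 2\<kappa> (gy,\<nabla>v) + \<kappa>\<^sup>2 Q v + lower order\<close>.

  The proof is a Rellich-type multiplier argument. The multiplier is \<open>N = 2h (gy,\<nabla>v) + l v\<close> with
  \<open>h = \<rho>s/q\<close> and \<open>l = \<rho> (F - \<omega>)\<close>, where \<open>F = s trace(g(0)\<Gamma>)/q - 2\<close> is the function \<open>F\<close> of the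
  frozen metric. Thus \<open>h gy\<close> is \<open>\<rho>\<close> times a perturbation of the field \<open>B\<^sub>0\<close>: the denominator is frozen
  at the origin, so that only first derivatives of \<open>g\<close> ever appear. Wherever \<open>g\<close> has partial derivatives
  one has \<open>A N = div X + R\<close> (\<open>divergence_identity\<close>), with a quadratic form \<open>R\<close> in \<open>(\<nabla>v, v)\<close>
  and with the flux
  \<open>X\<^sup>i = N (g\<nabla>v)\<^sup>i - h (gy)\<^sup>i (g\<nabla>v,\<nabla>v) + \<kappa>\<^sup>2 Q h (gy)\<^sup>i v\<^sup>2\<close>.

  The choice of \<open>l\<close> balances two requirements. In units where \<open>\<sigma> = 1\<close> and with \<open>t = \<tau>/\<rho>\<close>, the
  coefficient of \<open>t\<^sup>2v\<^sup>2\<close> in \<open>R/\<rho>\<close> is \<open>\<beta>\<^sup>2 (\<beta> - \<omega>) q + O(\<sigma>)\<close>. On covectors tangential to the level sets of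
  \<open>\<sigma>\<close> the gradient part of \<open>R/\<rho>\<close>, frozen at the origin, is \<open>(\<beta> + \<omega>) (g(0)\<xi>,\<xi>) + 2 (S\<^sup>(\<^sup>0\<^sup>) \<xi>,\<xi>)\<close>, hence at
  least \<open>(\<beta> - \<omega>) (g(0)\<xi>,\<xi>)\<close> because \<open>\<omega> \<ge> \<omega>\<^sub>0\<close>. Both are positive. In the remaining, normal, direction the
  form need not be positive by itself, but the product of the two first-order terms \<open>2\<kappa> (gy,\<nabla>v)\<close> and
  \<open>2h (gy,\<nabla>v)\<close> contributes \<open>4t\<beta> (gy,\<nabla>v)\<^sup>2/q\<close>, which dominates for large \<open>\<tau>\<close>. Cross terms are absorbed for
  large \<open>\<tau>\<close>; the errors from replacing \<open>g(x)\<close> by \<open>g(0)\<close> are absorbed for small \<open>\<sigma>\<close>. This is the coercivity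
  statement \<open>Rh_coercive\<close>; estimating \<open>A N\<close> by Young's inequality turns it into the
  pointwise estimate \<open>pointwise_carleman\<close>.

  Two further points carry the proof. First, \<open>g\<close> is only Lipschitz, so the identity holds almost
  everywhere, and \<open>\<integral> div X = 0\<close> has to be known for compactly supported Lipschitz fields. A Lipschitz
  function on the line is differentiable almost everywhere, by Vitali coverings
  (\<open>lipschitz_differentiable_off_null\<close>); Tonelli's theorem on lines and dominated convergence of
  difference quotients give the rest (\<open>integral_deriv_along_eq_zero\<close>). Secondly,
  the supremum \<open>\<omega>\<^sub>0\<close> is evaluated in closed form. This shows that \<open>\<omega>\<^sub>0 \<ge> 0\<close> in dimension at least two
  (\<open>gram_pair.omega0_nonneg\<close>), so that \<open>\<beta> > \<omega> \<ge> 0\<close>.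

  The constants depend only on the data because the estimate of \<open>R\<close> is carried out for a family of
  tuples \<open>(g(x), g(0), \<Gamma>, \<partial>g(x), y/\<sigma>, \<sigma>)\<close> subject to common bounds (locale \<open>frames\<close>), and is finally
  applied to the family of all such tuples.
\<close>

section \<open>Almost everywhere differentiability on the line\<close>

text \<open>
  The covering theorem for balls, read in one dimension for a family of intervals that contain the
  point to be covered somewhere in their interior, not necessarily at the centre.
\<close>

lemma Vitali_open_intervals:
  fixes S :: "real set"
  assumes cov: "\<And>x d. x \<in> S \<Longrightarrow> 0 < d \<Longrightarrow> \<exists>a b. a < x \<and> x < b \<and> b - a < d \<and> P a b"
  obtains C where "countable C" "\<And>a b. (a, b) \<in> C \<Longrightarrow> a < b \<and> P a b"
    "disjoint_family_on (\<lambda>(a, b). {a<..<b}) C"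
    "negligible (S - (\<Union>(a, b)\<in>C. {a<..<b}))"
proof -
  define K where "K = {(a, b). a < b \<and> P a b}"
  define ctr where "ctr = (\<lambda>(a::real, b::real). (a + b) / 2)"
  define rad where "rad = (\<lambda>(a::real, b::real). (b - a) / 2)"
  have ball: "ball (ctr i) (rad i) = (\<lambda>(a, b). {a<..<b}) i" for i
    by (cases i) (auto simp: ctr_def rad_def ball_eq_greaterThanLessThan field_simps)
  have "\<exists>i. i \<in> K \<and> x \<in> ball (ctr i) (rad i) \<and> rad i < d" if x: "x \<in> S" and d: "0 < d" for x d
  proof -
    obtain a b where "a < x" "x < b" "b - a < d" "P a b" using cov[OF x d] by blast
    then show ?thesis
      by (intro exI[of _ "(a, b)"]) (auto simp: K_def ball, auto simp: rad_def)
  qed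
  then obtain C where C: "countable C" "C \<subseteq> K"
     "pairwise (\<lambda>i j. disjnt (ball (ctr i) (rad i)) (ball (ctr j) (rad j))) C"
     "negligible(S - (\<Union>i \<in> C. ball (ctr i) (rad i)))"
    by (rule Vitali_covering_theorem_balls[of S K ctr rad])
  show ?thesis
  proof
    show "countable C" by fact
    show "a < b \<and> P a b" if "(a, b) \<in> C" for a b using that C(2) by (auto simp: K_def)
    show "disjoint_family_on (\<lambda>(a, b). {a<..<b}) C"
      using C(3) unfolding ball by (simp add: pairwise_def disjoint_family_on_def disjnt_def)
    show "negligible (S - (\<Union>(a, b)\<in>C. {a<..<b}))" using C(4) unfolding ball by simp
  qed
qed

lemma AE_mem_of_negligible_diff:
  assumes "negligible (S - W)" shows "AE x in lborel. x \<in> S \<longrightarrow> x \<in> W"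
proof -
  have "AE x in lebesgue. x \<in> S \<longrightarrow> x \<in> W"
    using assms by (auto simp: negligible_iff_null_sets eventually_ae_filter intro!: exI[of _ "S - W"])
  then show ?thesis by (simp add: AE_completion_iff)
qed

lemma emeasure_interval_measure_Ioo:
  assumes "mono F" "continuous_on UNIV F" "a < b"
  shows "emeasure (interval_measure F) {a<..<b} = ennreal (F b - F a)"
proof -
  have F: "\<And>x y. x \<le> y \<Longrightarrow> F x \<le> F y" using assms(1) by (auto dest: monoD)
  have c: "\<And>a. continuous (at_right a) F"
    using assms(2) by (meson UNIV_I continuous_on_eq_continuous_at continuous_at_imp_continuous_at_within open_UNIV)
  have "emeasure (interval_measure F) {b..b} = ennreal (F b - F b)"
    by (rule emeasure_interval_measure_Icc) (use F assms(2) continuous_on_subset in auto)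
  then have z: "{b} \<in> null_sets (interval_measure F)" by (auto simp: null_sets_def)
  have "{a<..b} = {a<..<b} \<union> {b}" using assms(3) by auto
  then have "emeasure (interval_measure F) {a<..<b} = emeasure (interval_measure F) {a<..b}"
    using emeasure_Un_null_set[OF _ z, of "{a<..<b}"] by simp
  also have "\<dots> = ennreal (F b - F a)"
    by (rule emeasure_interval_measure_Ioc) (use F c assms(3) in auto)
  finally show ?thesis .
qed

text \<open>
  On \<open>E\<close> there are arbitrarily short intervals around each point of slope below \<open>p\<close>, and others of slope
  above \<open>q\<close>. Let \<open>\<mu>\<close> be the Stieltjes measure of \<open>F\<close>. Cover \<open>E\<close> first by disjoint intervals of
  the first kind inside an open set \<open>U\<close> of almost the same measure, with union \<open>W\<close>, and then by disjoint
  intervals of the second kind inside \<open>W\<close>. Comparing measures,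
  \<open>q |E| \<le> \<mu>(W) \<le> p |W| \<le> p (|E| + e)\<close>, which forces \<open>|E| = 0\<close>.
\<close>

lemma straddle_derivate_gap_null:
  fixes F :: "real \<Rightarrow> real"
  assumes F: "mono F" "continuous_on UNIV F" and pq: "p < q"
  defines "E \<equiv> {x. (\<forall>d>0. \<exists>a b. a < x \<and> x < b \<and> b - a < d \<and> F b - F a < p * (b - a))
                 \<and> (\<forall>d>0. \<exists>a b. a < x \<and> x < b \<and> b - a < d \<and> F b - F a > q * (b - a))}"
  shows "E \<in> null_sets lborel"
proof (cases "p > 0")
  case False
  have "\<not> F b - F a < p * (b - a)" if "a < b" for a b
  proof -
    have "p * (b - a) \<le> 0" using False that by (simp add: mult_nonpos_nonneg)
    then show ?thesis using monoD[OF F(1), of a b] that by auto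
  qed
  then have "E = {}" unfolding E_def by (auto intro!: exI[of _ 1])
  then show ?thesis by simp
next
  case True
  have op: "open {x. \<exists>a b. a < x \<and> x < b \<and> b - a < d \<and> P a b}" for d :: real and P
  proof -
    have "{x. \<exists>a b. a < x \<and> x < b \<and> b - a < d \<and> P a b} = (\<Union>(a,b)\<in>{(a,b). b - a < d \<and> P a b}. {a<..<b})"
      by (auto; blast)
    then show ?thesis by (auto intro!: open_UN)
  qed
  \<comment> \<open>Countably many lengths suffice, which makes the set Borel.\<close>
  have ex_nat: "(\<forall>d>0. \<exists>a b. a < x \<and> x < b \<and> b - a < d \<and> P a b) \<longleftrightarrow>
      (\<forall>n::nat. \<exists>a b. a < x \<and> x < b \<and> b - a < inverse (real (Suc n)) \<and> P a b)" for x :: real and P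
  proof
    assume R: "\<forall>n::nat. \<exists>a b. a < x \<and> x < b \<and> b - a < inverse (real (Suc n)) \<and> P a b"
    show "\<forall>d>0. \<exists>a b. a < x \<and> x < b \<and> b - a < d \<and> P a b"
    proof (intro allI impI)
      fix d :: real assume "d > 0"
      then obtain n where n: "inverse (real (Suc n)) < d" using reals_Archimedean by blast
      obtain a b where "a < x" "x < b" "b - a < inverse (real (Suc n))" "P a b" using R by blast
      with n show "\<exists>a b. a < x \<and> x < b \<and> b - a < d \<and> P a b" by (intro exI[of _ a] exI[of _ b]) auto
    qed
  qed auto
  have E_borel: "E \<in> sets borel"
  proof -
    have "E = (\<Inter>n::nat. {x. \<exists>a b. a < x \<and> x < b \<and> b - a < inverse (real (Suc n)) \<and> F b - F a < p * (b - a)})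
            \<inter> (\<Inter>n::nat. {x. \<exists>a b. a < x \<and> x < b \<and> b - a < inverse (real (Suc n)) \<and> F b - F a > q * (b - a)})"
      unfolding E_def ex_nat by auto
    moreover have "\<dots> \<in> sets borel"
      by (intro sets.Int; rule sets.countable_INT''; (rule borel_open[OF op])?; simp)
    ultimately show ?thesis by (rule ssubst)
  qed
  let ?mu = "interval_measure F"
  have null: "E \<inter> {-B<..<B} \<in> null_sets lborel" for B :: real
  proof -
    let ?E = "E \<inter> {-B<..<B}"
    have Eb: "?E \<in> sets borel" using E_borel by auto
    have fin: "emeasure lborel ?E < \<infinity>"
    proof -
      have "emeasure lborel ?E \<le> emeasure lborel {-B<..<B}" by (intro emeasure_mono) auto
      also have "\<dots> < \<infinity>" by (cases "-B \<le> B") (auto simp: emeasure_lborel_Ioo)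
      finally show ?thesis .
    qed
    have est: "ennreal q * emeasure lborel ?E \<le> ennreal p * (emeasure lborel ?E + ennreal e)" if e: "e > 0" for e
    proof -
      obtain U where U: "open U" "?E \<subseteq> U" "emeasure lborel (U - ?E) < ennreal e"
        using outer_regular_lborel[OF Eb e] by blast
      have small: "\<exists>d'>0. d' \<le> d \<and> {x-d'<..<x+d'} \<subseteq> V" if V: "open V" "x \<in> V" "d > 0" for V and x d :: real
      proof -
        obtain d1 where "d1 > 0" "ball x d1 \<subseteq> V" using V by (meson open_contains_ball)
        then show ?thesis using V(3) by (intro exI[of _ "min d d1"]) (auto simp: ball_eq_greaterThanLessThan subset_iff min_def split: if_splits)
      qed
      have c1: "\<exists>a b. a < x \<and> x < b \<and> b - a < d \<and> {a<..<b} \<subseteq> V \<and> P a b"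
        if xd: "x \<in> V" "open V" "0 < d" and ex: "\<And>d. d > 0 \<Longrightarrow> \<exists>a b. a < x \<and> x < b \<and> b - a < d \<and> P a b" for x d :: real and V P
      proof -
        obtain d' where d': "d' > 0" "d' \<le> d" "{x-d'<..<x+d'} \<subseteq> V" using small[OF xd(2,1,3)] by blast
        obtain a b where ab: "a < x" "x < b" "b - a < d'" "P a b" using ex[OF d'(1)] by blast
        have "{a<..<b} \<subseteq> {x-d'<..<x+d'}" using ab by auto
        then show ?thesis using ab d' by (intro exI[of _ a] exI[of _ b]) auto
      qed
      \<comment> \<open>Intervals of small slope: their union W has Stieltjes measure at most p |U|.\<close>
      obtain C where C: "countable C" "\<And>a b. (a, b) \<in> C \<Longrightarrow> a < b \<and> {a<..<b} \<subseteq> U \<and> F b - F a < p * (b - a)"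
          "disjoint_family_on (\<lambda>(a, b). {a<..<b}) C" "negligible (?E - (\<Union>(a, b)\<in>C. {a<..<b}))"
      proof (rule Vitali_open_intervals[of ?E "\<lambda>a b. {a<..<b} \<subseteq> U \<and> F b - F a < p * (b - a)"])
        fix x d :: real assume "x \<in> ?E" "0 < d"
        then show "\<exists>a b. a < x \<and> x < b \<and> b - a < d \<and> {a<..<b} \<subseteq> U \<and> F b - F a < p * (b - a)"
          using U(1,2) by (intro c1) (auto simp: E_def)
      qed blast
      define W where "W = (\<Union>(a, b)\<in>C. {a<..<b})"
      have W: "open W" "W \<subseteq> U" unfolding W_def using C(2) by (auto intro!: open_UN)
      \<comment> \<open>Intervals of large slope inside W, still covering almost all of the set.\<close>
      obtain D where D: "countable D" "\<And>a b. (a, b) \<in> D \<Longrightarrow> a < b \<and> {a<..<b} \<subseteq> W \<and> F b - F a > q * (b - a)"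
          "disjoint_family_on (\<lambda>(a, b). {a<..<b}) D" "negligible (?E \<inter> W - (\<Union>(a, b)\<in>D. {a<..<b}))"
      proof (rule Vitali_open_intervals[of "?E \<inter> W" "\<lambda>a b. {a<..<b} \<subseteq> W \<and> F b - F a > q * (b - a)"])
        fix x d :: real assume "x \<in> ?E \<inter> W" "0 < d"
        then show "\<exists>a b. a < x \<and> x < b \<and> b - a < d \<and> {a<..<b} \<subseteq> W \<and> F b - F a > q * (b - a)"
          using W by (intro c1) (auto simp: E_def)
      qed blast
      define Z where "Z = (\<Union>(a, b)\<in>D. {a<..<b})"
      have Z: "open Z" "Z \<subseteq> W" unfolding Z_def using D(2) by (auto intro!: open_UN)
      have meas: "emeasure M (\<Union>(a, b)\<in>C. {a<..<b}) = (\<integral>\<^sup>+i. emeasure M ((\<lambda>(a, b). {a<..<b}) i) \<partial>count_space C)"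
        if "countable C" "disjoint_family_on (\<lambda>(a, b). {a<..<b}) C" "sets M = sets borel"
        for C and M :: "real measure"
        using that by (intro emeasure_UN_countable) (auto simp: that)
      have len: "emeasure lborel {a<..<b} = ennreal (b - a)" if "a < b" for a b :: real
        using that by (simp add: emeasure_lborel_Ioo)
      have "ennreal q * emeasure lborel ?E \<le> ennreal q * emeasure lborel Z"
      proof (intro mult_left_mono emeasure_mono_AE)
        show "AE x in lborel. x \<in> ?E \<longrightarrow> x \<in> Z"
          using AE_mem_of_negligible_diff[OF C(4)] AE_mem_of_negligible_diff[OF D(4)]
          by eventually_elim (auto simp: W_def Z_def)
      qed (use Z(1) in auto)
      also have "\<dots> \<le> emeasure ?mu Z"
      proof -
        have "ennreal q * emeasure lborel Z = (\<integral>\<^sup>+i. ennreal q * emeasure lborel ((\<lambda>(a, b). {a<..<b}) i) \<partial>count_space D)"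
          unfolding Z_def by (subst meas[OF D(1,3)]) (auto simp: nn_integral_cmult)
        also have "\<dots> \<le> (\<integral>\<^sup>+i. emeasure ?mu ((\<lambda>(a, b). {a<..<b}) i) \<partial>count_space D)"
        proof (intro nn_integral_mono)
          fix i assume i: "i \<in> space (count_space D)"
          obtain a b where ab: "i = (a, b)" by (cases i)
          have 1: "a < b" "F b - F a > q * (b - a)" using D(2)[of a b] i ab by auto
          show "ennreal q * emeasure lborel ((\<lambda>(a, b). {a<..<b}) i) \<le> emeasure ?mu ((\<lambda>(a, b). {a<..<b}) i)"
            using 1 True pq by (simp add: ab len emeasure_interval_measure_Ioo[OF F 1(1)]
                  ennreal_mult[symmetric] ennreal_leI)
        qed
        also have "\<dots> = emeasure ?mu Z" unfolding Z_def by (subst meas[OF D(1,3)]) auto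
        finally show ?thesis .
      qed
      also have "\<dots> \<le> emeasure ?mu W" using Z W by (intro emeasure_mono) auto
      also have "\<dots> \<le> ennreal p * emeasure lborel W"
      proof -
        have "emeasure ?mu W = (\<integral>\<^sup>+i. emeasure ?mu ((\<lambda>(a, b). {a<..<b}) i) \<partial>count_space C)"
          unfolding W_def by (subst meas[OF C(1,3)]) auto
        also have "\<dots> \<le> (\<integral>\<^sup>+i. ennreal p * emeasure lborel ((\<lambda>(a, b). {a<..<b}) i) \<partial>count_space C)"
        proof (intro nn_integral_mono)
          fix i assume i: "i \<in> space (count_space C)"
          obtain a b where ab: "i = (a, b)" by (cases i)
          have 1: "a < b" "F b - F a < p * (b - a)" using C(2)[of a b] i ab by auto
          show "emeasure ?mu ((\<lambda>(a, b). {a<..<b}) i) \<le> ennreal p * emeasure lborel ((\<lambda>(a, b). {a<..<b}) i)"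
            using 1 True pq by (simp add: ab len emeasure_interval_measure_Ioo[OF F 1(1)]
                  ennreal_mult[symmetric] ennreal_leI)
        qed
        also have "\<dots> = ennreal p * emeasure lborel W" unfolding W_def
          by (subst meas[OF C(1,3)]) (auto simp: nn_integral_cmult)
        finally show ?thesis .
      qed
      also have "\<dots> \<le> ennreal p * (emeasure lborel ?E + ennreal e)"
      proof (intro mult_left_mono)
        have "emeasure lborel W \<le> emeasure lborel U" using W U by (intro emeasure_mono) auto
        also have "\<dots> = emeasure lborel (?E \<union> (U - ?E))" using U(2) by (intro arg_cong[where f="emeasure lborel"]) auto
        also have "\<dots> \<le> emeasure lborel ?E + emeasure lborel (U - ?E)"
          using Eb U by (intro emeasure_subadditive) auto
        also have "\<dots> \<le> emeasure lborel ?E + ennreal e" using U(3) by (intro add_left_mono) auto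
        finally show "emeasure lborel W \<le> emeasure lborel ?E + ennreal e" .
      qed auto
      finally show ?thesis .
    qed
    obtain m where m: "emeasure lborel ?E = ennreal m" "m \<ge> 0" using fin by (cases "emeasure lborel ?E") auto
    have "q * m \<le> p * (m + e)" if "e > 0" for e
      using est[OF that] m True pq that by (simp add: ennreal_mult[symmetric] ennreal_plus[symmetric] del: ennreal_plus)
    \<comment> \<open>With this e the inequality reads q m <= (p + q) m / 2.\<close>
    from this[of "(q - p) * m / (2 * p)"] have "m \<le> 0"
      using True pq m(2)
      by (cases "m = 0") (auto simp: field_simps zero_less_mult_iff)
    then have "emeasure lborel ?E = 0" using m by auto
    then show ?thesis using Eb by (auto simp: null_sets_def)
  qed
  have "E = (\<Union>n::nat. E \<inter> {- real n<..<real n})"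
  proof -
    have "\<exists>n::nat. x \<in> {- real n<..<real n}" for x :: real
    proof -
      obtain n :: nat where "\<bar>x\<bar> < real n" using reals_Archimedean2 by blast
      then show ?thesis by (intro exI[of _ n]) auto
    qed
    then show ?thesis by auto
  qed
  moreover have "(\<Union>n::nat. E \<inter> {- real n<..<real n}) \<in> null_sets lborel"
    by (intro null_sets_UN null)
  ultimately show ?thesis by metis
qed

text \<open>
  The function \<open>F x = f x + L x\<close> is monotone, so for rational \<open>p < q\<close> almost no point admits both slopes
  below \<open>p\<close> and slopes above \<open>q\<close> on short intervals around it. Off the union of these null sets all slopes
  on short intervals approach one number, which is the derivative of \<open>F\<close>.
\<close>

theorem lipschitz_differentiable_off_null:
  fixes f :: "real \<Rightarrow> real"
  assumes L: "L-lipschitz_on UNIV f"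
  shows "\<exists>N\<in>null_sets lborel. \<forall>x. x \<notin> N \<longrightarrow> f differentiable (at x)"
proof -
  define F where "F = (\<lambda>x. f x + L * x)"
  have lip: "\<bar>f x - f y\<bar> \<le> L * \<bar>x - y\<bar>" for x y
    using lipschitz_onD[OF L, of x y] by (simp add: dist_real_def)
  have L0: "L \<ge> 0" using L by (rule lipschitz_on_nonneg)
  have monoF: "mono F"
  proof (rule monoI)
    fix x y :: real assume "x \<le> y"
    then show "F x \<le> F y" using lip[of x y] by (auto simp: F_def abs_le_iff algebra_simps)
  qed
  have cf: "continuous_on UNIV f" using L by (rule lipschitz_on_continuous_on)
  have cF: "continuous_on UNIV F" unfolding F_def by (intro continuous_intros cf)
  have ub: "F b - F a \<le> 2 * L * (b - a)" if "a \<le> b" for a b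
    using lip[of b a] that by (auto simp: F_def abs_le_iff algebra_simps)
  define A where "A p x \<longleftrightarrow> (\<forall>d>0. \<exists>a b. a < x \<and> x < b \<and> b - a < d \<and> F b - F a < p * (b - a))" for p x
  define B where "B q x \<longleftrightarrow> (\<forall>d>0. \<exists>a b. a < x \<and> x < b \<and> b - a < d \<and> F b - F a > q * (b - a))" for q x
  define N where "N = (\<Union>(p, q)\<in>{(p, q). p \<in> \<rat> \<and> q \<in> \<rat> \<and> p < q}. {x. A p x \<and> B q x})"
  have "N \<in> null_sets lborel"
    unfolding N_def
  proof (rule null_sets_UN')
    have "countable (\<rat> \<times> \<rat> :: (real \<times> real) set)" by (intro countable_SIGMA countable_rat)
    then show "countable {(p::real, q). p \<in> \<rat> \<and> q \<in> \<rat> \<and> p < q}"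
      by (rule countable_subset[rotated]) auto
    show "(case i of (p, q) \<Rightarrow> {x. A p x \<and> B q x}) \<in> null_sets lborel"
      if "i \<in> {(p, q). p \<in> \<rat> \<and> q \<in> \<rat> \<and> p < q}" for i
      using that straddle_derivate_gap_null[OF monoF cF] unfolding A_def B_def by (cases i) auto
  qed
  moreover have "f differentiable (at x)" if x: "x \<notin> N" for x
  proof -
    have AB: "\<not> B q x" if "A p x" "p \<in> \<rat>" "q \<in> \<rat>" "p < q" for p q
      using x that unfolding N_def by auto
    have notA: "\<exists>d>0. \<forall>a b. a < x \<longrightarrow> x < b \<longrightarrow> b - a < d \<longrightarrow> p * (b - a) \<le> F b - F a" if "\<not> A p x" for p
      using that unfolding A_def by (meson not_less)
    have notB: "\<exists>d>0. \<forall>a b. a < x \<longrightarrow> x < b \<longrightarrow> b - a < d \<longrightarrow> F b - F a \<le> q * (b - a)" if "\<not> B q x" for q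
      using that unfolding B_def by (meson not_less)
    \<comment> \<open>The derivative is the largest eventual lower bound for slopes around x.\<close>
    define S where "S = {p. \<not> A p x}"
    have "0 \<in> S"
    proof -
      have "\<not> F b - F a < 0 * (b - a)" if "a < x" "x < b" for a b using monoD[OF monoF, of a b] that by simp
      then have "\<not> A 0 x" unfolding A_def by (intro notI) (drule spec[of _ 1], auto)
      then show ?thesis by (simp add: S_def)
    qed
    have Sub: "p \<le> 2 * L" if pS: "p \<in> S" for p
    proof -
      obtain d where d: "d > 0" "\<And>a b. a < x \<Longrightarrow> x < b \<Longrightarrow> b - a < d \<Longrightarrow> F b - F a \<ge> p * (b - a)"
        using notA[of p] pS unfolding S_def by blast
      have "p * (d / 2) \<le> F (x + d / 4) - F (x - d / 4)"
        using d(2)[of "x - d/4" "x + d/4"] d(1) by auto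
      also have "\<dots> \<le> 2 * L * (d / 2)"
        using ub[of "x - d/4" "x + d/4"] d(1) by auto
      finally show ?thesis using d(1) by (simp add: mult_le_cancel_right)
    qed
    define D where "D = Sup S"
    have bdd: "bdd_above S" by (rule bdd_aboveI[of S "2 * L"]) (rule Sub)
    have two: "\<exists>d>0. \<forall>a b. a < x \<longrightarrow> x < b \<longrightarrow> b - a < d \<longrightarrow> \<bar>F b - F a - D * (b - a)\<bar> \<le> e * (b - a)"
      if e: "e > 0" for e
    proof -
      obtain p where p: "p \<in> S" "p > D - e"
        using e \<open>0 \<in> S\<close> less_cSupD[of S "D - e"] by (auto simp: D_def)
      obtain d1 where d1: "d1 > 0" "\<And>a b. a < x \<Longrightarrow> x < b \<Longrightarrow> b - a < d1 \<Longrightarrow> F b - F a \<ge> p * (b - a)"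
        using notA[of p] p(1) unfolding S_def by blast
      obtain p' where p': "p' \<in> \<rat>" "D < p'" "p' < D + e" using Rats_dense_in_real[of D "D + e"] e by auto
      obtain q' where q': "q' \<in> \<rat>" "p' < q'" "q' < D + e" using Rats_dense_in_real[OF p'(3)] by auto
      have "p' \<notin> S" using p'(2) cSup_upper[OF _ bdd, of p'] by (auto simp: D_def)
      then have "\<not> B q' x" using AB p' q' by (auto simp: S_def)
      then obtain d2 where d2: "d2 > 0" "\<And>a b. a < x \<Longrightarrow> x < b \<Longrightarrow> b - a < d2 \<Longrightarrow> F b - F a \<le> q' * (b - a)"
        using notB[of q'] by blast
      show ?thesis
      proof (intro exI[of _ "min d1 d2"] conjI allI impI)
        fix a b assume ab: "a < x" "x < b" "b - a < min d1 d2"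
        have "p * (b - a) \<le> F b - F a" "F b - F a \<le> q' * (b - a)" using d1 d2 ab by auto
        moreover have "(D - e) * (b - a) \<le> p * (b - a)" "q' * (b - a) \<le> (D + e) * (b - a)"
          using p q' ab by (auto intro!: mult_right_mono)
        ultimately show "\<bar>F b - F a - D * (b - a)\<bar> \<le> e * (b - a)" by (simp add: abs_le_iff algebra_simps)
      qed (use d1 d2 in auto)
    qed
    \<comment> \<open>Intervals with x as an end point are limits of intervals around x.\<close>
    have one: "\<exists>d>0. \<forall>y. \<bar>y - x\<bar> < d \<longrightarrow> \<bar>F y - F x - D * (y - x)\<bar> \<le> e * \<bar>y - x\<bar>" if e: "e > 0" for e
    proof -
      obtain d where d: "d > 0" "\<And>a b. a < x \<Longrightarrow> x < b \<Longrightarrow> b - a < d \<Longrightarrow> \<bar>F b - F a - D * (b - a)\<bar> \<le> e * (b - a)"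
        using two[OF e] by blast
      have cont: "(F \<longlongrightarrow> F x) (at x within T)" for T
        using cF by (meson UNIV_I continuous_on_def tendsto_within_subset top_greatest)
      have r: "\<bar>F b - F x - D * (b - x)\<bar> \<le> e * (b - x)" if b: "x < b" "b < x + d" for b
      proof (rule tendsto_le[of "at_left x"])
        show "((\<lambda>a. \<bar>F b - F a - D * (b - a)\<bar>) \<longlongrightarrow> \<bar>F b - F x - D * (b - x)\<bar>) (at_left x)"
          by (intro tendsto_intros cont)
        show "((\<lambda>a. e * (b - a)) \<longlongrightarrow> e * (b - x)) (at_left x)" by (intro tendsto_intros)
        show "\<forall>\<^sub>F a in at_left x. \<bar>F b - F a - D * (b - a)\<bar> \<le> e * (b - a)"
          using b by (intro eventually_at_leftI[of "b - d"] d(2)) auto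
      qed auto
      have l: "\<bar>F x - F a - D * (x - a)\<bar> \<le> e * (x - a)" if a: "a < x" "x - d < a" for a
      proof (rule tendsto_le[of "at_right x"])
        show "((\<lambda>b. \<bar>F b - F a - D * (b - a)\<bar>) \<longlongrightarrow> \<bar>F x - F a - D * (x - a)\<bar>) (at_right x)"
          by (intro tendsto_intros cont)
        show "((\<lambda>b. e * (b - a)) \<longlongrightarrow> e * (x - a)) (at_right x)" by (intro tendsto_intros)
        show "\<forall>\<^sub>F b in at_right x. \<bar>F b - F a - D * (b - a)\<bar> \<le> e * (b - a)"
          using a by (intro eventually_at_rightI[of _ "a + d"] d(2)) auto
      qed auto
      show ?thesis
      proof (intro exI[of _ d] conjI allI impI d(1))
        fix y assume y: "\<bar>y - x\<bar> < d"
        consider "y = x" | "x < y" | "y < x" by linarith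
        then show "\<bar>F y - F x - D * (y - x)\<bar> \<le> e * \<bar>y - x\<bar>"
        proof cases
          case 2 then show ?thesis using r[of y] y by auto
        next
          case 3
          have "F y - F x - D * (y - x) = - (F x - F y - D * (x - y))" by (simp add: algebra_simps)
          then have "\<bar>F y - F x - D * (y - x)\<bar> = \<bar>F x - F y - D * (x - y)\<bar>" by (simp only: abs_minus_cancel)
          then show ?thesis using l[of y] y 3 by auto
        qed auto
      qed
    qed
    have "(F has_derivative (\<lambda>h. D * h)) (at x)"
      unfolding has_derivative_at_alt using one by (auto simp: bounded_linear_mult_right)
    then have "F differentiable (at x)" by (auto simp: differentiable_def)
    then have "(\<lambda>x. F x - L * x) differentiable (at x)" by (intro derivative_intros) auto
    then show ?thesis by (simp add: F_def)
  qed
  ultimately show ?thesis by blast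
qed

section \<open>Directional derivatives of Lipschitz functions\<close>

lemma closed_quotients_close:
  fixes f :: "'a::euclidean_space \<Rightarrow> real"
  assumes "continuous_on UNIV f"
  shows "closed {x. \<forall>s t. 0 < \<bar>s\<bar> \<longrightarrow> \<bar>s\<bar> < d \<longrightarrow> 0 < \<bar>t\<bar> \<longrightarrow> \<bar>t\<bar> < d \<longrightarrow>
     \<bar>(f (x + s *\<^sub>R e) - f x) / s - (f (x + t *\<^sub>R e) - f x) / t\<bar> \<le> c}"
proof -
  have c: "continuous_on UNIV (\<lambda>x. f (x + s *\<^sub>R e))" for s
    by (rule continuous_on_compose2[OF assms]) (auto intro!: continuous_intros)
  have q: "continuous_on UNIV (\<lambda>x. (f (x + s *\<^sub>R e) - f x) / s)" for s
    unfolding divide_inverse by (intro continuous_on_mult continuous_on_diff c assms continuous_on_const)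
  show ?thesis
    by (intro closed_Collect_all closed_Collect_imp open_Collect_const closed_Collect_le
        continuous_on_rabs continuous_on_diff q continuous_on_const)
qed

text \<open>
  Differentiability at a point as a Cauchy condition does not mention the value of the derivative.
  Quantifying over natural numbers instead of reals makes the set of points where it holds Borel.
\<close>

lemma differentiable_real_iff_quotients_Cauchy:
  fixes g :: "real \<Rightarrow> real"
  shows "g differentiable (at 0) \<longleftrightarrow> (\<forall>m::nat. \<exists>k::nat. \<forall>s t. 0 < \<bar>s\<bar> \<longrightarrow> \<bar>s\<bar> < inverse (real (Suc k)) \<longrightarrow>
     0 < \<bar>t\<bar> \<longrightarrow> \<bar>t\<bar> < inverse (real (Suc k)) \<longrightarrow>
     \<bar>(g s - g 0) / s - (g t - g 0) / t\<bar> \<le> inverse (real (Suc m)))" (is "?L \<longleftrightarrow> ?R")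
proof
  assume ?L
  then obtain D where "(g has_real_derivative D) (at 0)" using real_differentiable_def by blast
  then have lim: "((\<lambda>s. (g s - g 0) / s) \<longlongrightarrow> D) (at 0)" by (simp add: DERIV_def)
  show ?R
  proof
    fix m :: nat
    have "\<forall>\<^sub>F s in at 0. dist ((g s - g 0) / s) D < inverse (real (Suc m)) / 2"
      using lim by (rule tendstoD) auto
    then obtain d where d: "d > 0" "\<And>s. s \<noteq> 0 \<Longrightarrow> \<bar>s\<bar> < d \<Longrightarrow> \<bar>(g s - g 0) / s - D\<bar> < inverse (real (Suc m)) / 2"
      by (auto simp: eventually_at dist_real_def)
    obtain k where k: "inverse (real (Suc k)) < d" using reals_Archimedean d(1) by blast
    show "\<exists>k::nat. \<forall>s t. 0 < \<bar>s\<bar> \<longrightarrow> \<bar>s\<bar> < inverse (real (Suc k)) \<longrightarrow>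
     0 < \<bar>t\<bar> \<longrightarrow> \<bar>t\<bar> < inverse (real (Suc k)) \<longrightarrow>
     \<bar>(g s - g 0) / s - (g t - g 0) / t\<bar> \<le> inverse (real (Suc m))"
    proof (intro exI[of _ k] allI impI)
      fix s t assume st: "0 < \<bar>s\<bar>" "\<bar>s\<bar> < inverse (real (Suc k))" "0 < \<bar>t\<bar>" "\<bar>t\<bar> < inverse (real (Suc k))"
      show "\<bar>(g s - g 0) / s - (g t - g 0) / t\<bar> \<le> inverse (real (Suc m))"
        using d(2)[of s] d(2)[of t] st k by linarith
    qed
  qed
next
  assume R: ?R
  let ?q = "\<lambda>s. (g s - g 0) / s"
  let ?X = "\<lambda>n::nat. inverse (real (Suc n))"
  have "Cauchy (\<lambda>n. ?q (?X n))"
  proof (rule CauchyI')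
    fix e :: real assume "e > 0"
    then obtain m where m: "?X m < e" using reals_Archimedean by blast
    obtain k where k: "\<And>s t. 0 < \<bar>s\<bar> \<Longrightarrow> \<bar>s\<bar> < ?X k \<Longrightarrow> 0 < \<bar>t\<bar> \<Longrightarrow> \<bar>t\<bar> < ?X k \<Longrightarrow> \<bar>?q s - ?q t\<bar> \<le> ?X m"
      using R by blast
    have "dist (?q (?X i)) (?q (?X j)) < e" if "i \<ge> Suc k" "i < j" for i j
    proof -
      have a: "?X i < ?X k" "?X j < ?X k" using that by (auto intro!: less_imp_inverse_less)
      have b: "0 < ?X i" "0 < ?X j" by auto
      have "\<bar>?q (?X i) - ?q (?X j)\<bar> \<le> ?X m" using a b by (intro k) auto
      then show ?thesis using m by (simp only: dist_real_def)
    qed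
    then show "\<exists>M. \<forall>m\<ge>M. \<forall>n>m. dist (?q (?X m)) (?q (?X n)) < e" by blast
  qed
  then obtain D where D: "(\<lambda>n. ?q (?X n)) \<longlonglongrightarrow> D" by (meson Cauchy_convergent_iff convergent_def)
  have "(?q \<longlongrightarrow> D) (at 0)"
  proof (rule LIM_I)
    fix e :: real assume "e > 0"
    then obtain m where m: "?X m < e" using reals_Archimedean by blast
    obtain k where k: "\<And>s t. 0 < \<bar>s\<bar> \<Longrightarrow> \<bar>s\<bar> < ?X k \<Longrightarrow> 0 < \<bar>t\<bar> \<Longrightarrow> \<bar>t\<bar> < ?X k \<Longrightarrow> \<bar>?q s - ?q t\<bar> \<le> ?X m"
      using R by blast
    have "norm (?q s - D) < e" if s: "s \<noteq> 0 \<and> norm (s - 0) < ?X k" for s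
    proof -
      have "(\<lambda>n. \<bar>?q s - ?q (?X n)\<bar>) \<longlonglongrightarrow> \<bar>?q s - D\<bar>" by (intro tendsto_intros D)
      moreover have "\<bar>?q s - ?q (?X n)\<bar> \<le> ?X m" if "n \<ge> Suc k" for n
      proof (rule k)
        have "?X n < ?X k" using that by (auto intro!: less_imp_inverse_less)
        then show "\<bar>?X n\<bar> < ?X k" by auto
      qed (use s in auto)
      ultimately have "\<bar>?q s - D\<bar> \<le> ?X m"
        by (intro tendsto_upperbound) (auto simp: eventually_sequentially simp del: of_nat_Suc intro!: exI[of _ "Suc k"])
      then show ?thesis using m by simp
    qed
    then show "\<exists>s>0. \<forall>x. x \<noteq> 0 \<and> norm (x - 0) < s \<longrightarrow> norm (?q x - D) < e"
      by (intro exI[of _ "?X k"]) auto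
  qed
  then show ?L by (auto simp: real_differentiable_def DERIV_def)
qed

lemma nondifferentiable_along_borel:
  fixes f :: "'a::euclidean_space \<Rightarrow> real"
  assumes "continuous_on UNIV f"
  shows "{x. \<not> (\<lambda>t. f (x + t *\<^sub>R e)) differentiable (at (0::real))} \<in> sets borel"
proof -
  have "{x. (\<lambda>t. f (x + t *\<^sub>R e)) differentiable (at (0::real))} =
    (\<Inter>m::nat. \<Union>k::nat. {x. \<forall>s t. 0 < \<bar>s\<bar> \<longrightarrow> \<bar>s\<bar> < inverse (real (Suc k)) \<longrightarrow> 0 < \<bar>t\<bar> \<longrightarrow> \<bar>t\<bar> < inverse (real (Suc k)) \<longrightarrow>
     \<bar>(f (x + s *\<^sub>R e) - f x) / s - (f (x + t *\<^sub>R e) - f x) / t\<bar> \<le> inverse (real (Suc m))})"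
    unfolding differentiable_real_iff_quotients_Cauchy by (simp only: scaleR_zero_left add_0_right) auto
  moreover have "\<dots> \<in> sets borel"
    by (rule sets.countable_INT''; (rule sets.countable_UN'')?; (rule borel_closed[OF closed_quotients_close[OF assms]])?; simp)
  ultimately have "{x. (\<lambda>t. f (x + t *\<^sub>R e)) differentiable (at (0::real))} \<in> sets borel" by simp
  moreover have "{x. \<not> (\<lambda>t. f (x + t *\<^sub>R e)) differentiable (at (0::real))} = UNIV - {x. (\<lambda>t. f (x + t *\<^sub>R e)) differentiable (at (0::real))}"
    by auto
  ultimately show ?thesis by (metis sets.compl_sets space_borel)
qed

text \<open>
  By Tonelli's theorem, integrating the indicator of \<open>N\<close> at \<open>x + t e\<close> over \<open>x\<close> and over \<open>0 \<le> t \<le> 1\<close> gives the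
  measure of \<open>N\<close> in one order and zero in the other. Moving along translates avoids any choice of
  coordinates adapted to \<open>e\<close>; for \<open>e = 0\<close> the hypothesis says that \<open>N\<close> is empty.
\<close>

lemma null_if_null_on_lines:
  fixes N :: "'a::euclidean_space set"
  assumes N: "N \<in> sets borel" and line: "\<And>x. {t::real. x + t *\<^sub>R e \<in> N} \<in> null_sets lborel"
  shows "N \<in> null_sets lborel"
proof -
  have h: "(\<lambda>z::real \<times> 'a. snd z + fst z *\<^sub>R e) \<in> (lborel \<Otimes>\<^sub>M lborel) \<rightarrow>\<^sub>M borel"
  proof -
    have "continuous_on UNIV (\<lambda>z::real \<times> 'a. snd z + fst z *\<^sub>R e)" by (intro continuous_intros)
    then have "(\<lambda>z::real \<times> 'a. snd z + fst z *\<^sub>R e) \<in> borel \<rightarrow>\<^sub>M borel" by (rule borel_measurable_continuous_onI)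
    then show ?thesis by (simp add: lborel_prod)
  qed
  have iN: "indicator N \<in> borel_measurable (borel :: 'a measure)" using N by (rule borel_measurable_indicator)
  have m: "(\<lambda>(t, x). indicator {0..1::real} t * indicator N (x + t *\<^sub>R e) :: ennreal) \<in> borel_measurable (lborel \<Otimes>\<^sub>M lborel)"
    unfolding split_beta'
    by (intro borel_measurable_times_ennreal measurable_compose[OF h iN] measurable_compose[OF measurable_fst]) simp
  have "(\<integral>\<^sup>+t. (\<integral>\<^sup>+x. indicator {0..1} t * indicator N (x + t *\<^sub>R e) \<partial>lborel) \<partial>lborel)
      = (\<integral>\<^sup>+x. (\<integral>\<^sup>+t. indicator {0..1::real} t * indicator N (x + t *\<^sub>R e) \<partial>lborel) \<partial>lborel)"
    by (rule lborel_pair.Fubini'[OF m, symmetric])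
  also have "\<dots> = (\<integral>\<^sup>+(x::'a). 0 \<partial>lborel)"
  proof (intro nn_integral_cong)
    fix x :: 'a
    have "AE t in lborel. t \<notin> {t. x + t *\<^sub>R e \<in> N}" using line by (rule AE_not_in)
    then have "AE t in lborel. indicator {0..1::real} t * indicator N (x + t *\<^sub>R e) = (0::ennreal)"
      by eventually_elim auto
    then have "(\<integral>\<^sup>+t. indicator {0..1::real} t * indicator N (x + t *\<^sub>R e) \<partial>lborel) = (\<integral>\<^sup>+(t::real). 0 \<partial>lborel)"
      by (rule nn_integral_cong_AE)
    then show "(\<integral>\<^sup>+t. indicator {0..1::real} t * indicator N (x + t *\<^sub>R e) \<partial>lborel) = 0" by simp
  qed
  finally have *: "(\<integral>\<^sup>+t. (\<integral>\<^sup>+x. indicator {0..1} t * indicator N (x + t *\<^sub>R e) \<partial>lborel) \<partial>lborel) = 0" by simp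
  have "(\<integral>\<^sup>+x. indicator N (x + t *\<^sub>R e) \<partial>lborel) = emeasure lborel N" for t
  proof -
    have "emeasure lborel N = (\<integral>\<^sup>+x. indicator N x \<partial>distr lborel borel ((+) (t *\<^sub>R e)))"
      by (simp add: lborel_distr_plus N)
    also have "\<dots> = (\<integral>\<^sup>+x. indicator N (t *\<^sub>R e + x) \<partial>lborel)" by (rule nn_integral_distr) (auto intro: N borel_measurable_indicator)
    finally show ?thesis by (simp add: add.commute)
  qed
  then have "(\<integral>\<^sup>+t. indicator {0..1::real} t * emeasure lborel N \<partial>lborel) = 0"
  proof -
    have "(\<integral>\<^sup>+x. indicator {0..1} t * indicator N (x + t *\<^sub>R e) \<partial>lborel)
        = indicator {0..1} t * (\<integral>\<^sup>+x. indicator N (x + t *\<^sub>R e) \<partial>lborel)" for t :: real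
      by (rule nn_integral_cmult)
        (use measurable_compose[OF _ iN, of "\<lambda>x. x + t *\<^sub>R e" lborel] in auto)
    then show ?thesis using * \<open>\<And>t. (\<integral>\<^sup>+x. indicator N (x + t *\<^sub>R e) \<partial>lborel) = emeasure lborel N\<close> by simp
  qed
  then have "emeasure lborel N = 0" by (simp add: nn_integral_multc)
  then show ?thesis using N by (auto simp: null_sets_def)
qed

theorem lipschitz_AE_differentiable_along:
  fixes f :: "'a::euclidean_space \<Rightarrow> real"
  assumes L: "L-lipschitz_on UNIV f"
  shows "AE x in lborel. (\<lambda>t. f (x + t *\<^sub>R e)) differentiable (at (0::real))"
proof -
  let ?N = "{x. \<not> (\<lambda>t. f (x + t *\<^sub>R e)) differentiable (at (0::real))}"
  have cf: "continuous_on UNIV f" using L by (rule lipschitz_on_continuous_on)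
  have "{t::real. x + t *\<^sub>R e \<in> ?N} \<in> null_sets lborel" for x
  proof -
    let ?g = "\<lambda>t::real. f (x + t *\<^sub>R e)"
    have "(L * norm e)-lipschitz_on UNIV ?g"
    proof (rule lipschitz_onI)
      fix s t :: real
      have "dist (?g s) (?g t) \<le> L * dist (x + s *\<^sub>R e) (x + t *\<^sub>R e)" using L by (rule lipschitz_onD) auto
      also have "dist (x + s *\<^sub>R e) (x + t *\<^sub>R e) = norm e * dist s t"
        by (simp add: dist_norm scaleR_diff_left[symmetric])
      finally show "dist (?g s) (?g t) \<le> L * norm e * dist s t" by (simp add: mult.assoc)
    qed (use lipschitz_on_nonneg[OF L] in auto)
    then obtain M where M: "M \<in> null_sets lborel" "\<And>t. t \<notin> M \<Longrightarrow> ?g differentiable (at t)"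
      using lipschitz_differentiable_off_null by blast
    have "t \<in> M" if t: "x + t *\<^sub>R e \<in> ?N" for t
    proof (rule ccontr)
      assume "t \<notin> M"
      then have g: "?g differentiable (at (t + 0))" using M(2) by simp
      have "(\<lambda>h. ?g (t + h)) differentiable (at 0)"
        by (rule differentiable_compose[of ?g "\<lambda>h. t + h", OF g]) (auto intro!: derivative_intros)
      then show False using t by (simp add: scaleR_left_distrib add.assoc)
    qed
    moreover have "{t::real. x + t *\<^sub>R e \<in> ?N} \<in> sets borel"
    proof -
      have "continuous_on UNIV (\<lambda>t::real. x + t *\<^sub>R e)" by (intro continuous_intros)
      then have "(\<lambda>t::real. x + t *\<^sub>R e) \<in> borel \<rightarrow>\<^sub>M borel" by (rule borel_measurable_continuous_onI)
      from measurable_sets[OF this nondifferentiable_along_borel[OF cf]]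
      have "(\<lambda>t::real. x + t *\<^sub>R e) -` ?N \<inter> space borel \<in> sets borel" .
      then show ?thesis by (simp add: vimage_def)
    qed
    ultimately show ?thesis by (intro null_sets_subset[OF M(1)]) auto
  qed
  from null_if_null_on_lines[OF nondifferentiable_along_borel[OF cf] this]
  have "?N \<in> null_sets lborel" .
  from AE_not_in[OF this] show ?thesis by simp
qed

text \<open>
  Where the derivative exists it is a limit of difference quotients along the sequence \<open>1/(n+1)\<close>; elsewhere \<^const>\<open>deriv\<close>
  is one fixed, arbitrary number.
\<close>

lemma deriv_along_measurable:
  fixes f :: "'a::euclidean_space \<Rightarrow> real"
  assumes cf: "continuous_on UNIV f"
  shows "(\<lambda>x. deriv (\<lambda>t. f (x + t *\<^sub>R e)) 0) \<in> borel_measurable borel"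
proof -
  let ?N = "{x. \<not> (\<lambda>t. f (x + t *\<^sub>R e)) differentiable (at (0::real))}"
  let ?h = "\<lambda>n::nat. inverse (real (Suc n))"
  let ?q = "\<lambda>n x. (f (x + ?h n *\<^sub>R e) - f x) / ?h n"
  have N: "?N \<in> sets borel" by (rule nondifferentiable_along_borel[OF cf])
  have "continuous_on UNIV (\<lambda>x. f (x + s *\<^sub>R e))" for s
    by (rule continuous_on_compose2[OF cf]) (auto intro!: continuous_intros)
  then have q: "?q n \<in> borel_measurable borel" for n
    unfolding divide_inverse
    by (intro borel_measurable_continuous_onI continuous_on_mult continuous_on_diff cf continuous_on_const) auto
  have eq: "deriv (\<lambda>t. f (x + t *\<^sub>R e)) 0 = (if x \<in> ?N then SOME D. False else lim (\<lambda>n. ?q n x))" for x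
  proof (cases "x \<in> ?N")
    case True
    then have "\<not> ((\<lambda>t. f (x + t *\<^sub>R e)) has_real_derivative D) (at 0)" for D
      by (auto simp: real_differentiable_def)
    then show ?thesis using True by (simp add: deriv_def)
  next
    case False
    then obtain D where D: "((\<lambda>t. f (x + t *\<^sub>R e)) has_real_derivative D) (at 0)"
      by (auto simp: real_differentiable_def)
    then have "((\<lambda>s. (f (x + s *\<^sub>R e) - f x) / s) \<longlongrightarrow> D) (at 0)" by (simp add: DERIV_def)
    moreover have "filterlim ?h (at 0) sequentially"
      using LIMSEQ_inverse_real_of_nat by (auto simp: filterlim_at simp del: of_nat_Suc)
    ultimately have "(\<lambda>n. ?q n x) \<longlonglongrightarrow> D" by (rule filterlim_compose)
    then have "lim (\<lambda>n. ?q n x) = D" by (rule limI)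
    then show ?thesis using False DERIV_imp_deriv[OF D] by simp
  qed
  have "(\<lambda>x. if x \<in> ?N then SOME D. False else lim (\<lambda>n. ?q n x)) \<in> borel_measurable borel"
  proof (rule measurable_If)
    show "(\<lambda>x. lim (\<lambda>n. ?q n x)) \<in> borel_measurable borel" by (rule borel_measurable_lim_metric[OF q])
    show "{x \<in> space borel. x \<in> ?N} \<in> sets borel" using N by simp
  qed simp
  then show ?thesis by (simp only: eq)
qed

lemma integrable_continuous_compact_support:
  fixes f :: "'a::euclidean_space \<Rightarrow> real"
  assumes "continuous_on UNIV f" "\<And>x. x \<notin> cball 0 R \<Longrightarrow> f x = 0"
  shows "integrable lborel f"
proof -
  have "integrable lborel (\<lambda>x. indicator (cball 0 R) x *\<^sub>R f x)"
    by (rule borel_integrable_compact) (use continuous_on_subset[OF assms(1)] in auto)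
  moreover have "(\<lambda>x. indicator (cball 0 R) x *\<^sub>R f x) = f"
    using assms(2) by (auto simp: fun_eq_iff indicator_def)
  ultimately show ?thesis by simp
qed

lemma lborel_translate:
  fixes f :: "'a::euclidean_space \<Rightarrow> real"
  assumes "integrable lborel f"
  shows "integrable lborel (\<lambda>x. f (x + c))" "(\<integral>x. f (x + c) \<partial>lborel) = (\<integral>x. f x \<partial>lborel)"
proof -
  have fm: "f \<in> borel_measurable borel" using assms by simp
  have "integrable (distr lborel borel ((+) c)) f" using assms by (simp add: lborel_distr_plus)
  then have "integrable lborel (\<lambda>x. f (c + x))" by (subst (asm) integrable_distr_eq) (use fm in auto)
  then show "integrable lborel (\<lambda>x. f (x + c))" by (simp add: add.commute)
  have "(\<integral>x. f x \<partial>lborel) = (\<integral>x. f x \<partial>distr lborel borel ((+) c))" by (simp add: lborel_distr_plus)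
  also have "\<dots> = (\<integral>x. f (c + x) \<partial>lborel)" by (rule integral_distr) (use fm in auto)
  finally show "(\<integral>x. f (x + c) \<partial>lborel) = (\<integral>x. f x \<partial>lborel)" by (simp add: add.commute)
qed

text \<open>
  Difference quotients of \<open>X\<close> have integral zero by translation invariance. They are bounded by the
  Lipschitz constant and vanish outside a common ball, so they converge to the derivative under the
  integral sign.
\<close>

theorem integral_deriv_along_eq_zero:
  fixes X :: "'a::euclidean_space \<Rightarrow> real"
  assumes L: "L-lipschitz_on UNIV X" and supp: "\<And>x. x \<notin> cball 0 R \<Longrightarrow> X x = 0"
  shows "integrable lborel (\<lambda>x. deriv (\<lambda>t. X (x + t *\<^sub>R e)) 0)"
    "(\<integral>x. deriv (\<lambda>t. X (x + t *\<^sub>R e)) 0 \<partial>lborel) = 0"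
proof -
  let ?h = "\<lambda>n::nat. inverse (real (Suc n))"
  let ?q = "\<lambda>n x. (X (x + ?h n *\<^sub>R e) - X x) / ?h n"
  let ?D = "\<lambda>x. deriv (\<lambda>t. X (x + t *\<^sub>R e)) 0"
  let ?w = "\<lambda>x. L * norm e * indicator (cball 0 (R + norm e)) x :: real"
  have cX: "continuous_on UNIV X" using L by (rule lipschitz_on_continuous_on)
  have iX: "integrable lborel X" by (rule integrable_continuous_compact_support[OF cX supp])
  have iq: "integrable lborel (?q n)" and zq: "(\<integral>x. ?q n x \<partial>lborel) = 0" for n
    using lborel_translate[OF iX, of "?h n *\<^sub>R e"] iX by auto
  have DM: "?D \<in> borel_measurable lborel" using deriv_along_measurable[OF cX] by simp
  have qM: "\<And>n. ?q n \<in> borel_measurable lborel" using iq by (rule borel_measurable_integrable)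
  have wI: "integrable lborel ?w"
    by (intro integrable_mult_right integrable_real_indicator) (use emeasure_bounded_finite[OF bounded_cball] in auto)
  have lim: "AE x in lborel. (\<lambda>n. ?q n x) \<longlonglongrightarrow> ?D x"
    using lipschitz_AE_differentiable_along[OF L, of e]
  proof eventually_elim
    case (elim x)
    then obtain D where D: "((\<lambda>t. X (x + t *\<^sub>R e)) has_real_derivative D) (at 0)"
      by (auto simp: real_differentiable_def)
    then have "((\<lambda>s. (X (x + s *\<^sub>R e) - X x) / s) \<longlongrightarrow> D) (at 0)" by (simp add: DERIV_def)
    moreover have "filterlim ?h (at 0) sequentially"
      using LIMSEQ_inverse_real_of_nat by (auto simp: filterlim_at simp del: of_nat_Suc)
    ultimately have "(\<lambda>n. ?q n x) \<longlonglongrightarrow> D" by (rule filterlim_compose)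
    then show ?case using DERIV_imp_deriv[OF D] by simp
  qed
  have bd: "AE x in lborel. norm (?q n x) \<le> ?w x" for n
  proof (rule AE_I2)
    fix x
    have h: "?h n > 0" "?h n \<le> 1" by (auto simp: field_simps)
    have "\<bar>X (x + ?h n *\<^sub>R e) - X x\<bar> \<le> L * dist (x + ?h n *\<^sub>R e) x"
      using lipschitz_onD[OF L, of "x + ?h n *\<^sub>R e" x] by (simp add: dist_real_def)
    also have "dist (x + ?h n *\<^sub>R e) x = ?h n * norm e" using h by (simp add: dist_norm)
    finally have "\<bar>X (x + ?h n *\<^sub>R e) - X x\<bar> \<le> L * norm e * ?h n" by (simp only: mult_ac)
    then have lip: "\<bar>?q n x\<bar> \<le> L * norm e"
      by (simp only: abs_divide abs_of_pos[OF h(1)] pos_divide_le_eq[OF h(1)])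
    show "norm (?q n x) \<le> ?w x"
    proof (cases "x \<in> cball 0 (R + norm e)")
      case False
      then have nx: "norm x > R + norm e" by simp
      have "norm (?h n *\<^sub>R e) \<le> norm e" using h by (simp add: mult_left_le_one_le)
      moreover have "norm x \<le> norm (x + ?h n *\<^sub>R e) + norm (?h n *\<^sub>R e)"
        using norm_triangle_ineq4[of "x + ?h n *\<^sub>R e" "?h n *\<^sub>R e"] by simp
      ultimately have "norm (x + ?h n *\<^sub>R e) > R" "norm x > R" using nx norm_ge_zero[of e] by linarith+
      then have "X (x + ?h n *\<^sub>R e) = 0" "X x = 0" by (auto intro!: supp)
      then show ?thesis using False by simp
    qed (use lip in simp)
  qed
  show "integrable lborel ?D" by (rule integrable_dominated_convergence[OF DM qM wI lim bd])
  have "(\<lambda>n. \<integral>x. ?q n x \<partial>lborel) \<longlonglongrightarrow> (\<integral>x. ?D x \<partial>lborel)"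
    by (rule integral_dominated_convergence[OF DM qM wI lim bd])
  then have "(\<lambda>n. 0) \<longlonglongrightarrow> (\<integral>x. ?D x \<partial>lborel)" by (simp only: zq)
  then show "(\<integral>x. ?D x \<partial>lborel) = 0" by (simp add: LIMSEQ_const_iff)
qed

section \<open>Locally Lipschitz functions\<close>

text \<open>
  The flux is a product of quotients and exponentials that are singular at the origin. It is
  globally Lipschitz only because it has compact support away from the origin, so regularity is
  tracked by a property of single points that is stable under the operations used.
\<close>

definition loc_lip_at :: "('a::metric_space \<Rightarrow> 'b::metric_space) \<Rightarrow> 'a \<Rightarrow> bool" where
  "loc_lip_at f x \<longleftrightarrow> (\<exists>e>0. \<exists>L. L-lipschitz_on (ball x e) f)"

lemma loc_lip_at_lipschitz: "L-lipschitz_on UNIV f \<Longrightarrow> loc_lip_at f x"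
  unfolding loc_lip_at_def using lipschitz_on_subset[of L UNIV f] by (meson subset_UNIV zero_less_one)

lemma loc_lip_at_const: "loc_lip_at (\<lambda>_. c) x"
  by (rule loc_lip_at_lipschitz[of 0]) (rule lipschitz_on_constant)

lemma loc_lip_at_cong:
  assumes "loc_lip_at g x" "open U" "x \<in> U" "\<And>y. y \<in> U \<Longrightarrow> f y = g y"
  shows "loc_lip_at f x"
proof -
  obtain e L where e: "e > 0" "L-lipschitz_on (ball x e) g" using assms(1) by (auto simp: loc_lip_at_def)
  obtain d where d: "d > 0" "ball x d \<subseteq> U" using assms(2,3) by (meson open_contains_ball)
  have "L-lipschitz_on (ball x (min d e)) g" using e(2) by (rule lipschitz_on_subset) auto
  moreover have "f y = g y" if "y \<in> ball x (min d e)" for y using d(2) that assms(4) by auto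
  ultimately have "L-lipschitz_on (ball x (min d e)) f" by (simp add: lipschitz_on_def)
  then show ?thesis using d e unfolding loc_lip_at_def by (intro exI[of _ "min d e"]) auto
qed

lemma loc_lip_at_common:
  assumes "loc_lip_at f x" "loc_lip_at g x"
  obtains e L M where "e > 0" "e \<le> 1" "L-lipschitz_on (ball x e) f" "M-lipschitz_on (ball x e) g"
proof -
  obtain e1 L where 1: "e1 > 0" "L-lipschitz_on (ball x e1) f" using assms by (auto simp: loc_lip_at_def)
  obtain e2 M where 2: "e2 > 0" "M-lipschitz_on (ball x e2) g" using assms by (auto simp: loc_lip_at_def)
  let ?e = "min 1 (min e1 e2)"
  have "L-lipschitz_on (ball x ?e) f" using 1(2) by (rule lipschitz_on_subset) auto
  moreover have "M-lipschitz_on (ball x ?e) g" using 2(2) by (rule lipschitz_on_subset) auto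
  ultimately show ?thesis using 1 2 that[of ?e L M] by auto
qed

lemma loc_lip_at_add:
  fixes f g :: "'a::metric_space \<Rightarrow> 'b::real_normed_vector"
  assumes "loc_lip_at f x" "loc_lip_at g x" shows "loc_lip_at (\<lambda>y. f y + g y) x"
proof -
  obtain e L M where "e > 0" "L-lipschitz_on (ball x e) f" "M-lipschitz_on (ball x e) g"
    using loc_lip_at_common[OF assms] by blast
  then show ?thesis using lipschitz_on_add[of L _ f M g] unfolding loc_lip_at_def by blast
qed

lemma loc_lip_at_mult:
  fixes f g :: "'a::metric_space \<Rightarrow> real"
  assumes "loc_lip_at f x" "loc_lip_at g x" shows "loc_lip_at (\<lambda>y. f y * g y) x"
proof -
  obtain e L M where e: "e > 0" "e \<le> 1" and L: "L-lipschitz_on (ball x e) f" and M: "M-lipschitz_on (ball x e) g"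
    using loc_lip_at_common[OF assms] by blast
  have LM: "L \<ge> 0" "M \<ge> 0" using L M lipschitz_on_nonneg by auto
  have b: "\<bar>h y\<bar> \<le> \<bar>h x\<bar> + K" if "K-lipschitz_on (ball x e) h" "y \<in> ball x e" for h :: "'a \<Rightarrow> real" and y K
  proof -
    have "dist (h x) (h y) \<le> K * dist x y" using that(1) by (rule lipschitz_onD) (use that(2) e in auto)
    also have "\<dots> \<le> K * 1" using that lipschitz_on_nonneg e by (intro mult_left_mono) auto
    finally show ?thesis by (simp add: dist_real_def)
  qed
  let ?K = "(\<bar>f x\<bar> + L) * M + (\<bar>g x\<bar> + M) * L"
  have "?K-lipschitz_on (ball x e) (\<lambda>y. f y * g y)"
  proof (rule lipschitz_onI)
    fix y z assume y: "y \<in> ball x e" and z: "z \<in> ball x e"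
    have "f y * g y - f z * g z = f y * (g y - g z) + g z * (f y - f z)" by (simp add: algebra_simps)
    then have "\<bar>f y * g y - f z * g z\<bar> \<le> \<bar>f y\<bar> * \<bar>g y - g z\<bar> + \<bar>g z\<bar> * \<bar>f y - f z\<bar>"
      by (metis abs_mult abs_triangle_ineq)
    also have "\<dots> \<le> (\<bar>f x\<bar> + L) * (M * dist y z) + (\<bar>g x\<bar> + M) * (L * dist y z)"
      using b[OF L y] b[OF M z] lipschitz_onD[OF L y z] lipschitz_onD[OF M y z] LM
      by (intro add_mono mult_mono) (auto simp: dist_real_def)
    finally show "dist (f y * g y) (f z * g z) \<le> ?K * dist y z" by (simp add: dist_real_def algebra_simps)
  qed (use LM in auto)
  then show ?thesis using e unfolding loc_lip_at_def by blast
qed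

lemma loc_lip_at_minus:
  fixes f :: "'a::metric_space \<Rightarrow> real"
  assumes "loc_lip_at f x" shows "loc_lip_at (\<lambda>y. - f y) x"
  using loc_lip_at_mult[OF loc_lip_at_const[of "-1"] assms] by simp

lemma loc_lip_at_diff:
  fixes f g :: "'a::metric_space \<Rightarrow> real"
  assumes "loc_lip_at f x" "loc_lip_at g x" shows "loc_lip_at (\<lambda>y. f y - g y) x"
  using loc_lip_at_add[OF assms(1) loc_lip_at_minus[OF assms(2)]] by simp

lemma loc_lip_at_sum:
  fixes f :: "'i \<Rightarrow> 'a::metric_space \<Rightarrow> real"
  assumes "\<And>i. i \<in> I \<Longrightarrow> loc_lip_at (f i) x" shows "loc_lip_at (\<lambda>y. \<Sum>i\<in>I. f i y) x"
  using assms by (induction I rule: infinite_finite_induct) (auto intro: loc_lip_at_const loc_lip_at_add)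

lemma loc_lip_at_compose:
  assumes f: "loc_lip_at f x" and g: "loc_lip_at g (f x)"
  shows "loc_lip_at (\<lambda>y. g (f y)) x"
proof -
  obtain e L where e: "e > 0" "L-lipschitz_on (ball x e) f" using f by (auto simp: loc_lip_at_def)
  obtain d M where d: "d > 0" "M-lipschitz_on (ball (f x) d) g" using g by (auto simp: loc_lip_at_def)
  have L: "L \<ge> 0" using e(2) by (rule lipschitz_on_nonneg)
  let ?r = "min e (d / (L + 1))"
  have im: "f ` ball x ?r \<subseteq> ball (f x) d"
  proof
    fix w assume "w \<in> f ` ball x ?r"
    then obtain y where y: "y \<in> ball x ?r" "w = f y" by auto
    have "dist (f x) (f y) \<le> L * dist x y" using e(2) by (rule lipschitz_onD) (use y e in auto)
    also have "\<dots> \<le> L * (d / (L + 1))" using y L by (intro mult_left_mono) auto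
    also have "\<dots> < d" using d L by (simp add: field_simps)
    finally show "w \<in> ball (f x) d" using y by simp
  qed
  have "L-lipschitz_on (ball x ?r) f" using e(2) by (rule lipschitz_on_subset) auto
  moreover have "M-lipschitz_on (f ` ball x ?r) g" using d(2) im by (rule lipschitz_on_subset)
  ultimately have "(M * L)-lipschitz_on (ball x ?r) (\<lambda>y. g (f y))" by (rule lipschitz_on_compose2)
  then show ?thesis unfolding loc_lip_at_def using e d L by (intro exI[of _ ?r]) auto
qed

lemma loc_lip_at_C1_real:
  fixes \<phi> :: "real \<Rightarrow> real"
  assumes U: "open U" "a \<in> U" and d: "\<And>t. t \<in> U \<Longrightarrow> (\<phi> has_real_derivative \<phi>' t) (at t)" and c: "continuous_on U \<phi>'"
  shows "loc_lip_at \<phi> a"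
proof -
  obtain e where e: "e > 0" "cball a e \<subseteq> U" using U by (meson open_contains_cball)
  have "compact (\<phi>' ` cball a e)" by (intro compact_continuous_image continuous_on_subset[OF c] e) auto
  then have "bounded (\<phi>' ` cball a e)" by (rule compact_imp_bounded)
  then obtain B where B: "\<And>t. t \<in> cball a e \<Longrightarrow> norm (\<phi>' t) \<le> B" unfolding bounded_iff by blast
  have "norm (\<phi>' a) \<le> B" using e by (intro B) auto
  then have "B \<ge> 0" using norm_ge_zero order_trans by blast
  moreover have "norm (\<phi> s - \<phi> t) \<le> B * norm (s - t)" if "s \<in> ball a e" "t \<in> ball a e" for s t
    by (rule field_differentiable_bound[of "cball a e" \<phi> \<phi>'])
      (use that e B d in \<open>auto intro: has_field_derivative_at_within simp: subset_iff\<close>)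
  ultimately have "B-lipschitz_on (ball a e) \<phi>" by (intro lipschitz_onI) (auto simp: dist_norm)
  then show ?thesis using e unfolding loc_lip_at_def by blast
qed

lemma loc_lip_at_powr:
  assumes "loc_lip_at f x" "f x > (0::real)" shows "loc_lip_at (\<lambda>y. f y powr b) x"
proof -
  have d: "((\<lambda>t. t powr b) has_real_derivative b * t powr (b - 1)) (at t)" if "t \<in> {0<..}" for t :: real
    using that by (intro has_real_derivative_powr) simp
  have c: "continuous_on {0<..} (\<lambda>t::real. b * t powr (b - 1))"
    by (intro continuous_on_mult continuous_on_const continuous_on_powr continuous_on_id) auto
  have "loc_lip_at (\<lambda>t::real. t powr b) (f x)"
    by (rule loc_lip_at_C1_real[OF _ _ d c]) (use assms(2) in auto)
  from loc_lip_at_compose[OF assms(1) this] show ?thesis .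
qed

lemma loc_lip_at_exp:
  assumes "loc_lip_at f x" shows "loc_lip_at (\<lambda>y. exp (f y :: real)) x"
proof -
  have "loc_lip_at (exp :: real \<Rightarrow> real) (f x)"
    by (rule loc_lip_at_C1_real[OF open_UNIV UNIV_I DERIV_exp]) (intro continuous_on_exp continuous_on_id)
  from loc_lip_at_compose[OF assms(1) this] show ?thesis .
qed

lemma loc_lip_at_inverse:
  assumes "loc_lip_at f x" "f x \<noteq> (0::real)" shows "loc_lip_at (\<lambda>y. inverse (f y)) x"
proof -
  have d: "(inverse has_real_derivative - (inverse t ^ Suc (Suc 0))) (at t)" if "t \<in> - {0}" for t :: real
    using DERIV_inverse[of t] that by simp
  have c: "continuous_on (- {0}) (\<lambda>t::real. - (inverse t ^ Suc (Suc 0)))"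
    by (intro continuous_on_minus continuous_on_power continuous_on_inverse continuous_on_id) auto
  have "loc_lip_at (inverse :: real \<Rightarrow> real) (f x)"
    by (rule loc_lip_at_C1_real[OF _ _ d c]) (use assms(2) in auto)
  from loc_lip_at_compose[OF assms(1) this] show ?thesis .
qed

lemma loc_lip_at_divide:
  fixes f g :: "'a::metric_space \<Rightarrow> real"
  assumes "loc_lip_at f x" "loc_lip_at g x" "g x \<noteq> 0" shows "loc_lip_at (\<lambda>y. f y / g y) x"
  unfolding divide_inverse by (intro loc_lip_at_mult loc_lip_at_inverse assms)

lemma loc_lip_at_imp_isCont: "loc_lip_at f x \<Longrightarrow> isCont f x"
proof -
  assume "loc_lip_at f x"
  then obtain e L where e: "e > 0" "L-lipschitz_on (ball x e) f" unfolding loc_lip_at_def by blast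
  have "continuous_on (ball x e) f" using e(2) by (rule lipschitz_on_continuous_on)
  then show "isCont f x" using e(1) by (simp add: continuous_on_eq_continuous_at)
qed

text \<open>
  On the compact ball of radius \<open>R + 1\<close> compactness gives one Lipschitz constant. A point of the
  support and a point outside this ball are at distance at least one, so there the bound of the
  function itself serves as Lipschitz constant.
\<close>

theorem lipschitz_of_loc_lip_compact_support:
  fixes X :: "'a::euclidean_space \<Rightarrow> real"
  assumes loc: "\<And>x. loc_lip_at X x" and supp: "\<And>x. x \<notin> cball 0 R \<Longrightarrow> X x = 0"
  obtains L where "L-lipschitz_on UNIV X"
proof -
  let ?S = "cball 0 (R + 1) :: 'a set"
  have cont: "continuous_on UNIV X" by (intro continuous_at_imp_continuous_on ballI loc_lip_at_imp_isCont loc)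
  have "local_lipschitz {0::real} ?S (\<lambda>_. X)"
  proof (rule local_lipschitzI)
    fix t :: real and x :: 'a
    obtain e L where e: "e > 0" "L-lipschitz_on (ball x e) X" using loc[of x] unfolding loc_lip_at_def by blast
    have "L-lipschitz_on (cball x (e/2) \<inter> ?S) X" using e(2) by (rule lipschitz_on_subset) (use e(1) in auto)
    then show "\<exists>u>0. \<exists>L. \<forall>t\<in>cball t u \<inter> {0}. L-lipschitz_on (cball x u \<inter> ?S) X"
      using e(1) by (intro exI[of _ "e/2"]) auto
  qed
  then obtain L where L: "L-lipschitz_on ?S X"
    using local_lipschitz_compact_implies_lipschitz[where X="?S" and T="{0::real}" and f="\<lambda>_. X"] by (auto simp: compact_cball)
  have "bounded (X ` ?S)"
    by (intro compact_imp_bounded compact_continuous_image continuous_on_subset[OF cont]) auto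
  then obtain M where M: "M > 0" "\<And>x. x \<in> ?S \<Longrightarrow> \<bar>X x\<bar> \<le> M" unfolding bounded_pos by auto
  have far: "\<bar>X x - X y\<bar> \<le> M * dist x y" if "x \<in> ?S" "y \<notin> ?S" for x y
  proof (cases "x \<in> cball 0 R")
    case True
    have "norm y \<le> norm x + dist x y" using norm_triangle_ineq2[of y x] by (simp add: dist_norm norm_minus_commute)
    then have "1 \<le> dist x y" using True that by auto
    then have "M * 1 \<le> M * dist x y" using M by (intro mult_left_mono) auto
    moreover have "X y = 0" using that by (intro supp) auto
    ultimately show ?thesis using M(2)[OF that(1)] by auto
  next
    case False
    then have "X x = 0" "X y = 0" using that by (auto intro!: supp)
    then show ?thesis using M by simp
  qed
  have "(max L M)-lipschitz_on UNIV X"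
  proof (rule lipschitz_onI)
    fix x y :: 'a
    have mx: "L * dist x y \<le> max L M * dist x y" "M * dist x y \<le> max L M * dist x y"
      by (auto intro: mult_right_mono)
    consider "x \<in> ?S" "y \<in> ?S" | "x \<in> ?S" "y \<notin> ?S" | "x \<notin> ?S" "y \<in> ?S" | "x \<notin> ?S" "y \<notin> ?S" by blast
    then show "dist (X x) (X y) \<le> max L M * dist x y"
    proof cases
      case 1 then show ?thesis using lipschitz_onD[OF L 1] mx by linarith
    next
      case 2 then show ?thesis using far[of x y] mx unfolding dist_real_def by linarith
    next
      case 3 then show ?thesis using far[of y x] mx unfolding dist_real_def
        by (simp add: dist_commute abs_minus_commute)
    next
      case 4
      then have "X x = 0" "X y = 0" by (auto intro!: supp)
      then show ?thesis using M by simp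
    qed
  qed (use M in auto)
  then show ?thesis by (rule that)
qed

section \<open>Smooth functions\<close>

lemma smooth_pd: "smooth f \<Longrightarrow> smooth (pd i f)"
proof -
  have "iter_pd is (pd i f) = iter_pd (is @ [i]) f" for "is" by (induction "is") auto
  moreover assume "smooth f"
  ultimately show "smooth (pd i f)" unfolding smooth_def by simp
qed

lemma smooth_differentiable: "smooth f \<Longrightarrow> f differentiable (at x)"
  unfolding smooth_def by (drule spec[of _ "[]"]) simp

lemma has_derivative_along:
  fixes f :: "real ^ 'n \<Rightarrow> real"
  assumes "(f has_derivative f') (at x)"
  shows "((\<lambda>t. f (x + t *\<^sub>R v)) has_real_derivative f' v) (at 0)"
proof -
  interpret bounded_linear f' using assms by (rule has_derivative_bounded_linear)
  have "((\<lambda>t. f (x + t *\<^sub>R v)) has_derivative (\<lambda>t. f' (t *\<^sub>R v))) (at 0)"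
    by (rule has_derivative_compose[of "\<lambda>t. x + t *\<^sub>R v" "\<lambda>t. t *\<^sub>R v" 0 UNIV f f'])
      (use assms in \<open>auto intro!: derivative_eq_intros\<close>)
  moreover have "(\<lambda>t. f' (t *\<^sub>R v)) = (*) (f' v)" by (auto simp: scaleR)
  ultimately show ?thesis by (simp add: has_field_derivative_def)
qed

text \<open>
  The relational counterpart of \<^const>\<open>pd\<close>: for Lipschitz coefficients the existence of a partial
  derivative is a hypothesis that has to be carried along.
\<close>

definition has_pd :: "'n \<Rightarrow> (real ^ 'n \<Rightarrow> real) \<Rightarrow> real \<Rightarrow> real ^ 'n \<Rightarrow> bool" where
  "has_pd i f D x \<longleftrightarrow> ((\<lambda>t. f (x + t *\<^sub>R axis i 1)) has_real_derivative D) (at 0)"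

lemma has_pd_imp_pd: "has_pd i f D x \<Longrightarrow> pd i f x = D"
  unfolding has_pd_def pd_def by (rule DERIV_imp_deriv)

lemma differentiable_has_pd: "f differentiable (at x) \<Longrightarrow> has_pd i f (pd i f x) x"
proof -
  assume "f differentiable (at x)"
  then obtain f' where "(f has_derivative f') (at x)" unfolding differentiable_def by blast
  from has_derivative_along[OF this, of "axis i 1"] have "has_pd i f (f' (axis i 1)) x"
    unfolding has_pd_def .
  with has_pd_imp_pd[OF this] show "has_pd i f (pd i f x) x" by simp
qed

lemma smooth_has_pd: "smooth f \<Longrightarrow> has_pd i f (pd i f x) x"
  by (intro differentiable_has_pd smooth_differentiable)

lemma smooth_continuous: "smooth f \<Longrightarrow> continuous_on UNIV f"
  by (meson continuous_at_imp_continuous_on differentiable_imp_continuous_within smooth_differentiable)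

lemma smooth_has_derivative:
  assumes "smooth f"
  shows "(f has_derivative (\<lambda>h. \<Sum>i\<in>UNIV. h $ i * pd i f x)) (at x)"
proof -
  obtain f' where f': "(f has_derivative f') (at x)"
    using smooth_differentiable[OF assms] unfolding differentiable_def by blast
  interpret bounded_linear f' using f' by (rule has_derivative_bounded_linear)
  have "f' h = (\<Sum>i\<in>UNIV. h $ i * pd i f x)" for h
  proof -
    have p: "pd i f x = f' (axis i 1)" for i
      using has_derivative_along[OF f', of "axis i 1"] unfolding has_pd_def[symmetric] by (rule has_pd_imp_pd)
    have "h = (\<Sum>i\<in>UNIV. h $ i *\<^sub>R axis i 1)" 
      using basis_expansion[of h] unfolding scalar_mult_eq_scaleR by (rule sym)
    then have "f' h = f' (\<Sum>i\<in>UNIV. h $ i *\<^sub>R axis i 1)" by (rule arg_cong)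
    also have "\<dots> = (\<Sum>i\<in>UNIV. h $ i * pd i f x)" by (simp add: sum scaleR p)
    finally show ?thesis .
  qed
  then have "f' = (\<lambda>h. \<Sum>i\<in>UNIV. h $ i * pd i f x)" by auto
  then show ?thesis using f' by simp
qed

lemma smooth_DERIV_line:
  assumes "smooth f"
  shows "((\<lambda>t. f (x + t *\<^sub>R axis i 1)) has_real_derivative pd i f (x + t *\<^sub>R axis i 1)) (at t)"
proof -
  have "((\<lambda>s. f ((x + t *\<^sub>R axis i 1) + s *\<^sub>R axis i 1)) has_real_derivative pd i f (x + t *\<^sub>R axis i 1)) (at 0)"
    using smooth_has_pd[OF assms] unfolding has_pd_def .
  then have "((\<lambda>s. f (x + (s + t) *\<^sub>R axis i 1)) has_real_derivative pd i f (x + t *\<^sub>R axis i 1)) (at 0)"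
    by (simp add: scaleR_left_distrib add_ac)
  then show ?thesis using DERIV_shift[of "\<lambda>t. f (x + t *\<^sub>R axis i 1)" "pd i f (x + t *\<^sub>R axis i 1)" 0 t] by simp
qed

text \<open>
  Two applications of the mean value theorem, first in direction \<open>i\<close> to the increment in direction
  \<open>j\<close>, then in direction \<open>j\<close>.
\<close>

lemma smooth_second_difference:
  assumes F: "smooth F" and h: "h > 0"
  obtains \<xi> \<eta> where "0 < \<xi>" "\<xi> < h" "0 < \<eta>" "\<eta> < h"
    "F (x + h *\<^sub>R axis i 1 + h *\<^sub>R axis j 1) - F (x + h *\<^sub>R axis i 1) - F (x + h *\<^sub>R axis j 1) + F x
      = h * h * pd j (pd i F) (x + \<xi> *\<^sub>R axis i 1 + \<eta> *\<^sub>R axis j 1)"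
proof -
  let ?ei = "axis i 1 :: real^'a" and ?ej = "axis j 1 :: real^'a"
  define \<psi> where "\<psi> s = F ((x + h *\<^sub>R ?ej) + s *\<^sub>R ?ei) - F (x + s *\<^sub>R ?ei)" for s
  have "\<exists>z. 0 < z \<and> z < h \<and> \<psi> h - \<psi> 0 = (h - 0) * (pd i F ((x + h *\<^sub>R ?ej) + z *\<^sub>R ?ei) - pd i F (x + z *\<^sub>R ?ei))"
    unfolding \<psi>_def by (rule MVT2[OF h]) (intro DERIV_diff smooth_DERIV_line F)
  then obtain \<xi> where xi: "0 < \<xi>" "\<xi> < h"
    "\<psi> h - \<psi> 0 = h * (pd i F ((x + h *\<^sub>R ?ej) + \<xi> *\<^sub>R ?ei) - pd i F (x + \<xi> *\<^sub>R ?ei))" by auto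
  have "\<exists>z. 0 < z \<and> z < h \<and> pd i F ((x + \<xi> *\<^sub>R ?ei) + h *\<^sub>R ?ej) - pd i F ((x + \<xi> *\<^sub>R ?ei) + 0 *\<^sub>R ?ej)
      = (h - 0) * pd j (pd i F) ((x + \<xi> *\<^sub>R ?ei) + z *\<^sub>R ?ej)"
    by (rule MVT2[OF h]) (intro smooth_DERIV_line smooth_pd F)
  then obtain \<eta> where eta: "0 < \<eta>" "\<eta> < h"
    "pd i F ((x + \<xi> *\<^sub>R ?ei) + h *\<^sub>R ?ej) - pd i F (x + \<xi> *\<^sub>R ?ei) = h * pd j (pd i F) ((x + \<xi> *\<^sub>R ?ei) + \<eta> *\<^sub>R ?ej)"
    by auto
  show ?thesis
  proof (rule that[OF xi(1,2) eta(1,2)])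
    have "F (x + h *\<^sub>R ?ei + h *\<^sub>R ?ej) - F (x + h *\<^sub>R ?ei) - F (x + h *\<^sub>R ?ej) + F x = \<psi> h - \<psi> 0"
      by (simp add: \<psi>_def add_ac)
    also have "\<dots> = h * (pd i F ((x + \<xi> *\<^sub>R ?ei) + h *\<^sub>R ?ej) - pd i F (x + \<xi> *\<^sub>R ?ei))"
      unfolding xi(3) by (simp add: add_ac)
    also have "\<dots> = h * h * pd j (pd i F) (x + \<xi> *\<^sub>R ?ei + \<eta> *\<^sub>R ?ej)" unfolding eta(3) by simp
    finally show "F (x + h *\<^sub>R ?ei + h *\<^sub>R ?ej) - F (x + h *\<^sub>R ?ei) - F (x + h *\<^sub>R ?ej) + F x
      = h * h * pd j (pd i F) (x + \<xi> *\<^sub>R ?ei + \<eta> *\<^sub>R ?ej)" .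
  qed
qed

text \<open>
  The second difference of \<open>F\<close> is symmetric in the two directions, and by continuity of the mixed
  derivatives it is asymptotic to either of them.
\<close>

theorem pd_commute:
  assumes F: "smooth F"
  shows "pd i (pd j F) x = pd j (pd i F) x"
proof -
  let ?ei = "axis i 1 :: real^'a" and ?ej = "axis j 1 :: real^'a"
  let ?A = "pd j (pd i F)" and ?B = "pd i (pd j F)"
  have ct: "isCont ?A x" "isCont ?B x"
    using smooth_continuous[OF smooth_pd[OF smooth_pd[OF F]]] by (auto simp: continuous_on_eq_continuous_at)
  have "\<bar>?A x - ?B x\<bar> \<le> e" if e: "e > 0" for e
  proof -
    have "\<forall>\<^sub>F y in at x. dist (?A y) (?A x) < e / 2" "\<forall>\<^sub>F y in at x. dist (?B y) (?B x) < e / 2"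
      using ct[unfolded isCont_def, THEN tendstoD, of "e / 2"] e by simp_all
    then obtain d1 d2 where d: "d1 > 0" "d2 > 0"
      "\<And>y. y \<noteq> x \<Longrightarrow> dist y x < d1 \<Longrightarrow> dist (?A y) (?A x) < e / 2"
      "\<And>y. y \<noteq> x \<Longrightarrow> dist y x < d2 \<Longrightarrow> dist (?B y) (?B x) < e / 2" by (auto simp: eventually_at)
    have dA: "dist (?A y) (?A x) < e / 2" if "dist y x < d1" for y using d(3)[of y] that e by (cases "y = x") auto
    have dB: "dist (?B y) (?B x) < e / 2" if "dist y x < d2" for y using d(4)[of y] that e by (cases "y = x") auto
    define h where "h = min d1 d2 / 2"
    have h: "h > 0" "2 * h \<le> d1" "2 * h \<le> d2" using d by (auto simp: h_def)
    obtain \<xi> \<eta> where 1: "0 < \<xi>" "\<xi> < h" "0 < \<eta>" "\<eta> < h"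
      "F (x + h *\<^sub>R ?ei + h *\<^sub>R ?ej) - F (x + h *\<^sub>R ?ei) - F (x + h *\<^sub>R ?ej) + F x = h * h * ?A (x + \<xi> *\<^sub>R ?ei + \<eta> *\<^sub>R ?ej)"
      by (rule smooth_second_difference[OF F h(1), of x i j]) blast
    obtain \<xi>' \<eta>' where 2: "0 < \<xi>'" "\<xi>' < h" "0 < \<eta>'" "\<eta>' < h"
      "F (x + h *\<^sub>R ?ej + h *\<^sub>R ?ei) - F (x + h *\<^sub>R ?ej) - F (x + h *\<^sub>R ?ei) + F x = h * h * ?B (x + \<xi>' *\<^sub>R ?ej + \<eta>' *\<^sub>R ?ei)"
      by (rule smooth_second_difference[OF F h(1), of x j i]) blast
    have near: "dist (x + s *\<^sub>R axis k 1 + t *\<^sub>R axis l 1) x < 2 * h" if "0 < s" "s < h" "0 < t" "t < h" for s t and k l :: 'a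
    proof -
      have "norm (s *\<^sub>R axis k 1 + t *\<^sub>R axis l 1 :: real^'a) \<le> s + t"
        using norm_triangle_ineq[of "s *\<^sub>R axis k 1 :: real^'a" "t *\<^sub>R axis l 1"] that by simp
      then show ?thesis using that by (simp add: dist_norm add.assoc)
    qed
    have "h * h * ?A (x + \<xi> *\<^sub>R ?ei + \<eta> *\<^sub>R ?ej) = h * h * ?B (x + \<xi>' *\<^sub>R ?ej + \<eta>' *\<^sub>R ?ei)"
    proof -
      have "h * h * ?A (x + \<xi> *\<^sub>R ?ei + \<eta> *\<^sub>R ?ej)
          = F (x + h *\<^sub>R ?ei + h *\<^sub>R ?ej) - F (x + h *\<^sub>R ?ei) - F (x + h *\<^sub>R ?ej) + F x" using 1(5) by simp
      also have "x + h *\<^sub>R ?ei + h *\<^sub>R ?ej = x + h *\<^sub>R ?ej + h *\<^sub>R ?ei" by (simp add: add_ac)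
      also have "F \<dots> - F (x + h *\<^sub>R ?ei) - F (x + h *\<^sub>R ?ej) + F x = h * h * ?B (x + \<xi>' *\<^sub>R ?ej + \<eta>' *\<^sub>R ?ei)"
        using 2(5) by linarith
      finally show ?thesis .
    qed
    then have "?A (x + \<xi> *\<^sub>R ?ei + \<eta> *\<^sub>R ?ej) = ?B (x + \<xi>' *\<^sub>R ?ej + \<eta>' *\<^sub>R ?ei)" using h by simp
    then show ?thesis
      using dA[OF less_le_trans[OF near h(2)], OF 1(1-4), of i j] dB[OF less_le_trans[OF near h(3)], OF 2(1-4), of j i]
      unfolding dist_real_def by linarith
  qed
  then have "\<bar>?A x - ?B x\<bar> \<le> 0" by (rule field_le_epsilon) auto
  then show ?thesis by simp
qed

lemma smooth_loc_lip_at: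
  assumes f: "smooth f" shows "loc_lip_at f x"
proof -
  let ?B = "\<lambda>y. \<Sum>i\<in>UNIV. \<bar>pd i f y\<bar>"
  have c: "continuous_on (cball x 1) ?B"
    by (intro continuous_on_sum continuous_on_rabs continuous_on_subset[OF smooth_continuous[OF smooth_pd[OF f]]]) auto
  have "bounded (?B ` cball x 1)" by (intro compact_imp_bounded compact_continuous_image c) auto
  then obtain M where M: "M > 0" "\<And>y. y \<in> cball x 1 \<Longrightarrow> \<bar>?B y\<bar> \<le> M" unfolding bounded_pos by auto
  have "M-lipschitz_on (ball x 1) f"
  proof (rule lipschitz_onI)
    fix y z assume yz: "y \<in> ball x 1" "z \<in> ball x 1"
    have "norm (f y - f z) \<le> M * norm (y - z)"
    proof (rule differentiable_bound[of "ball x 1" f "\<lambda>w h. \<Sum>i\<in>UNIV. h $ i * pd i f w"])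
      fix w assume w: "w \<in> ball x 1"
      show "(f has_derivative (\<lambda>h. \<Sum>i\<in>UNIV. h $ i * pd i f w)) (at w within ball x 1)"
        by (rule has_derivative_at_withinI[OF smooth_has_derivative[OF f]])
      show "onorm (\<lambda>h. \<Sum>i\<in>UNIV. h $ i * pd i f w) \<le> M"
      proof (rule onorm_le)
        fix h :: "real^'a"
        have "norm (\<Sum>i\<in>UNIV. h $ i * pd i f w) \<le> (\<Sum>i\<in>UNIV. norm h * \<bar>pd i f w\<bar>)"
          by (rule sum_norm_le) (auto simp: abs_mult intro!: mult_right_mono component_le_norm_cart)
        also have "\<dots> = norm h * ?B w" by (simp add: sum_distrib_left)
        also have "\<dots> \<le> norm h * M" using M(2)[of w] w by (intro mult_left_mono) auto
        finally show "norm (\<Sum>i\<in>UNIV. h $ i * pd i f w) \<le> M * norm h" by (simp add: mult.commute)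
      qed
    qed (use yz in auto)
    then show "dist (f y) (f z) \<le> M * dist y z" by (simp add: dist_norm)
  qed (use M in auto)
  then show ?thesis unfolding loc_lip_at_def by (intro exI[of _ 1]) auto
qed

section \<open>Symmetric matrices\<close>

lemma symmetric_matrix_inner: "transpose A = A \<Longrightarrow> (A *v x) \<bullet> y = x \<bullet> (A *v (y :: real ^ 'n))"
proof -
  assume "transpose A = A"
  then have "A *v x = x v* A" using transpose_matrix_vector[of A x] by simp
  then show ?thesis by (simp only: dot_lmul_matrix)
qed

lemma inner_matrix_vector_sum: "(A *v x) \<bullet> (y :: real ^ 'n) = (\<Sum>i\<in>UNIV. \<Sum>j\<in>UNIV. A $ i $ j * x $ j * y $ i)"
  by (simp add: inner_vec_def matrix_vector_mult_def sum_distrib_right)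

lemma quadratic_form_sum: "(\<Sum>i\<in>UNIV. \<Sum>j\<in>UNIV. A $ i $ j * x $ i * y $ j) = (A *v y) \<bullet> (x :: real ^ 'n)"
  by (simp add: inner_matrix_vector_sum mult_ac)

text \<open>
  The form at \<open>v + t Av\<close> is \<open>2t |Av|\<^sup>2 + O(t\<^sup>2)\<close>, which would be negative for small negative \<open>t\<close> if
  \<open>Av\<close> did not vanish.
\<close>

lemma psd_null_vector:
  fixes A :: "real ^ 'n ^ 'n"
  assumes sym: "transpose A = A" and psd: "\<And>x. (A *v x) \<bullet> x \<ge> 0" and z: "(A *v v) \<bullet> v = 0"
  shows "A *v v = 0"
proof -
  let ?w = "A *v v"
  let ?c = "(A *v ?w) \<bullet> ?w"
  have "0 \<le> 2 * t * (?w \<bullet> ?w) + t\<^sup>2 * ?c" for t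
  proof -
    have "(A *v (v + t *\<^sub>R ?w)) \<bullet> (v + t *\<^sub>R ?w) = ?w \<bullet> v + t * (?w \<bullet> ?w) + t * ((A *v ?w) \<bullet> v) + t * t * ?c"
      by (simp add: matrix_vector_right_distrib matrix_vector_mult_scaleR inner_add_left inner_add_right algebra_simps)
    also have "(A *v ?w) \<bullet> v = ?w \<bullet> ?w" by (rule symmetric_matrix_inner[OF sym])
    finally show ?thesis using psd[of "v + t *\<^sub>R ?w"] z by (simp add: power2_eq_square)
  qed note poly = this
  have c0: "?c \<ge> 0" by (rule psd)
  define W where "W = ?w \<bullet> ?w"
  have W0: "W \<ge> 0" by (simp add: W_def)
  have "W \<le> 0"
  proof (rule ccontr)
    assume "\<not> W \<le> 0"
    then have Wp: "W > 0" by simp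
    \<comment> \<open>A step length for which the linear term beats the quadratic one.\<close>
    define d where "d = W / (?c + 1)"
    have d: "d > 0" "W = d * (?c + 1)" using Wp c0 by (simp_all add: d_def)
    have "0 \<le> 2 * (- d) * (d * (?c + 1)) + (- d)\<^sup>2 * ?c" using poly[of "- d"] d(2) unfolding W_def by simp
    also have "\<dots> = - (d\<^sup>2 * (?c + 2))" by (simp add: power2_eq_square algebra_simps)
    also have "\<dots> < 0" using d(1) c0 by simp
    finally show False by simp
  qed
  then have "W = 0" using W0 by simp
  then show ?thesis unfolding W_def by (simp only: inner_eq_zero_iff)
qed

text \<open>
  The minimum of the form over the unit sphere is attained, and a minimiser is a null vector of the
  positive semidefinite matrix \<open>A - \<mu>\<close>.
\<close>

lemma symmetric_least_eigenvalue:
  fixes A :: "real ^ 'n ^ 'n"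
  assumes sym: "transpose A = A"
  shows "\<exists>\<mu>\<in>eigenvalues A. \<forall>x. \<mu> * (norm x)\<^sup>2 \<le> (A *v x) \<bullet> x"
proof -
  let ?f = "\<lambda>x::real^'n. (A *v x) \<bullet> x"
  have cont: "continuous_on (sphere 0 1) ?f"
    by (intro continuous_on_inner linear_continuous_on matrix_vector_mul_bounded_linear continuous_on_id)
  have "sphere (0::real^'n) 1 \<noteq> {}" using norm_axis_1[of undefined] by (metis empty_iff mem_sphere_0)
  then obtain v where v: "norm v = 1" "\<And>y. norm y = 1 \<Longrightarrow> ?f v \<le> ?f y"
    using continuous_attains_inf[OF compact_sphere _ cont] by (metis mem_sphere_0)
  define \<mu> where "\<mu> = ?f v"
  have lower: "\<mu> * (norm x)\<^sup>2 \<le> ?f x" for x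
  proof (cases "x = 0")
    case False
    let ?y = "(1 / norm x) *\<^sub>R x"
    have "\<mu> \<le> ?f ?y" unfolding \<mu>_def by (rule v(2)) (use False in simp)
    also have "?f ?y = ?f x / (norm x)\<^sup>2"
      by (simp add: matrix_vector_mult_scaleR power2_eq_square)
    finally show ?thesis using False by (simp add: field_simps)
  qed simp
  let ?B = "A - mat \<mu>"
  have Bv: "?B *v x = A *v x - \<mu> *\<^sub>R x" for x
  proof -
    have "mat \<mu> *v x = \<mu> *\<^sub>R x"
      by (simp add: vec_eq_iff matrix_vector_mult_def mat_def if_distrib if_distribR sum.delta cong: if_cong)
    then show ?thesis by (simp add: matrix_vector_mult_diff_rdistrib)
  qed
  have "?B *v v = 0"
  proof (rule psd_null_vector)
    show "transpose ?B = ?B" using sym by (simp add: transpose_def vec_eq_iff mat_def)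
    show "(?B *v x) \<bullet> x \<ge> 0" for x using lower[of x] by (simp add: Bv inner_diff_left dot_square_norm)
    show "(?B *v v) \<bullet> v = 0" 
      by (simp only: Bv inner_diff_left) (use v(1) in \<open>simp add: dot_square_norm \<mu>_def\<close>)
  qed
  then have "A *v v = \<mu> *\<^sub>R v" by (simp add: Bv)
  moreover have "v \<noteq> 0" using v(1) by auto
  ultimately have "\<mu> \<in> eigenvalues A" by (auto simp: eigenvalues_def)
  then show ?thesis using lower by blast
qed

lemma psd_Cauchy_Schwarz:
  fixes A :: "real ^ 'n ^ 'n"
  assumes sym: "transpose A = A" and psd: "\<And>x. (A *v x) \<bullet> x \<ge> 0"
  shows "((A *v x) \<bullet> y)\<^sup>2 \<le> ((A *v x) \<bullet> x) * ((A *v y) \<bullet> y)"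
proof -
  let ?a = "(A *v x) \<bullet> x" and ?b = "(A *v x) \<bullet> y" and ?c = "(A *v y) \<bullet> y"
  have e: "(A *v (s *\<^sub>R x + t *\<^sub>R y)) \<bullet> (s *\<^sub>R x + t *\<^sub>R y) = s\<^sup>2 * ?a + 2 * s * t * ?b + t\<^sup>2 * ?c" for s t
    using symmetric_matrix_inner[OF sym, of y x]
    by (simp add: matrix_vector_right_distrib matrix_vector_mult_scaleR inner_add_left inner_add_right
       inner_commute[of y] power2_eq_square algebra_simps)
  show ?thesis
  proof (cases "?c = 0")
    case True
    then have "A *v y = 0" by (rule psd_null_vector[OF sym psd])
    then have "?b = 0" using symmetric_matrix_inner[OF sym, of x y] by simp
    then show ?thesis using True by simp
  next
    case False
    then have c: "?c > 0" using psd[of y] by simp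
    have "0 \<le> ?c\<^sup>2 * ?a + 2 * ?c * (- ?b) * ?b + (- ?b)\<^sup>2 * ?c"
      using psd[of "?c *\<^sub>R x + (- ?b) *\<^sub>R y"] unfolding e .
    also have "\<dots> = ?c * (?a * ?c - ?b\<^sup>2)" by (simp add: power2_eq_square algebra_simps)
    finally show ?thesis using c by (simp add: zero_le_mult_iff)
  qed
qed

text \<open>
  The Cauchy-Schwarz inequality for \<open>A\<close> applied to \<open>x\<close> and \<open>Ax\<close> gives
  \<open>|Ax|\<^sup>4 \<le> (Ax,x) (AAx,Ax) \<le> b\<^sup>2 |x|\<^sup>2 |Ax|\<^sup>2\<close>.
\<close>

lemma psd_norm_bound:
  fixes A :: "real ^ 'n ^ 'n"
  assumes sym: "transpose A = A" and psd: "\<And>x. (A *v x) \<bullet> x \<ge> 0"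
    and ub: "\<And>x. (A *v x) \<bullet> x \<le> b * (norm x)\<^sup>2"
  shows "norm (A *v x) \<le> b * norm x"
proof (cases "A *v x = 0")
  case True
  have "0 \<le> b * (norm (axis undefined 1 :: real^'n))\<^sup>2" using psd ub order_trans by blast
  then show ?thesis using True by simp
next
  case False
  have b0: "0 \<le> b"
  proof -
    have "0 \<le> b * (norm (axis undefined 1 :: real^'n))\<^sup>2" using psd ub order_trans by blast
    then show ?thesis by simp
  qed
  let ?N = "norm (A *v x)"
  have "((A *v x) \<bullet> (A *v x))\<^sup>2 \<le> ((A *v x) \<bullet> x) * ((A *v (A *v x)) \<bullet> (A *v x))"
    by (rule psd_Cauchy_Schwarz[OF sym psd])
  also have "\<dots> \<le> (b * (norm x)\<^sup>2) * (b * ?N\<^sup>2)" by (intro mult_mono ub psd) (use b0 in auto)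
  finally have "(?N\<^sup>2)\<^sup>2 \<le> (b * norm x)\<^sup>2 * ?N\<^sup>2"
    by (simp add: dot_square_norm power_mult_distrib mult_ac power2_eq_square)
  then have "?N\<^sup>2 * ?N\<^sup>2 \<le> (b * norm x)\<^sup>2 * ?N\<^sup>2" by (simp only: power2_eq_square)
  then have "?N\<^sup>2 \<le> (b * norm x)\<^sup>2" by (rule mult_right_le_imp_le) (use False in simp)
  then show ?thesis by (rule power2_le_imp_le) (use b0 in simp)
qed

text \<open>
  The upper bound is the lower bound for \<open>-\<Gamma>\<close>.
\<close>

lemma eigenvalue_bounds:
  fixes \<Gamma> :: "real ^ 'n ^ 'n"
  assumes sym: "transpose \<Gamma> = \<Gamma>" and pos: "\<And>x. x \<noteq> 0 \<Longrightarrow> 0 < (\<Gamma> *v x) \<bullet> x"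
    and ev: "\<And>\<mu>. \<mu> \<in> eigenvalues \<Gamma> \<Longrightarrow> m \<le> \<mu> \<and> \<mu> \<le> M"
  shows "m * (norm x)\<^sup>2 \<le> (\<Gamma> *v x) \<bullet> x" "(\<Gamma> *v x) \<bullet> x \<le> M * (norm x)\<^sup>2" "norm (\<Gamma> *v x) \<le> M * norm x"
proof -
  obtain \<mu> where mu: "\<mu> \<in> eigenvalues \<Gamma>" "\<And>x. \<mu> * (norm x)\<^sup>2 \<le> (\<Gamma> *v x) \<bullet> x"
    using symmetric_least_eigenvalue[OF sym] by blast
  have "m * (norm x)\<^sup>2 \<le> \<mu> * (norm x)\<^sup>2" using ev[OF mu(1)] by (intro mult_right_mono) auto
  then show "m * (norm x)\<^sup>2 \<le> (\<Gamma> *v x) \<bullet> x" using mu(2)[of x] by linarith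
  have "transpose (- \<Gamma>) = - \<Gamma>" using sym by (simp add: transpose_def vec_eq_iff)
  then obtain \<nu> where nu: "\<nu> \<in> eigenvalues (- \<Gamma>)" "\<And>x. \<nu> * (norm x)\<^sup>2 \<le> (- \<Gamma> *v x) \<bullet> x"
    using symmetric_least_eigenvalue by blast
  have neg: "- \<Gamma> *v x = - (\<Gamma> *v x)" for x
    by (simp add: vec_eq_iff matrix_vector_mult_def sum_negf)
  have "- \<nu> \<in> eigenvalues \<Gamma>" using nu(1) unfolding eigenvalues_def
    by (auto simp: neg) (metis minus_equation_iff scaleR_minus_left)
  then have "- M \<le> \<nu>" using ev by force
  then have "- M * (norm x)\<^sup>2 \<le> \<nu> * (norm x)\<^sup>2" for x :: "real^'n" by (intro mult_right_mono) auto
  then have ub: "(\<Gamma> *v x) \<bullet> x \<le> M * (norm x)\<^sup>2" for x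
    using nu(2)[of x] by (smt (verit) neg inner_minus_left mult_minus_left)
  then show "(\<Gamma> *v x) \<bullet> x \<le> M * (norm x)\<^sup>2" .
  have psd: "(\<Gamma> *v x) \<bullet> x \<ge> 0" for x using pos[of x] by (cases "x = 0") auto
  show "norm (\<Gamma> *v x) \<le> M * norm x" by (rule psd_norm_bound[OF sym psd ub])
qed

section \<open>Calculus of partial derivatives\<close>

lemma eventually_on_axis_line:
  fixes x :: "real ^ 'n"
  assumes "open U" "x \<in> U"
  shows "\<forall>\<^sub>F t in nhds (0::real). x + t *\<^sub>R axis i 1 \<in> U"
proof -
  have "((\<lambda>t::real. x + t *\<^sub>R axis i 1) \<longlongrightarrow> x + 0 *\<^sub>R axis i 1) (at 0)" by (intro tendsto_intros)
  then have "\<forall>\<^sub>F t in at (0::real). x + t *\<^sub>R axis i 1 \<in> U" using assms by (intro topological_tendstoD) auto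
  then show ?thesis using assms(2) by (auto simp: eventually_nhds_conv_at)
qed

lemma has_pd_cong:
  assumes "has_pd i g D x" "open U" "x \<in> U" "\<And>y. y \<in> U \<Longrightarrow> f y = g y"
  shows "has_pd i f D x"
proof -
  have "\<forall>\<^sub>F t in nhds 0. f (x + t *\<^sub>R axis i 1) = g (x + t *\<^sub>R axis i 1)"
    by (rule eventually_mono[OF eventually_on_axis_line[OF assms(2,3)]]) (rule assms(4))
  then show ?thesis using assms(1) unfolding has_pd_def by (subst DERIV_cong_ev) auto
qed

lemma pd_cong:
  assumes "open U" "x \<in> U" "\<And>y. y \<in> U \<Longrightarrow> f y = g y"
  shows "pd i f x = pd i g x"
proof -
  have "\<forall>\<^sub>F t in nhds 0. f (x + t *\<^sub>R axis i 1) = g (x + t *\<^sub>R axis i 1)"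
    by (rule eventually_mono[OF eventually_on_axis_line[OF assms(1,2)]]) (rule assms(3))
  then show ?thesis unfolding pd_def by (rule deriv_cong_ev) simp
qed

lemma has_pd_const: "has_pd i (\<lambda>_. c) 0 x"
  by (simp add: has_pd_def)
lemma has_pd_add: "has_pd i f F x \<Longrightarrow> has_pd i g G x \<Longrightarrow> has_pd i (\<lambda>y. f y + g y) (F + G) x"
  unfolding has_pd_def by (rule DERIV_add)
lemma has_pd_diff: "has_pd i f F x \<Longrightarrow> has_pd i g G x \<Longrightarrow> has_pd i (\<lambda>y. f y - g y) (F - G) x"
  unfolding has_pd_def by (rule DERIV_diff)
lemma has_pd_mult: "has_pd i f F x \<Longrightarrow> has_pd i g G x \<Longrightarrow> has_pd i (\<lambda>y. f y * g y) (F * g x + f x * G) x"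
  unfolding has_pd_def by (drule (1) DERIV_mult) (simp add: algebra_simps)
lemma has_pd_cmult: "has_pd i f F x \<Longrightarrow> has_pd i (\<lambda>y. c * f y) (c * F) x"
  unfolding has_pd_def by (rule DERIV_cmult)
lemma has_pd_divide:
  "has_pd i f F x \<Longrightarrow> has_pd i g G x \<Longrightarrow> g x \<noteq> 0 \<Longrightarrow> has_pd i (\<lambda>y. f y / g y) (F / g x - f x * G / (g x)\<^sup>2) x"
  unfolding has_pd_def
  by (drule (1) DERIV_divide, simp) (simp add: power2_eq_square diff_divide_distrib)
lemma has_pd_sum: "(\<And>j. j \<in> I \<Longrightarrow> has_pd i (f j) (F j) x) \<Longrightarrow> has_pd i (\<lambda>y. \<Sum>j\<in>I. f j y) (\<Sum>j\<in>I. F j) x"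
  unfolding has_pd_def by (rule DERIV_sum)
lemma has_pd_chain: "has_pd i f F x \<Longrightarrow> (\<phi> has_real_derivative D) (at (f x)) \<Longrightarrow> has_pd i (\<lambda>y. \<phi> (f y)) (D * F) x"
  unfolding has_pd_def using DERIV_chain2[of \<phi> D "\<lambda>t. f (x + t *\<^sub>R axis i 1)" 0 F] by simp

lemma has_pd_component: "has_pd i (\<lambda>y. (A *v y) $ k) ((A *v axis i 1) $ k) x"
proof -
  have "((\<lambda>t. (A *v x) $ k + t * (A *v axis i 1) $ k) has_real_derivative (A *v axis i 1) $ k) (at 0)"
    by (auto intro!: derivative_eq_intros)
  then show ?thesis unfolding has_pd_def
    by (simp add: matrix_vector_right_distrib matrix_vector_mult_scaleR)
qed

lemma has_pd_inner_const: 
  assumes "\<And>k. has_pd i (\<lambda>y. f y $ k) (F $ k) x" "\<And>k. has_pd i (\<lambda>y. g y $ k) (G $ k) x"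
  shows "has_pd i (\<lambda>y. f y \<bullet> g y) (F \<bullet> g x + f x \<bullet> (G :: real ^ 'n)) x"
  unfolding inner_vec_def inner_real_def sum.distrib[symmetric]
  by (intro has_pd_sum has_pd_mult assms)

section \<open>The number \<open>\<omega>\<^sub>0\<close> in closed form\<close>

text \<open>
  The shape of \<open>(S\<^sup>(\<^sup>0\<^sup>) \<xi>,\<xi>)\<close>: here \<open>c\<close> stands for \<open>div B\<^sub>0 - F\<close> and \<open>b k j\<close> for \<open>\<partial>\<^sub>k B\<^sub>0\<^sup>j\<close>. The two
  derivative terms are transposes of each other and so contribute equally to the form.
\<close>

lemma S0_form:
  fixes G :: "real ^ 'n ^ 'n" and b :: "'n \<Rightarrow> 'n \<Rightarrow> real"
  assumes symG: "transpose G = G"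
  shows "((\<chi> i j. 1 / 2 * (c * G $ i $ j - (\<Sum>k\<in>UNIV. b k j * G $ k $ i) - (\<Sum>k\<in>UNIV. b k i * G $ k $ j))) *v \<xi>) \<bullet> \<xi>
    = c / 2 * ((G *v \<xi>) \<bullet> \<xi>) - (\<Sum>k\<in>UNIV. \<Sum>j\<in>UNIV. b k j * \<xi> $ j * (G *v \<xi>) $ k)"
proof -
  have 1: "(\<Sum>i\<in>UNIV. \<Sum>j\<in>UNIV. (\<Sum>k\<in>UNIV. b k j * G $ k $ i) * \<xi> $ j * \<xi> $ i)
      = (\<Sum>k\<in>UNIV. \<Sum>j\<in>UNIV. b k j * \<xi> $ j * (G *v \<xi>) $ k)"
  proof -
    have "(\<Sum>i\<in>UNIV. \<Sum>j\<in>UNIV. (\<Sum>k\<in>UNIV. b k j * G $ k $ i) * \<xi> $ j * \<xi> $ i)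
       = (\<Sum>i\<in>UNIV. \<Sum>j\<in>UNIV. \<Sum>k\<in>UNIV. b k j * \<xi> $ j * (G $ k $ i * \<xi> $ i))"
      by (intro sum.cong refl, simp only: sum_distrib_right, intro sum.cong refl, simp only: mult_ac)
    also have "\<dots> = (\<Sum>j\<in>UNIV. \<Sum>i\<in>UNIV. \<Sum>k\<in>UNIV. b k j * \<xi> $ j * (G $ k $ i * \<xi> $ i))" by (rule sum.swap)
    also have "\<dots> = (\<Sum>j\<in>UNIV. \<Sum>k\<in>UNIV. \<Sum>i\<in>UNIV. b k j * \<xi> $ j * (G $ k $ i * \<xi> $ i))"
      by (rule sum.cong[OF refl]) (rule sum.swap)
    also have "\<dots> = (\<Sum>k\<in>UNIV. \<Sum>j\<in>UNIV. \<Sum>i\<in>UNIV. b k j * \<xi> $ j * (G $ k $ i * \<xi> $ i))" by (rule sum.swap)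
    also have "\<dots> = (\<Sum>k\<in>UNIV. \<Sum>j\<in>UNIV. b k j * \<xi> $ j * (G *v \<xi>) $ k)"
      by (simp add: matrix_vector_mult_def sum_distrib_left)
    finally show ?thesis .
  qed
  have 2: "(\<Sum>i\<in>UNIV. \<Sum>j\<in>UNIV. (\<Sum>k\<in>UNIV. b k i * G $ k $ j) * \<xi> $ j * \<xi> $ i)
     = (\<Sum>i\<in>UNIV. \<Sum>j\<in>UNIV. (\<Sum>k\<in>UNIV. b k j * G $ k $ i) * \<xi> $ j * \<xi> $ i)"
    by (subst sum.swap) (simp add: mult_ac)
  have "((\<chi> i j. 1 / 2 * (c * G $ i $ j - (\<Sum>k\<in>UNIV. b k j * G $ k $ i) - (\<Sum>k\<in>UNIV. b k i * G $ k $ j))) *v \<xi>) \<bullet> \<xi>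
    = c / 2 * (\<Sum>i\<in>UNIV. \<Sum>j\<in>UNIV. G $ i $ j * \<xi> $ j * \<xi> $ i)
     - (1/2) * (\<Sum>i\<in>UNIV. \<Sum>j\<in>UNIV. (\<Sum>k\<in>UNIV. b k j * G $ k $ i) * \<xi> $ j * \<xi> $ i)
     - (1/2) * (\<Sum>i\<in>UNIV. \<Sum>j\<in>UNIV. (\<Sum>k\<in>UNIV. b k i * G $ k $ j) * \<xi> $ j * \<xi> $ i)"
    unfolding inner_matrix_vector_sum sum_distrib_left sum_subtractf[symmetric]
    by (intro sum.cong refl) (simp add: algebra_simps)
  then show ?thesis unfolding 2 1 by (simp add: inner_matrix_vector_sum)
qed

text \<open>
  A frozen metric \<open>G = g(0)\<close> together with \<open>\<Gamma>\<close>, both positive definite, with one constant for all bounds.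
  Since \<open>\<nabla>\<sigma> = \<Gamma>x/\<sigma>\<close>, everything in the definition of \<open>\<omega>\<^sub>0\<close> is expressed by the quadratic forms \<open>s = \<sigma>\<^sup>2\<close>,
  \<open>q = (Gy,y)\<close> and \<open>P = (\<Gamma>Gy,Gy)\<close> of \<open>y = \<Gamma>x\<close> and by the trace \<open>T\<close> of \<open>G\<Gamma>\<close>.
\<close>

locale gram_pair =
  fixes G \<Gamma> :: "real ^ 'n ^ 'n" and K :: real
  assumes symG: "transpose G = G" and sym\<Gamma>: "transpose \<Gamma> = \<Gamma>" and K: "K > 0"
    and ellG: "(norm x)\<^sup>2 \<le> K * ((G *v x) \<bullet> x)" and ell\<Gamma>: "(norm x)\<^sup>2 \<le> K * ((\<Gamma> *v x) \<bullet> x)"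
    and normG: "norm (G *v x) \<le> K * norm x" and norm\<Gamma>: "norm (\<Gamma> *v x) \<le> K * norm x"
begin

definition s :: "real ^ 'n \<Rightarrow> real" where "s x = (\<Gamma> *v x) \<bullet> x"
definition q :: "real ^ 'n \<Rightarrow> real" where "q x = (G *v (\<Gamma> *v x)) \<bullet> (\<Gamma> *v x)"
definition P :: "real ^ 'n \<Rightarrow> real" where "P x = (\<Gamma> *v (G *v (\<Gamma> *v x))) \<bullet> (G *v (\<Gamma> *v x))"
definition T :: real where "T = (\<Sum>k\<in>UNIV. (G *v (\<Gamma> *v axis k 1)) $ k)"

lemma innerG: "(G *v x) \<bullet> y = x \<bullet> (G *v y)" by (rule symmetric_matrix_inner[OF symG])
lemma inner\<Gamma>: "(\<Gamma> *v x) \<bullet> y = x \<bullet> (\<Gamma> *v y)" by (rule symmetric_matrix_inner[OF sym\<Gamma>])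

lemma posG: "x \<noteq> 0 \<Longrightarrow> (G *v x) \<bullet> x > 0"
  using ellG[of x] K by (smt (verit) mult_nonneg_nonpos zero_less_norm_iff zero_less_power)
lemma pos\<Gamma>: "x \<noteq> 0 \<Longrightarrow> (\<Gamma> *v x) \<bullet> x > 0"
  using ell\<Gamma>[of x] K by (smt (verit) mult_nonneg_nonpos zero_less_norm_iff zero_less_power)
lemma nonnegG: "(G *v x) \<bullet> x \<ge> 0" using posG[of x] by (cases "x = 0") auto
lemma nonneg\<Gamma>: "(\<Gamma> *v x) \<bullet> x \<ge> 0" using pos\<Gamma>[of x] by (cases "x = 0") auto
lemma s_pos: "x \<noteq> 0 \<Longrightarrow> s x > 0" unfolding s_def by (rule pos\<Gamma>)
lemma \<Gamma>_nonzero: "x \<noteq> 0 \<Longrightarrow> \<Gamma> *v x \<noteq> 0" using pos\<Gamma>[of x] by auto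
lemma q_pos: "x \<noteq> 0 \<Longrightarrow> q x > 0" unfolding q_def by (intro posG \<Gamma>_nonzero)
lemma sigma_eq: "sigma_norm \<Gamma> x = sqrt (s x)" by (simp add: sigma_norm_def s_def)
lemma sigma_pos: "x \<noteq> 0 \<Longrightarrow> sigma_norm \<Gamma> x > 0" by (simp add: sigma_eq s_pos)
lemma sigma_sq: "sigma_norm \<Gamma> x * sigma_norm \<Gamma> x = s x" using nonneg\<Gamma>[of x] by (simp add: sigma_eq s_def)

lemma inner_axis_comp: "x \<bullet> axis k 1 = (x :: real ^ 'n) $ k" "axis k 1 \<bullet> x = x $ k"
  by (simp_all add: inner_axis inner_axis')

lemma has_pd_vec: "has_pd i (\<lambda>y. y $ k) (axis i 1 $ k) (x :: real ^ 'n)"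
  using has_pd_component[of i "mat 1" k x] by simp

lemma has_pd_comp2: "has_pd i (\<lambda>y. (A *v (B *v y)) $ k) ((A *v (B *v axis i 1)) $ k) (x :: real ^ 'n)"
  using has_pd_component[of i "A ** B" k x] by (simp add: matrix_vector_mul_assoc)

lemma has_pd_s: "has_pd i s (2 * (\<Gamma> *v x) $ i) x"
proof -
  have "has_pd i (\<lambda>y. (\<Gamma> *v y) \<bullet> y) ((\<Gamma> *v axis i 1) \<bullet> x + (\<Gamma> *v x) \<bullet> axis i 1) x"
    by (rule has_pd_inner_const) (rule has_pd_component has_pd_vec)+
  moreover have "(\<Gamma> *v axis i 1) \<bullet> x + (\<Gamma> *v x) \<bullet> axis i 1 = 2 * (\<Gamma> *v x) $ i"
  proof -
    have "(\<Gamma> *v axis i 1) \<bullet> x = (\<Gamma> *v x) $ i" by (simp only: inner\<Gamma> inner_axis_comp)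
    then show ?thesis by (simp add: inner_axis_comp(1))
  qed
  ultimately show ?thesis by (simp add: s_def[abs_def])
qed

lemma has_pd_q: "has_pd i q (2 * (\<Gamma> *v (G *v (\<Gamma> *v x))) $ i) x"
proof -
  have "has_pd i (\<lambda>y. (G *v (\<Gamma> *v y)) \<bullet> (\<Gamma> *v y))
     ((G *v (\<Gamma> *v axis i 1)) \<bullet> (\<Gamma> *v x) + (G *v (\<Gamma> *v x)) \<bullet> (\<Gamma> *v axis i 1)) x"
    by (rule has_pd_inner_const) (rule has_pd_component has_pd_comp2)+
  moreover have "(G *v (\<Gamma> *v axis i 1)) \<bullet> (\<Gamma> *v x) = (\<Gamma> *v (G *v (\<Gamma> *v x))) $ i"
    by (simp only: innerG inner\<Gamma> inner_axis_comp)
  moreover have "(G *v (\<Gamma> *v x)) \<bullet> (\<Gamma> *v axis i 1) = (\<Gamma> *v (G *v (\<Gamma> *v x))) $ i"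
    by (simp only: inner\<Gamma>[symmetric] inner_axis_comp)
  ultimately show ?thesis by (simp add: q_def[abs_def])
qed

lemma has_pd_sigma: assumes "x \<noteq> 0" shows "has_pd i (sigma_norm \<Gamma>) ((\<Gamma> *v x) $ i / sigma_norm \<Gamma> x) x"
proof -
  have "has_pd i (\<lambda>y. sqrt (s y)) (inverse (sqrt (s x)) / 2 * (2 * (\<Gamma> *v x) $ i)) x"
    by (rule has_pd_chain[OF has_pd_s]) (rule DERIV_real_sqrt[OF s_pos[OF assms]])
  moreover have "inverse (sqrt (s x)) / 2 * (2 * (\<Gamma> *v x) $ i) = (\<Gamma> *v x) $ i / sqrt (s x)"
    by (simp add: field_simps)
  moreover have "sigma_norm \<Gamma> = (\<lambda>y. sqrt (s y))" by (rule ext) (rule sigma_eq)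
  ultimately show ?thesis by (simp only:)
qed

lemma pd_sigma: "x \<noteq> 0 \<Longrightarrow> pd i (sigma_norm \<Gamma>) x = (\<Gamma> *v x) $ i / sigma_norm \<Gamma> x"
  by (rule has_pd_imp_pd[OF has_pd_sigma])

lemma open_nonzero: "open (- {0 :: real ^ 'n})" by (rule open_Compl) simp

lemma pd_pd_sigma:
  assumes x: "x \<noteq> 0"
  shows "pd i (pd j (sigma_norm \<Gamma>)) x
     = (\<Gamma> *v axis i 1) $ j / sigma_norm \<Gamma> x - (\<Gamma> *v x) $ j * (\<Gamma> *v x) $ i / (sigma_norm \<Gamma> x * s x)"
proof -
  have "has_pd i (\<lambda>y. (\<Gamma> *v y) $ j / sigma_norm \<Gamma> y)
     ((\<Gamma> *v axis i 1) $ j / sigma_norm \<Gamma> x - (\<Gamma> *v x) $ j * ((\<Gamma> *v x) $ i / sigma_norm \<Gamma> x) / (sigma_norm \<Gamma> x)\<^sup>2) x"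
    by (rule has_pd_divide[OF has_pd_component has_pd_sigma[OF x]]) (use sigma_pos[OF x] in simp)
  then have "has_pd i (pd j (sigma_norm \<Gamma>))
     ((\<Gamma> *v axis i 1) $ j / sigma_norm \<Gamma> x - (\<Gamma> *v x) $ j * ((\<Gamma> *v x) $ i / sigma_norm \<Gamma> x) / (sigma_norm \<Gamma> x)\<^sup>2) x"
    by (rule has_pd_cong[OF _ open_nonzero]) (use x pd_sigma in auto)
  from has_pd_imp_pd[OF this] show ?thesis
    by (simp add: power2_eq_square sigma_sq)
qed

lemma grad_sigma_sq_eq: assumes x: "x \<noteq> 0" shows "grad_sigma_sq G \<Gamma> x = q x / s x"
proof -
  have "grad_sigma_sq G \<Gamma> x = (\<Sum>l\<in>UNIV. \<Sum>m\<in>UNIV. G $ l $ m * (\<Gamma> *v x) $ l * (\<Gamma> *v x) $ m / s x)"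
    unfolding grad_sigma_sq_def pd_sigma[OF x] by (simp add: sigma_sq)
  also have "\<dots> = (\<Sum>l\<in>UNIV. \<Sum>m\<in>UNIV. G $ l $ m * (\<Gamma> *v x) $ l * (\<Gamma> *v x) $ m) / s x"
    by (simp add: sum_divide_distrib)
  also have "\<dots> = q x / s x" by (simp only: quadratic_form_sum q_def)
  finally show ?thesis .
qed

lemma B0_eq: assumes x: "x \<noteq> 0" shows "B0 G \<Gamma> x $ i = s x * (G *v (\<Gamma> *v x)) $ i / q x"
proof -
  have sg: "sigma_norm \<Gamma> x \<noteq> 0" using sigma_pos[OF x] by simp
  have "sigma_norm \<Gamma> x * (\<Sum>j\<in>UNIV. G $ i $ j * pd j (sigma_norm \<Gamma>) x) = (G *v (\<Gamma> *v x)) $ i"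
    unfolding pd_sigma[OF x] using sg by (simp add: matrix_vector_mult_def[of G] sum_distrib_left)
  then show ?thesis unfolding B0_def grad_sigma_sq_eq[OF x] by simp
qed

lemma F0_eq: assumes x: "x \<noteq> 0" shows "F0 G \<Gamma> x = T * s x / q x - 2"
proof -
  have sg: "sigma_norm \<Gamma> x \<noteq> 0" using sigma_pos[OF x] by simp
  have s0: "s x \<noteq> 0" "q x \<noteq> 0" using s_pos[OF x] q_pos[OF x] by auto
  have tr: "(\<Sum>i\<in>UNIV. \<Sum>j\<in>UNIV. G $ i $ j * (\<Gamma> *v axis i 1) $ j) = T"
    unfolding T_def by (simp add: matrix_vector_mult_def[of G])
  have "sigma_norm \<Gamma> x * (\<Sum>i\<in>UNIV. \<Sum>j\<in>UNIV. G $ i $ j * pd i (pd j (sigma_norm \<Gamma>)) x)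
     = (\<Sum>i\<in>UNIV. \<Sum>j\<in>UNIV. G $ i $ j * (\<Gamma> *v axis i 1) $ j - G $ i $ j * (\<Gamma> *v x) $ i * (\<Gamma> *v x) $ j / s x)"
    unfolding pd_pd_sigma[OF x] sum_distrib_left
    by (intro sum.cong refl) (use sg s0 in \<open>simp add: field_simps\<close>)
  also have "\<dots> = T - q x / s x"
    by (simp add: sum_subtractf tr sum_divide_distrib[symmetric] quadratic_form_sum q_def)
  finally have eq: "sigma_norm \<Gamma> x * (\<Sum>i\<in>UNIV. \<Sum>j\<in>UNIV. G $ i $ j * pd i (pd j (sigma_norm \<Gamma>)) x) = T - q x / s x" .
  show ?thesis unfolding F0_def grad_sigma_sq_eq[OF x] eq using s0 by (simp add: field_simps)
qed

lemma pd_B0: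
  assumes x: "x \<noteq> 0"
  shows "pd k (\<lambda>y. B0 G \<Gamma> y $ j) x = 2 * (\<Gamma> *v x) $ k * (G *v (\<Gamma> *v x)) $ j / q x
     + s x * (G *v (\<Gamma> *v axis k 1)) $ j / q x
     - 2 * s x * (\<Gamma> *v (G *v (\<Gamma> *v x))) $ k * (G *v (\<Gamma> *v x)) $ j / (q x)\<^sup>2"
proof -
  have "has_pd k (\<lambda>y. s y * (G *v (\<Gamma> *v y)) $ j / q y)
    ((2 * (\<Gamma> *v x) $ k * (G *v (\<Gamma> *v x)) $ j + s x * (G *v (\<Gamma> *v axis k 1)) $ j) / q x
      - s x * (G *v (\<Gamma> *v x)) $ j * (2 * (\<Gamma> *v (G *v (\<Gamma> *v x))) $ k) / (q x)\<^sup>2) x"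
    by (rule has_pd_divide[OF has_pd_mult[OF has_pd_s has_pd_comp2] has_pd_q]) (use q_pos[OF x] in simp)
  then have "has_pd k (\<lambda>y. B0 G \<Gamma> y $ j)
    ((2 * (\<Gamma> *v x) $ k * (G *v (\<Gamma> *v x)) $ j + s x * (G *v (\<Gamma> *v axis k 1)) $ j) / q x
      - s x * (G *v (\<Gamma> *v x)) $ j * (2 * (\<Gamma> *v (G *v (\<Gamma> *v x))) $ k) / (q x)\<^sup>2) x"
    by (rule has_pd_cong[OF _ open_nonzero]) (use x B0_eq in auto)
  from has_pd_imp_pd[OF this] show ?thesis by (simp add: add_divide_distrib mult_ac)
qed

lemma div_B0:
  assumes x: "x \<noteq> 0"
  shows "(\<Sum>k\<in>UNIV. pd k (\<lambda>y. B0 G \<Gamma> y $ k) x) = 2 + s x * T / q x - 2 * s x * P x / (q x)\<^sup>2"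
proof -
  have q0: "q x \<noteq> 0" using q_pos[OF x] by auto
  have "(\<Sum>k\<in>UNIV. pd k (\<lambda>y. B0 G \<Gamma> y $ k) x) = 2 * ((\<Gamma> *v x) \<bullet> (G *v (\<Gamma> *v x))) / q x + s x * T / q x
     - 2 * s x * ((\<Gamma> *v (G *v (\<Gamma> *v x))) \<bullet> (G *v (\<Gamma> *v x))) / (q x)\<^sup>2"
    unfolding pd_B0[OF x] T_def inner_vec_def
    by (simp add: sum.distrib sum_subtractf sum_distrib_left sum_divide_distrib mult_ac)
  moreover have "(\<Gamma> *v x) \<bullet> (G *v (\<Gamma> *v x)) = q x" by (simp add: q_def inner_commute)
  ultimately show ?thesis using q0 by (simp add: P_def)
qed

text \<open>
  On covectors orthogonal to \<open>\<Gamma>x\<close> the terms of \<open>\<partial>B\<^sub>0\<close> that come from differentiating \<open>s\<close> and \<open>1/q\<close> are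
  multiples of \<open>(G\<Gamma>x,\<xi>)\<close> and vanish; only \<open>(s/q) G\<Gamma>\<close> remains. In \<open>div B\<^sub>0 - F\<close> the trace \<open>T\<close> cancels.
\<close>

lemma S0_eq:
  assumes x: "x \<noteq> 0" and orth: "(G *v (\<Gamma> *v x)) \<bullet> \<xi> = 0"
  shows "- ((S0 G \<Gamma> x *v \<xi>) \<bullet> \<xi>) = (s x * P x / (q x)\<^sup>2 - 2) * ((G *v \<xi>) \<bullet> \<xi>)
      + s x / q x * ((\<Gamma> *v (G *v \<xi>)) \<bullet> (G *v \<xi>))"
proof -
  let ?y = "\<Gamma> *v x"
  let ?b = "\<lambda>k j. pd k (\<lambda>y. B0 G \<Gamma> y $ j) x"
  have o: "(\<Sum>j\<in>UNIV. (G *v ?y) $ j * \<xi> $ j) = 0" using orth by (simp add: inner_vec_def)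
  have "(\<Sum>j\<in>UNIV. ?b k j * \<xi> $ j) = s x / q x * (\<Sum>j\<in>UNIV. (G *v (\<Gamma> *v axis k 1)) $ j * \<xi> $ j)" for k
  proof -
    have "(\<Sum>j\<in>UNIV. ?b k j * \<xi> $ j) = (2 * ?y $ k / q x - 2 * s x * (\<Gamma> *v (G *v ?y)) $ k / (q x)\<^sup>2) * (\<Sum>j\<in>UNIV. (G *v ?y) $ j * \<xi> $ j)
        + s x / q x * (\<Sum>j\<in>UNIV. (G *v (\<Gamma> *v axis k 1)) $ j * \<xi> $ j)"
      unfolding pd_B0[OF x] sum_distrib_left sum.distrib[symmetric]
      by (intro sum.cong refl) (simp add: algebra_simps diff_divide_distrib add_divide_distrib)
    then show ?thesis using o by simp
  qed
  also have "(\<Sum>j\<in>UNIV. (G *v (\<Gamma> *v axis k 1)) $ j * \<xi> $ j) = (\<Gamma> *v (G *v \<xi>)) $ k" for k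
  proof -
    have "(\<Sum>j\<in>UNIV. (G *v (\<Gamma> *v axis k 1)) $ j * \<xi> $ j) = (G *v (\<Gamma> *v axis k 1)) \<bullet> \<xi>"
      by (simp add: inner_vec_def)
    also have "\<dots> = (\<Gamma> *v (G *v \<xi>)) $ k" by (simp only: innerG inner\<Gamma> inner_axis_comp)
    finally show ?thesis .
  qed
  finally have b: "(\<Sum>j\<in>UNIV. ?b k j * \<xi> $ j) = s x / q x * (\<Gamma> *v (G *v \<xi>)) $ k" for k .
  have "(\<Sum>k\<in>UNIV. \<Sum>j\<in>UNIV. ?b k j * \<xi> $ j * (G *v \<xi>) $ k) = (\<Sum>k\<in>UNIV. (\<Sum>j\<in>UNIV. ?b k j * \<xi> $ j) * (G *v \<xi>) $ k)"
    by (simp add: sum_distrib_right)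
  also have "\<dots> = s x / q x * ((\<Gamma> *v (G *v \<xi>)) \<bullet> (G *v \<xi>))"
    unfolding b by (simp add: inner_vec_def sum_distrib_left mult.assoc)
  finally have bb: "(\<Sum>k\<in>UNIV. \<Sum>j\<in>UNIV. ?b k j * \<xi> $ j * (G *v \<xi>) $ k) = s x / q x * ((\<Gamma> *v (G *v \<xi>)) \<bullet> (G *v \<xi>))" .
  have "(S0 G \<Gamma> x *v \<xi>) \<bullet> \<xi> = ((\<Sum>k\<in>UNIV. ?b k k) - F0 G \<Gamma> x) / 2 * ((G *v \<xi>) \<bullet> \<xi>)
     - (\<Sum>k\<in>UNIV. \<Sum>j\<in>UNIV. ?b k j * \<xi> $ j * (G *v \<xi>) $ k)"
    unfolding S0_def by (rule S0_form[OF symG])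
  also have "(\<Sum>k\<in>UNIV. ?b k k) - F0 G \<Gamma> x = 4 - 2 * s x * P x / (q x)\<^sup>2"
    unfolding div_B0[OF x] F0_eq[OF x] by (simp add: mult.commute)
  finally show ?thesis unfolding bb by (simp add: algebra_simps diff_divide_distrib)
qed

lemma orth_iff:
  assumes x: "x \<noteq> 0"
  shows "(\<Sum>i\<in>UNIV. \<Sum>j\<in>UNIV. G $ i $ j * pd i (sigma_norm \<Gamma>) x * \<xi> $ j) = 0 \<longleftrightarrow> (G *v (\<Gamma> *v x)) \<bullet> \<xi> = 0"
proof -
  have "(\<Sum>i\<in>UNIV. \<Sum>j\<in>UNIV. G $ i $ j * pd i (sigma_norm \<Gamma>) x * \<xi> $ j)
      = (\<Sum>i\<in>UNIV. \<Sum>j\<in>UNIV. G $ i $ j * (\<Gamma> *v x) $ i * \<xi> $ j) / sigma_norm \<Gamma> x"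
    unfolding pd_sigma[OF x] by (simp add: sum_divide_distrib)
  also have "\<dots> = ((G *v (\<Gamma> *v x)) \<bullet> \<xi>) / sigma_norm \<Gamma> x"
    by (simp only: quadratic_form_sum innerG[of \<xi>] inner_commute[of \<xi>])
  finally show ?thesis using sigma_pos[OF x] by simp
qed

definition omega_val :: "real ^ 'n \<Rightarrow> real ^ 'n \<Rightarrow> real" where
  "omega_val x \<xi> = s x * P x / (q x)\<^sup>2 + s x / q x * ((\<Gamma> *v (G *v \<xi>)) \<bullet> (G *v \<xi>)) - 2"

lemma omega0_eq:
  "omega0 G \<Gamma> = Sup {omega_val x \<xi> | x \<xi>. (G *v \<xi>) \<bullet> \<xi> = 1 \<and> (G *v (\<Gamma> *v x)) \<bullet> \<xi> = 0 \<and> x \<noteq> 0}"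
proof -
  have "{- ((S0 G \<Gamma> x *v \<xi>) \<bullet> \<xi>) | x \<xi>.
            (\<Sum>i\<in>UNIV. \<Sum>j\<in>UNIV. G $ i $ j * \<xi> $ i * \<xi> $ j) = 1 \<and>
            (\<Sum>i\<in>UNIV. \<Sum>j\<in>UNIV. G $ i $ j * pd i (sigma_norm \<Gamma>) x * \<xi> $ j) = 0 \<and> x \<noteq> 0}
    = {omega_val x \<xi> | x \<xi>. (G *v \<xi>) \<bullet> \<xi> = 1 \<and> (G *v (\<Gamma> *v x)) \<bullet> \<xi> = 0 \<and> x \<noteq> 0}"
  proof (intro Collect_cong ex_cong1)
    fix u x \<xi>
    have "- ((S0 G \<Gamma> x *v \<xi>) \<bullet> \<xi>) = omega_val x \<xi>"
      if "(G *v \<xi>) \<bullet> \<xi> = 1" "(G *v (\<Gamma> *v x)) \<bullet> \<xi> = 0" "x \<noteq> 0"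
      using S0_eq[OF that(3,2)] that(1) by (simp add: omega_val_def)
    then show "(u = - ((S0 G \<Gamma> x *v \<xi>) \<bullet> \<xi>) \<and>
            (\<Sum>i\<in>UNIV. \<Sum>j\<in>UNIV. G $ i $ j * \<xi> $ i * \<xi> $ j) = 1 \<and>
            (\<Sum>i\<in>UNIV. \<Sum>j\<in>UNIV. G $ i $ j * pd i (sigma_norm \<Gamma>) x * \<xi> $ j) = 0 \<and> x \<noteq> 0) =
      (u = omega_val x \<xi> \<and> (G *v \<xi>) \<bullet> \<xi> = 1 \<and> (G *v (\<Gamma> *v x)) \<bullet> \<xi> = 0 \<and> x \<noteq> 0)"
      unfolding quadratic_form_sum using orth_iff[of x \<xi>] by (cases "x = 0") (simp, auto)
  qed
  then show ?thesis unfolding omega0_def by simp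
qed

lemma s_le: "s x \<le> K * (norm x)\<^sup>2"
proof -
  have "s x \<le> norm (\<Gamma> *v x) * norm x" unfolding s_def by (rule norm_cauchy_schwarz)
  also have "\<dots> \<le> (K * norm x) * norm x" by (intro mult_right_mono norm\<Gamma>) auto
  finally show ?thesis by (simp add: power2_eq_square mult.assoc)
qed

lemma norm_le_\<Gamma>: "norm x \<le> K * norm (\<Gamma> *v x)"
proof (cases "x = 0")
  case False
  have "(norm x)\<^sup>2 \<le> K * ((\<Gamma> *v x) \<bullet> x)" by (rule ell\<Gamma>)
  also have "\<dots> \<le> K * (norm (\<Gamma> *v x) * norm x)" by (intro mult_left_mono norm_cauchy_schwarz) (use K in auto)
  finally show ?thesis using False by (simp add: power2_eq_square)
qed simp

lemma s_div_q_le: assumes x: "x \<noteq> 0" shows "s x / q x \<le> K ^ 4"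
proof -
  have "(norm x)\<^sup>2 \<le> (K * norm (\<Gamma> *v x))\<^sup>2" by (intro power_mono norm_le_\<Gamma>) auto
  also have "\<dots> = K\<^sup>2 * (norm (\<Gamma> *v x))\<^sup>2" by (simp add: power_mult_distrib)
  also have "\<dots> \<le> K\<^sup>2 * (K * q x)" unfolding q_def by (intro mult_left_mono ellG) auto
  finally have "K * (norm x)\<^sup>2 \<le> K * (K\<^sup>2 * (K * q x))" using K by (intro mult_left_mono) auto
  then have "s x \<le> K ^ 4 * q x" using s_le[of x] by (simp add: power2_eq_square power4_eq_xxxx mult.assoc)
  then show ?thesis using q_pos[OF x] by (simp add: field_simps)
qed

lemma \<Gamma>G_form_le: "(\<Gamma> *v (G *v \<xi>)) \<bullet> (G *v \<xi>) \<le> K ^ 4 * ((G *v \<xi>) \<bullet> \<xi>)"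
proof -
  have "(\<Gamma> *v (G *v \<xi>)) \<bullet> (G *v \<xi>) \<le> K * (norm (G *v \<xi>))\<^sup>2" using s_le[of "G *v \<xi>"] by (simp add: s_def)
  also have "\<dots> \<le> K * (K * norm \<xi>)\<^sup>2" using K by (intro mult_left_mono power_mono normG) auto
  also have "\<dots> = K ^ 3 * (norm \<xi>)\<^sup>2" by (simp add: power_mult_distrib power2_eq_square power3_eq_cube mult_ac)
  also have "\<dots> \<le> K ^ 3 * (K * ((G *v \<xi>) \<bullet> \<xi>))" using K by (intro mult_left_mono ellG) auto
  finally show ?thesis by (simp add: power3_eq_cube power4_eq_xxxx mult.assoc)
qed

text \<open>
  The set whose supremum is \<open>\<omega>\<^sub>0\<close> is bounded above, without which its elements could not be compared
  with the supremum.
\<close>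

lemma omega_val_le:
  assumes x: "x \<noteq> 0" and \<xi>: "(G *v \<xi>) \<bullet> \<xi> = 1"
  shows "omega_val x \<xi> \<le> 2 * (K ^ 4 * K ^ 4)"
proof -
  have q: "q x > 0" by (rule q_pos[OF x])
  have sq: "s x / q x \<ge> 0" using s_pos[OF x] q by simp
  have P0: "P x \<ge> 0" unfolding P_def by (rule nonneg\<Gamma>)
  have "P x \<le> K ^ 4 * q x" using \<Gamma>G_form_le[of "\<Gamma> *v x"] by (simp add: P_def q_def)
  then have "P x / q x \<le> K ^ 4" using q by (simp add: field_simps)
  then have "s x / q x * (P x / q x) \<le> K ^ 4 * K ^ 4"
    using s_div_q_le[OF x] sq P0 q by (intro mult_mono) auto
  moreover have "s x / q x * ((\<Gamma> *v (G *v \<xi>)) \<bullet> (G *v \<xi>)) \<le> K ^ 4 * K ^ 4"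
    using s_div_q_le[OF x] sq \<Gamma>G_form_le[of \<xi>] \<xi> nonneg\<Gamma> by (intro mult_mono) auto
  moreover have "s x * P x / (q x)\<^sup>2 = s x / q x * (P x / q x)" by (simp add: power2_eq_square)
  ultimately show ?thesis unfolding omega_val_def by linarith
qed

lemma omega_val_le_omega0:
  assumes "x \<noteq> 0" "(G *v \<xi>) \<bullet> \<xi> = 1" "(G *v (\<Gamma> *v x)) \<bullet> \<xi> = 0"
  shows "omega_val x \<xi> \<le> omega0 G \<Gamma>"
  unfolding omega0_eq
proof (rule cSup_upper)
  show "bdd_above {omega_val x \<xi> | x \<xi>. (G *v \<xi>) \<bullet> \<xi> = 1 \<and> (G *v (\<Gamma> *v x)) \<bullet> \<xi> = 0 \<and> x \<noteq> 0}"
    by (rule bdd_aboveI[of _ "2 * (K ^ 4 * K ^ 4)"]) (use omega_val_le in blast)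
qed (use assms in blast)

text \<open>
  The bound through which \<open>\<omega>\<^sub>0\<close> controls the gradient terms: an element of the set is at most its
  supremum, made homogeneous in \<open>\<xi>\<close>.
\<close>

theorem tangential_form_bound:
  assumes x: "x \<noteq> 0" and orth: "(G *v (\<Gamma> *v x)) \<bullet> \<xi> = 0"
  shows "s x * P x / (q x)\<^sup>2 * ((G *v \<xi>) \<bullet> \<xi>) + s x / q x * ((\<Gamma> *v (G *v \<xi>)) \<bullet> (G *v \<xi>))
     \<le> (2 + omega0 G \<Gamma>) * ((G *v \<xi>) \<bullet> \<xi>)"
proof (cases "\<xi> = 0")
  case False
  define N where "N = (G *v \<xi>) \<bullet> \<xi>"
  have N: "N > 0" unfolding N_def by (rule posG[OF False])
  let ?z = "(1 / sqrt N) *\<^sub>R \<xi>"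
  have sN: "sqrt N * sqrt N = N" using N by simp
  have "omega_val x ?z \<le> omega0 G \<Gamma>"
    by (rule omega_val_le_omega0[OF x]) (use N orth sN in \<open>auto simp: matrix_vector_mult_scaleR N_def[symmetric]\<close>)
  moreover have "(\<Gamma> *v (G *v ?z)) \<bullet> (G *v ?z) = ((\<Gamma> *v (G *v \<xi>)) \<bullet> (G *v \<xi>)) / N"
    using sN by (simp add: matrix_vector_mult_scaleR)
  ultimately have "s x * P x / (q x)\<^sup>2 + s x / q x * (((\<Gamma> *v (G *v \<xi>)) \<bullet> (G *v \<xi>)) / N) \<le> 2 + omega0 G \<Gamma>"
    by (simp add: omega_val_def)
  then have "(s x * P x / (q x)\<^sup>2 + s x / q x * (((\<Gamma> *v (G *v \<xi>)) \<bullet> (G *v \<xi>)) / N)) * N \<le> (2 + omega0 G \<Gamma>) * N"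
    using N by (intro mult_right_mono) auto
  then show ?thesis using N unfolding N_def[symmetric] by (simp add: distrib_right)
qed simp

lemma G_orthonormal_pair:
  assumes n: "CARD('n) \<ge> 2"
  obtains \<eta> \<xi> where "(G *v \<eta>) \<bullet> \<eta> = 1" "(G *v \<xi>) \<bullet> \<xi> = 1" "(G *v \<eta>) \<bullet> \<xi> = 0"
proof -
  obtain i j :: 'n where ij: "i \<noteq> j"
    using n by (metis (full_types) UNIV_I card_1_singleton_iff card_2_iff' card.infinite card_le_Suc0_iff_eq finite_class.finite_UNIV not_less_eq_eq numeral_2_eq_2)
  have norm1: "\<exists>c. (G *v (c *\<^sub>R z)) \<bullet> (c *\<^sub>R z) = 1" if "z \<noteq> 0" for z
  proof -
    have "(G *v z) \<bullet> z > 0" using that by (rule posG)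
    then have "sqrt ((G *v z) \<bullet> z) * sqrt ((G *v z) \<bullet> z) = (G *v z) \<bullet> z" "sqrt ((G *v z) \<bullet> z) > 0" by simp_all
    then show ?thesis
      by (intro exI[of _ "1 / sqrt ((G *v z) \<bullet> z)"]) (simp add: matrix_vector_mult_scaleR)
  qed
  have a0: "axis i 1 \<noteq> (0 :: real ^ 'n)" by simp
  obtain c where c: "(G *v (c *\<^sub>R axis i 1)) \<bullet> (c *\<^sub>R axis i 1) = 1" using norm1[OF a0] by blast
  define \<eta> where "\<eta> = c *\<^sub>R (axis i 1 :: real ^ 'n)"
  have eta: "(G *v \<eta>) \<bullet> \<eta> = 1" unfolding \<eta>_def by (rule c)
  define z where "z = axis j 1 - ((G *v \<eta>) \<bullet> axis j 1) *\<^sub>R \<eta>"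
  have "z $ j = 1" using ij by (simp add: z_def \<eta>_def axis_def)
  then have "z \<noteq> 0" by auto
  then obtain d where d: "(G *v (d *\<^sub>R z)) \<bullet> (d *\<^sub>R z) = 1" using norm1 by blast
  have "(G *v \<eta>) \<bullet> z = 0" by (simp add: z_def inner_diff_right eta)
  then have "(G *v \<eta>) \<bullet> (d *\<^sub>R z) = 0" by simp
  then show ?thesis using that eta d by blast
qed

lemma \<Gamma>_surj: "\<exists>x. \<Gamma> *v x = y"
proof -
  have "inj ((*v) \<Gamma>)"
  proof (rule injI)
    fix x z assume "\<Gamma> *v x = \<Gamma> *v z"
    then have "\<Gamma> *v (x - z) = 0" by (simp add: matrix_vector_mult_diff_distrib)
    then show "x = z" using \<Gamma>_nonzero[of "x - z"] by auto
  qed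
  then have "surj ((*v) \<Gamma>)"
    by (rule linear_injective_imp_surjective[OF matrix_vector_mul_linear]) simp
  then show ?thesis by (metis surjD)
qed

text \<open>
  Take a \<open>G\<close>-orthonormal pair \<open>\<eta>\<close>, \<open>\<xi>\<close> and evaluate at \<open>(\<Gamma>\<^sup>-\<^sup>1\<eta>, \<xi>)\<close> and at \<open>(\<Gamma>\<^sup>-\<^sup>1\<xi>, \<eta>)\<close>. With \<open>s\<^sub>1\<close>, \<open>s\<^sub>2\<close>
  the values of \<open>s\<close> and \<open>p\<^sub>1\<close>, \<open>p\<^sub>2\<close> those of \<open>P\<close>, the Cauchy-Schwarz inequality gives \<open>s\<^sub>1p\<^sub>1 \<ge> 1\<close> and
  \<open>s\<^sub>2p\<^sub>2 \<ge> 1\<close>. If both values \<open>s\<^sub>i (p\<^sub>1 + p\<^sub>2) - 2\<close> were negative, then \<open>s\<^sub>1p\<^sub>2 < 1\<close> and \<open>s\<^sub>2p\<^sub>1 < 1\<close>, and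
  \<open>s\<^sub>1s\<^sub>2p\<^sub>1p\<^sub>2\<close> would be both at least one and less than one.
\<close>

theorem omega0_nonneg:
  assumes n: "CARD('n) \<ge> 2"
  shows "omega0 G \<Gamma> \<ge> 0"
proof -
  obtain \<eta> \<xi> where e: "(G *v \<eta>) \<bullet> \<eta> = 1" "(G *v \<xi>) \<bullet> \<xi> = 1" "(G *v \<eta>) \<bullet> \<xi> = 0"
    using G_orthonormal_pair[OF n] by blast
  obtain x1 where x1: "\<Gamma> *v x1 = \<eta>" using \<Gamma>_surj by blast
  obtain x2 where x2: "\<Gamma> *v x2 = \<xi>" using \<Gamma>_surj by blast
  define p1 where "p1 = (\<Gamma> *v (G *v \<eta>)) \<bullet> (G *v \<eta>)"
  define p2 where "p2 = (\<Gamma> *v (G *v \<xi>)) \<bullet> (G *v \<xi>)"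
  have nz: "x1 \<noteq> 0" "x2 \<noteq> 0" using e x1 x2 by auto
  have CS: "1 \<le> s x * ((\<Gamma> *v (G *v (\<Gamma> *v x))) \<bullet> (G *v (\<Gamma> *v x)))" if "(G *v (\<Gamma> *v x)) \<bullet> (\<Gamma> *v x) = 1" for x
    using psd_Cauchy_Schwarz[OF sym\<Gamma> nonneg\<Gamma>, of x "G *v (\<Gamma> *v x)"] that
    by (simp add: s_def inner_commute[of "\<Gamma> *v x"])
  have s1: "1 \<le> s x1 * p1" and s2: "1 \<le> s x2 * p2" using CS[of x1] CS[of x2] e x1 x2 by (simp_all add: p1_def p2_def)
  have pos: "p1 \<ge> 0" "p2 \<ge> 0" "s x1 > 0" "s x2 > 0" unfolding p1_def p2_def using nonneg\<Gamma> s_pos nz by auto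
  have "q x1 = 1" "P x1 = p1" "q x2 = 1" "P x2 = p2" using e x1 x2 by (simp_all add: q_def P_def p1_def p2_def)
  then have v: "omega_val x1 \<xi> = s x1 * (p1 + p2) - 2" "omega_val x2 \<eta> = s x2 * (p1 + p2) - 2"
    by (simp_all add: omega_val_def p1_def p2_def algebra_simps)
  have le: "omega_val x1 \<xi> \<le> omega0 G \<Gamma>" "omega_val x2 \<eta> \<le> omega0 G \<Gamma>"
  proof -
    have "(G *v \<xi>) \<bullet> \<eta> = 0" using e(3) innerG[of \<eta> \<xi>] by (simp add: inner_commute)
    then show "omega_val x1 \<xi> \<le> omega0 G \<Gamma>" "omega_val x2 \<eta> \<le> omega0 G \<Gamma>"
      using e x1 x2 by (auto intro!: omega_val_le_omega0 nz)
  qed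
  show ?thesis
  proof (rule ccontr)
    assume "\<not> omega0 G \<Gamma> \<ge> 0"
    then have lt: "s x1 * (p1 + p2) < 2" "s x2 * (p1 + p2) < 2" using le v by auto
    then have a: "s x1 * p2 < 1" "s x2 * p1 < 1" using s1 s2 by (auto simp: algebra_simps)
    have "1 * 1 \<le> (s x1 * p1) * (s x2 * p2)" by (intro mult_mono s1 s2) (use pos in auto)
    also have "\<dots> = (s x1 * p2) * (s x2 * p1)" by (simp add: mult_ac)
    also have "\<dots> < 1 * 1" using a pos by (intro mult_strict_mono) auto
    finally show False by simp
  qed
qed

end

section \<open>Uniform bounds and absorption\<close>

text \<open>
  A Landau symbol with one implied constant for a whole index set: \<open>f\<close> is bounded by a constant
  multiple of \<open>\<rho>\<close> on \<open>S\<close>. Bounds that are explicit polynomials in the data would be unwieldy, and only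
  their uniformity matters.
\<close>

definition uO :: "'z set \<Rightarrow> ('z \<Rightarrow> real) \<Rightarrow> ('z \<Rightarrow> 'b::real_normed_vector) \<Rightarrow> bool" where
  "uO S \<rho> f \<longleftrightarrow> (\<exists>B\<ge>0. \<forall>z\<in>S. norm (f z) \<le> B * \<rho> z)"

lemma uO_I: "(\<And>z. z \<in> S \<Longrightarrow> norm (f z) \<le> B * \<rho> z) \<Longrightarrow> B \<ge> 0 \<Longrightarrow> uO S \<rho> f"
  unfolding uO_def by blast

lemma uO_cong: "uO S \<rho> f \<Longrightarrow> (\<And>z. z \<in> S \<Longrightarrow> g z = f z) \<Longrightarrow> uO S \<rho> g"
  unfolding uO_def by simp

lemma uO_add:
  assumes "uO S \<rho> f" "uO S \<rho> g" shows "uO S \<rho> (\<lambda>z. f z + g z)"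
proof -
  obtain A where A: "A \<ge> 0" "\<And>z. z \<in> S \<Longrightarrow> norm (f z) \<le> A * \<rho> z" using assms(1) unfolding uO_def by blast
  obtain B where B: "B \<ge> 0" "\<And>z. z \<in> S \<Longrightarrow> norm (g z) \<le> B * \<rho> z" using assms(2) unfolding uO_def by blast
  show ?thesis
  proof (rule uO_I)
    show "norm (f z + g z) \<le> (A + B) * \<rho> z" if "z \<in> S" for z
      using norm_triangle_ineq[of "f z" "g z"] A(2)[OF that] B(2)[OF that] by (simp add: distrib_right)
  qed (use A B in simp)
qed

lemma uO_minus: "uO S \<rho> f \<Longrightarrow> uO S \<rho> (\<lambda>z. - f z)"
  unfolding uO_def by simp

lemma uO_diff: "uO S \<rho> f \<Longrightarrow> uO S \<rho> g \<Longrightarrow> uO S \<rho> (\<lambda>z. f z - g z)"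
  using uO_add[of S \<rho> f "\<lambda>z. - g z"] uO_minus[of S \<rho> g] by simp

lemma uO_sum:
  assumes "\<And>i. uO S \<rho> (h i)" shows "uO S \<rho> (\<lambda>z. \<Sum>i\<in>I. h i z)"
proof (induction I rule: infinite_finite_induct)
  case (insert i I)
  then show ?case by (simp add: uO_add assms)
qed (auto intro: uO_I[of _ _ 0])

lemma uO_bilinear:
  fixes prd :: "'a::real_normed_vector \<Rightarrow> 'b::real_normed_vector \<Rightarrow> 'c::real_normed_vector"
  assumes prd: "\<And>x y. norm (prd x y) \<le> norm x * norm y"
    and f: "uO S \<rho> f" and g: "uO S \<rho>' g" and pos: "\<And>z. z \<in> S \<Longrightarrow> \<rho> z \<ge> 0" "\<And>z. z \<in> S \<Longrightarrow> \<rho>' z \<ge> 0"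
  shows "uO S (\<lambda>z. \<rho> z * \<rho>' z) (\<lambda>z. prd (f z) (g z))"
proof -
  obtain A where A: "A \<ge> 0" "\<And>z. z \<in> S \<Longrightarrow> norm (f z) \<le> A * \<rho> z" using f unfolding uO_def by blast
  obtain B where B: "B \<ge> 0" "\<And>z. z \<in> S \<Longrightarrow> norm (g z) \<le> B * \<rho>' z" using g unfolding uO_def by blast
  show ?thesis
  proof (rule uO_I)
    fix z assume z: "z \<in> S"
    have "norm (prd (f z) (g z)) \<le> norm (f z) * norm (g z)" by (rule prd)
    also have "\<dots> \<le> (A * \<rho> z) * (B * \<rho>' z)" using A B pos z by (intro mult_mono) auto
    finally show "norm (prd (f z) (g z)) \<le> (A * B) * (\<rho> z * \<rho>' z)" by (simp add: mult_ac)
  qed (use A B in simp)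
qed

text \<open>
  The final absorption, for \<open>p = |\<nabla>v|\<close>, \<open>\<mu> = (gy,\<nabla>v)/\<sigma>\<close>, \<open>\<nu> = v/\<sigma>\<close>, \<open>r = \<sigma>\<close> and \<open>t = \<tau>/\<rho>\<close>. The good terms are
  \<open>p\<^sup>2\<close>, \<open>t\<mu>\<^sup>2\<close> and \<open>t\<^sup>2\<nu>\<^sup>2\<close> with coefficient \<open>1/B\<close>; every other term has coefficient \<open>B\<close> and is, by
  Young's inequality, smaller than the good terms by a factor \<open>r\<close> or a negative power of \<open>t\<close>.
\<close>

lemma quadratic_absorption:
  fixes B :: real
  assumes B: "B \<ge> 1"
  obtains c r0 t0 where "c > 0" "r0 > 0" "t0 \<ge> 1"
    "\<And>r t p \<mu> \<nu> X. 0 < r \<Longrightarrow> r \<le> r0 \<Longrightarrow> t0 \<le> t \<Longrightarrow> 0 \<le> p \<Longrightarrow>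
       p\<^sup>2 / B - B * \<mu>\<^sup>2 - B * r * p\<^sup>2 - B * p * \<bar>\<mu>\<bar> - B * p * \<bar>\<nu>\<bar> - B * r * p\<^sup>2 + t\<^sup>2 * \<nu>\<^sup>2 * (1 / B - B * r)
        + t * \<mu>\<^sup>2 / B - B * t * \<bar>\<mu>\<bar> * \<bar>\<nu>\<bar> - B * t * \<nu>\<^sup>2 \<le> X \<Longrightarrow> c * (p\<^sup>2 + t * \<mu>\<^sup>2 + t\<^sup>2 * \<nu>\<^sup>2) \<le> X"
proof (rule that[of "1 / (4 * B)" "1 / (8 * B\<^sup>2)" "100 * B ^ 4"])
  show "1 / (4 * B) > 0" "1 / (8 * B\<^sup>2) > 0" using B by auto
  have B4: "B ^ 4 \<ge> 1" using B by simp
  then show "100 * B ^ 4 \<ge> 1" by linarith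
  fix r t p \<mu> \<nu> X :: real
  assume r: "0 < r" "r \<le> 1 / (8 * B\<^sup>2)" and t: "100 * B ^ 4 \<le> t" and p: "0 \<le> p"
    and X: "p\<^sup>2 / B - B * \<mu>\<^sup>2 - B * r * p\<^sup>2 - B * p * \<bar>\<mu>\<bar> - B * p * \<bar>\<nu>\<bar> - B * r * p\<^sup>2 + t\<^sup>2 * \<nu>\<^sup>2 * (1 / B - B * r)
        + t * \<mu>\<^sup>2 / B - B * t * \<bar>\<mu>\<bar> * \<bar>\<nu>\<bar> - B * t * \<nu>\<^sup>2 \<le> X"
  define b where "b = 1 / B"
  have b: "0 < b" "b \<le> 1" "B * b = 1" using B by (auto simp: b_def)
  define P where "P = p\<^sup>2"
  define m where "m = \<mu>\<^sup>2"
  define n where "n = \<nu>\<^sup>2"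
  have nn: "P \<ge> 0" "m \<ge> 0" "n \<ge> 0" by (simp_all add: P_def m_def n_def)
  have t0: "t > 0" "t \<ge> 1" using t B4 by linarith+
  \<comment> \<open>Each cross term may use an eighth of a good term.\<close>
  have young: "B * x * y \<le> b * x\<^sup>2 / 8 + 2 * B ^ 3 * y\<^sup>2" for x y
  proof -
    have "0 \<le> b / 8 * (x - 8 * B\<^sup>2 / 2 * y)\<^sup>2" using b by simp
    also have "\<dots> = b * x\<^sup>2 / 8 - (B * b) * B * x * y + 2 * (B * b) * B ^ 3 * y\<^sup>2"
      by (simp add: power2_eq_square power3_eq_cube algebra_simps)
    finally show ?thesis using b by simp
  qed
  have brB: "B * r \<le> b / 8"
  proof -
    have "B * r \<le> B * (1 / (8 * B\<^sup>2))" using r B by (intro mult_left_mono) auto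
    also have "\<dots> = b / 8" using B by (simp add: b_def power2_eq_square)
    finally show ?thesis .
  qed
  have 1: "B * r * p\<^sup>2 \<le> b / 8 * P" unfolding P_def using brB by (intro mult_right_mono) auto
  have 2: "B * p * \<bar>\<mu>\<bar> \<le> b * P / 8 + 2 * B ^ 3 * m" using young[of p "\<bar>\<mu>\<bar>"] by (simp add: P_def m_def)
  have 3: "B * p * \<bar>\<nu>\<bar> \<le> b * P / 8 + 2 * B ^ 3 * n" using young[of p "\<bar>\<nu>\<bar>"] by (simp add: P_def n_def)
  have 4: "B * t * \<bar>\<mu>\<bar> * \<bar>\<nu>\<bar> \<le> t * (b * m / 8 + 2 * B ^ 3 * n)"
  proof -
    have "t * (B * \<bar>\<mu>\<bar> * \<bar>\<nu>\<bar>) \<le> t * (b * m / 8 + 2 * B ^ 3 * n)"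
      using young[of "\<bar>\<mu>\<bar>" "\<bar>\<nu>\<bar>"] t0 by (intro mult_left_mono) (auto simp: m_def n_def)
    then show ?thesis by (simp add: mult_ac)
  qed
  have 5: "t\<^sup>2 * n * (b - B * r) \<ge> t\<^sup>2 * n * (b - b / 8)" using brB nn by (intro mult_left_mono) auto
  have B3: "B ^ 3 \<ge> 1" "B ^ 3 \<ge> B" using B power_increasing[of 1 3 B] by (auto simp: )
  \<comment> \<open>The constant 100 is generous: all terms with B cubed add up to far less.\<close>
  have tb: "b * t \<ge> 100 * B ^ 3"
  proof -
    have "b * (100 * B ^ 4) \<le> b * t" using t b by (intro mult_left_mono) auto
    moreover have "b * (100 * B ^ 4) = 100 * (B * b) * B ^ 3" by (simp add: power3_eq_cube power4_eq_xxxx)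
    ultimately show ?thesis using b by simp
  qed
  have 6: "(b * t / 8) * m \<ge> (B + 2 * B ^ 3) * m" using tb B3 nn by (intro mult_right_mono) linarith+
  have 7: "t\<^sup>2 * n * (b / 8) \<ge> 3 * t * B ^ 3 * n"
  proof -
    have "(t * n) * (b * t / 8) \<ge> (t * n) * (3 * B ^ 3)" using tb B3 nn t0 by (intro mult_left_mono) auto
    then show ?thesis by (simp add: power2_eq_square mult_ac)
  qed
  have 8: "t\<^sup>2 * n * (b / 8) \<ge> 2 * B ^ 3 * n"
  proof -
    have "3 * t * B ^ 3 * n \<ge> 2 * 1 * B ^ 3 * n" using t0 nn B3 B by (intro mult_right_mono mult_mono) auto
    then show ?thesis using 7 by simp
  qed
  have 9: "B * t * n \<le> t * B ^ 3 * n" using B3 t0 nn by (intro mult_right_mono) (auto simp: mult.commute)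
  have X': "b * P - B * m - B * r * p\<^sup>2 - B * p * \<bar>\<mu>\<bar> - B * p * \<bar>\<nu>\<bar> - B * r * p\<^sup>2 + t\<^sup>2 * n * (b - B * r)
        + b * t * m - B * t * \<bar>\<mu>\<bar> * \<bar>\<nu>\<bar> - B * t * n \<le> X"
    using X by (simp add: b_def P_def m_def n_def mult.commute)
  have pos: "b * P \<ge> 0" "b * (t * m) \<ge> 0" "t\<^sup>2 * n * b \<ge> 0" using b nn t0 by auto
  have "b / 4 * (P + t * m + t\<^sup>2 * n) \<le> X"
    using X' 1 2 3 4 5 6 7 8 9 pos by (simp add: algebra_simps)
  then show "1 / (4 * B) * (p\<^sup>2 + t * \<mu>\<^sup>2 + t\<^sup>2 * \<nu>\<^sup>2) \<le> X" by (simp add: b_def P_def m_def n_def)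
qed

text \<open>
  A frame \<open>z\<close> collects what the estimate sees of the coefficients at one point \<open>x \<noteq> 0\<close>: \<open>a = g(x)\<close>,
  \<open>G = g(0)\<close>, \<open>Gam = \<Gamma>\<close>, \<open>D i = \<partial>\<^sub>i g(x)\<close>, \<open>Y = \<Gamma>x/\<sigma>(x)\<close> and \<open>r = \<sigma>(x)\<close>. The vector \<open>Y\<close> is bounded above and
  below, so all singular powers of \<open>\<sigma>\<close> are split off into \<open>r\<close>. The last assumption is the bound on
  tangential covectors that the inequality \<open>\<omega>\<^sub>0 \<le> \<omega>\<close> provides.
\<close>

locale frames =
  fixes S :: "'z set" and a G Gam :: "'z \<Rightarrow> real ^ 'n ^ 'n" and D :: "'z \<Rightarrow> 'n \<Rightarrow> real ^ 'n ^ 'n"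
    and Y :: "'z \<Rightarrow> real ^ 'n" and r :: "'z \<Rightarrow> real" and K \<beta> \<omega> :: real
  assumes K: "K > 0" and \<omega>: "0 \<le> \<omega>" "\<omega> < \<beta>"
    and r: "z \<in> S \<Longrightarrow> 0 < r z" "z \<in> S \<Longrightarrow> r z \<le> 1"
    and sym: "z \<in> S \<Longrightarrow> (a z *v x) \<bullet> y = x \<bullet> (a z *v y)" "z \<in> S \<Longrightarrow> (G z *v x) \<bullet> y = x \<bullet> (G z *v y)"
      "z \<in> S \<Longrightarrow> (Gam z *v x) \<bullet> y = x \<bullet> (Gam z *v y)"
    and nb: "z \<in> S \<Longrightarrow> norm (a z *v x) \<le> K * norm x" "z \<in> S \<Longrightarrow> norm (G z *v x) \<le> K * norm x"
      "z \<in> S \<Longrightarrow> norm (Gam z *v x) \<le> K * norm x" "z \<in> S \<Longrightarrow> norm (D z i *v x) \<le> K * norm x"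
    and near: "z \<in> S \<Longrightarrow> norm (a z *v x - G z *v x) \<le> K * r z * norm x"
    and ell: "z \<in> S \<Longrightarrow> (norm x)\<^sup>2 \<le> K * ((G z *v x) \<bullet> x)"
    and Yb: "z \<in> S \<Longrightarrow> norm (Y z) \<le> K" "z \<in> S \<Longrightarrow> 1 \<le> K * norm (Y z)"
    and tang: "z \<in> S \<Longrightarrow> (G z *v Y z) \<bullet> \<xi> = 0 \<Longrightarrow>
       ((Gam z *v (G z *v Y z)) \<bullet> (G z *v Y z)) / ((G z *v Y z) \<bullet> Y z)\<^sup>2 * ((G z *v \<xi>) \<bullet> \<xi>)
       + ((Gam z *v (G z *v \<xi>)) \<bullet> (G z *v \<xi>)) / ((G z *v Y z) \<bullet> Y z) \<le> (2 + \<omega>) * ((G z *v \<xi>) \<bullet> \<xi>)"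
begin

abbreviation O1 :: "('z \<Rightarrow> 'b::real_normed_vector) \<Rightarrow> bool" where "O1 f \<equiv> uO S (\<lambda>_. 1) f"
abbreviation Or :: "('z \<Rightarrow> 'b::real_normed_vector) \<Rightarrow> bool" where "Or f \<equiv> uO S r f"

lemma r0: "z \<in> S \<Longrightarrow> r z \<ge> 0" using r(1) by fastforce

lemma O1_const: "O1 (\<lambda>_. c)" by (rule uO_I[of _ _ "norm c"]) auto
lemma Or_r: "Or r" by (rule uO_I[of _ _ 1]) (use r0 in auto)
lemma Or_imp_O1: assumes "Or f" shows "O1 f"
proof -
  obtain B where B: "B \<ge> 0" "\<And>z. z \<in> S \<Longrightarrow> norm (f z) \<le> B * r z" using assms unfolding uO_def by blast
  show ?thesis
  proof (rule uO_I[of _ _ B])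
    fix z assume z: "z \<in> S"
    have "B * r z \<le> B * 1" by (rule mult_left_mono) (use B r z in auto)
    then show "norm (f z) \<le> B * 1" using B(2)[OF z] by simp
  qed (rule B)
qed
lemma O1_mult: "O1 f \<Longrightarrow> O1 g \<Longrightarrow> O1 (\<lambda>z. f z * g z :: real)"
  using uO_bilinear[of "(*)" S "\<lambda>_. 1" f "\<lambda>_. 1" g] by (simp add: abs_mult)
lemma Or_mult: "Or f \<Longrightarrow> O1 g \<Longrightarrow> Or (\<lambda>z. f z * g z :: real)"
  using uO_bilinear[of "(*)" S r f "\<lambda>_. 1" g] r0 by (simp add: abs_mult)
lemma Or_mult': "O1 f \<Longrightarrow> Or g \<Longrightarrow> Or (\<lambda>z. f z * g z :: real)"
  using Or_mult[of g f] by (simp add: mult.commute)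
lemma O1_scaleR: "O1 f \<Longrightarrow> O1 g \<Longrightarrow> O1 (\<lambda>z. f z *\<^sub>R g z)"
  using uO_bilinear[of scaleR S "\<lambda>_. 1" f "\<lambda>_. 1" g] by simp
lemma Or_scaleR: "Or f \<Longrightarrow> O1 g \<Longrightarrow> Or (\<lambda>z. f z *\<^sub>R g z)"
  using uO_bilinear[of scaleR S r f "\<lambda>_. 1" g] r0 by simp
lemma Or_scaleR': "O1 f \<Longrightarrow> Or g \<Longrightarrow> Or (\<lambda>z. f z *\<^sub>R g z)"
  using uO_bilinear[of scaleR S "\<lambda>_. 1" f r g] r0 by simp
lemma O1_inner: "O1 f \<Longrightarrow> O1 g \<Longrightarrow> O1 (\<lambda>z. f z \<bullet> (g z :: real ^ 'n))"
  using uO_bilinear[of inner S "\<lambda>_. 1" f "\<lambda>_. 1" g] by (simp add: Cauchy_Schwarz_ineq2)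
lemma Or_inner: "Or f \<Longrightarrow> O1 g \<Longrightarrow> Or (\<lambda>z. f z \<bullet> (g z :: real ^ 'n))"
  using uO_bilinear[of inner S r f "\<lambda>_. 1" g] r0 by (simp add: Cauchy_Schwarz_ineq2)
lemma Or_inner': "O1 f \<Longrightarrow> Or g \<Longrightarrow> Or (\<lambda>z. f z \<bullet> (g z :: real ^ 'n))"
  using Or_inner[of g f] by (simp add: inner_commute)
lemma uO_mv:
  assumes A: "\<And>z x. z \<in> S \<Longrightarrow> norm (A z *v x) \<le> K * norm x" and f: "uO S \<rho> f"
  shows "uO S \<rho> (\<lambda>z. A z *v (f z :: real ^ 'n) :: real ^ 'n)"
proof -
  obtain B where B: "B \<ge> 0" "\<And>z. z \<in> S \<Longrightarrow> norm (f z) \<le> B * \<rho> z" using f unfolding uO_def by blast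
  show ?thesis
  proof (rule uO_I[of _ _ "K * B"])
    fix z assume z: "z \<in> S"
    have "norm (A z *v f z) \<le> K * norm (f z)" by (rule A[OF z])
    also have "\<dots> \<le> K * (B * \<rho> z)" using B(2)[OF z] K by (intro mult_left_mono) auto
    finally show "norm (A z *v f z) \<le> K * B * \<rho> z" by (simp add: mult.assoc)
  qed (use K B in simp)
qed

lemmas uO_a = uO_mv[where A=a, OF nb(1)] and uO_G = uO_mv[where A=G, OF nb(2)] and uO_Gam = uO_mv[where A=Gam, OF nb(3)]
lemmas uO_D = uO_mv[where A="\<lambda>z. D z i" for i, OF nb(4)]

lemma Or_near:
  assumes f: "O1 f" shows "Or (\<lambda>z. a z *v f z - G z *v f z)"
proof -
  obtain B where B: "B \<ge> 0" "\<And>z. z \<in> S \<Longrightarrow> norm (f z) \<le> B * 1" using f unfolding uO_def by blast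
  show ?thesis
  proof (rule uO_I[of _ _ "K * B"])
    fix z assume z: "z \<in> S"
    have "norm (a z *v f z - G z *v f z) \<le> K * r z * norm (f z)" by (rule near[OF z])
    also have "\<dots> \<le> K * r z * B" using B(2)[OF z] K r0[OF z] by (intro mult_left_mono) auto
    finally show "norm (a z *v f z - G z *v f z) \<le> K * B * r z" by (simp add: mult_ac)
  qed (use K B in simp)
qed

lemma uO_sum_comp:
  fixes f :: "'n \<Rightarrow> 'z \<Rightarrow> real ^ 'n"
  assumes "\<And>i. uO S \<rho> (f i)" shows "uO S \<rho> (\<lambda>z. \<Sum>i\<in>UNIV. f i z $ i)"
proof -
  have "uO S \<rho> (\<lambda>z. f i z $ i)" for i
  proof -
    obtain B where B: "B \<ge> 0" "\<And>z. z \<in> S \<Longrightarrow> norm (f i z) \<le> B * \<rho> z" using assms unfolding uO_def by blast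
    show ?thesis
      by (rule uO_I[of _ _ B]) (use B component_le_norm_cart order_trans in \<open>auto, blast\<close>)
  qed
  then show ?thesis by (rule uO_sum)
qed

text \<open>
  The coefficients of the multiplier argument with the powers of \<open>\<sigma>\<close> and \<open>\<rho>\<close> divided out. The values of the
  two multiplier coefficients are \<open>1/q\<close> and \<open>l0\<close>; \<open>h1\<close> and \<open>l1\<close> are their gradients, and \<open>k1\<close> is the
  gradient of the coefficient of \<open>v\<^sup>2\<close> in the flux, which has the value \<open>Q/q\<close>. The sum \<open>r d1 + Ta\<close> is the divergence of \<open>gy\<close>,
  and \<open>e1\<close> is the coefficient of \<open>\<kappa>v\<close> in the conjugated operator. \<open>Rh\<close> is the quadratic form
  that remains when the divergence is subtracted; \<open>V\<close> is its coefficient of \<open>t\<^sup>2\<beta>\<^sup>2\<nu>\<^sup>2\<close> and \<open>grad_form\<close> the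
  main part of its terms that are quadratic in the gradient.
\<close>

definition "q z = (G z *v Y z) \<bullet> Y z"
definition "M z = a z *v Y z"
definition "Q z = M z \<bullet> Y z"
definition "GY z = G z *v Y z"
definition "T z = (\<Sum>i\<in>UNIV. (G z *v (Gam z *v axis i 1)) $ i)"
definition "Ta z = (\<Sum>i\<in>UNIV. (a z *v (Gam z *v axis i 1)) $ i)"
definition "P z = (Gam z *v GY z) \<bullet> GY z"
definition "h1 z = ((\<beta> + 2) / q z) *\<^sub>R Y z - (2 / (q z)\<^sup>2) *\<^sub>R (Gam z *v GY z)"
definition "l0 z = T z / q z - (2 + \<omega>)"
definition "l1 z = T z *\<^sub>R h1 z - ((2 + \<omega>) * \<beta>) *\<^sub>R Y z"
definition "d1 z = (\<Sum>i\<in>UNIV. (D z i *v Y z) $ i)"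
definition "D2 z = (\<chi> k. (D z k *v Y z) \<bullet> Y z)"
definition "e1 z = - (\<beta> + 2) * Q z + r z * d1 z + Ta z"
definition "k1 z = (1 / q z) *\<^sub>R (2 *\<^sub>R (Gam z *v M z) + r z *\<^sub>R D2 z)
   - ((\<beta> + 2) * (Q z / q z)) *\<^sub>R Y z - (2 * Q z / (q z)\<^sup>2) *\<^sub>R (Gam z *v GY z)"
definition "V z = Q z * l0 z - k1 z \<bullet> M z - Q z / q z * (r z * d1 z + Ta z)"
definition "grad_form z p = (h1 z \<bullet> M z + (r z * d1 z + Ta z) / q z - l0 z) * ((a z *v p) \<bullet> p)
   - 2 / q z * (r z * (\<Sum>i\<in>UNIV. (a z *v p) $ i * ((D z i *v Y z) \<bullet> p)) + (Gam z *v (a z *v p)) \<bullet> (a z *v p))"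
definition "Rh z t p \<nu> = grad_form z p - 2 * (h1 z \<bullet> (a z *v p)) * (M z \<bullet> p) - \<nu> * (l1 z \<bullet> (a z *v p))
   + r z / q z * (\<Sum>k\<in>UNIV. M z $ k * ((D z k *v p) \<bullet> p)) + t\<^sup>2 * \<beta>\<^sup>2 * \<nu>\<^sup>2 * V z
   + 4 * t * \<beta> * (M z \<bullet> p)\<^sup>2 / q z + 2 * t * \<beta> * l0 z * (M z \<bullet> p) * \<nu>
   + t * \<beta> * e1 z * \<nu> * (2 * (M z \<bullet> p) / q z + l0 z * \<nu>)"

lemma q_lower: assumes z: "z \<in> S" shows "1 \<le> K ^ 3 * q z" "q z > 0"
proof -
  have "1 * 1 \<le> (K * norm (Y z)) * (K * norm (Y z))" using Yb(2)[OF z] by (intro mult_mono) auto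
  also have "\<dots> = K\<^sup>2 * (norm (Y z))\<^sup>2" by (simp add: power2_eq_square mult_ac)
  also have "\<dots> \<le> K\<^sup>2 * (K * q z)" unfolding q_def by (intro mult_left_mono ell z) auto
  finally show 1: "1 \<le> K ^ 3 * q z" by (simp add: power2_eq_square power3_eq_cube mult.assoc)
  have "\<not> q z \<le> 0"
  proof
    assume "q z \<le> 0"
    then have "K ^ 3 * q z \<le> 0" using K by (simp add: mult_nonneg_nonpos)
    then show False using 1 by simp
  qed
  then show "q z > 0" by simp
qed

lemma O1_Y: "O1 Y" by (rule uO_I[of _ _ K]) (use Yb K in auto)
lemma O1_GY: "O1 GY" unfolding GY_def by (intro uO_G O1_Y)
lemma O1_M: "O1 M" unfolding M_def by (intro uO_a O1_Y)
lemma O1_q: "O1 q" unfolding q_def by (intro O1_inner uO_G O1_Y)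
lemma O1_Q: "O1 Q" unfolding Q_def by (intro O1_inner O1_M O1_Y)
lemma O1_inv_q: "O1 (\<lambda>z. 1 / q z)"
proof (rule uO_I[of _ _ "K ^ 3"])
  fix z assume z: "z \<in> S"
  show "norm (1 / q z) \<le> K ^ 3 * 1" using q_lower[OF z] by (simp add: field_simps)
qed (use K in simp)
lemma O1_div_q: "O1 f \<Longrightarrow> O1 (\<lambda>z. f z / q z)" using O1_mult[OF _ O1_inv_q, of f] by simp
lemma Or_div_q: "Or f \<Longrightarrow> Or (\<lambda>z. f z / q z)" using Or_mult[OF _ O1_inv_q, of f] by simp
lemma O1_div_q2: "O1 f \<Longrightarrow> O1 (\<lambda>z. f z / (q z)\<^sup>2)"
  using O1_div_q[OF O1_div_q, of f] by (simp add: power2_eq_square)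
lemma Or_div_q2: "Or f \<Longrightarrow> Or (\<lambda>z. f z / (q z)\<^sup>2)"
  using Or_div_q[OF Or_div_q, of f] by (simp add: power2_eq_square)
lemma O1_T: "O1 T" unfolding T_def by (intro uO_sum_comp uO_G uO_Gam O1_const)
lemma O1_Ta: "O1 Ta" unfolding Ta_def by (intro uO_sum_comp uO_a uO_Gam O1_const)
lemma Or_TaT: "Or (\<lambda>z. Ta z - T z)"
proof -
  have "Or (\<lambda>z. \<Sum>i\<in>UNIV. (a z *v (Gam z *v axis i 1) - G z *v (Gam z *v axis i 1)) $ i)"
    by (intro uO_sum_comp Or_near uO_Gam O1_const)
  then show ?thesis by (simp add: Ta_def T_def sum_subtractf)
qed
lemma Or_MGY: "Or (\<lambda>z. M z - GY z)" unfolding M_def GY_def by (intro Or_near O1_Y)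
lemma Or_Qq: "Or (\<lambda>z. Q z - q z)"
proof -
  have "Or (\<lambda>z. (M z - GY z) \<bullet> Y z)" by (intro Or_inner Or_MGY O1_Y)
  then show ?thesis by (simp add: Q_def q_def GY_def inner_diff_left)
qed
lemma O1_P: "O1 P" unfolding P_def by (intro O1_inner uO_Gam O1_GY)
lemma O1_h1: "O1 h1" unfolding h1_def by (intro uO_diff O1_scaleR O1_div_q O1_div_q2 O1_const O1_Y uO_Gam O1_GY)
lemma O1_l0: "O1 l0" unfolding l0_def by (intro uO_diff O1_div_q O1_const O1_T)
lemma O1_l1: "O1 l1" unfolding l1_def by (intro uO_diff O1_scaleR O1_const O1_T O1_h1 O1_Y)
lemma O1_d1: "O1 d1" unfolding d1_def by (intro uO_sum_comp uO_D O1_Y)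
lemma O1_D2: "O1 D2"
proof -
  have c: "O1 (\<lambda>z. (D z k *v Y z) \<bullet> Y z)" for k by (intro O1_inner uO_D O1_Y)
  have e: "D2 z = (\<Sum>k\<in>UNIV. ((D z k *v Y z) \<bullet> Y z) *\<^sub>R axis k 1)" for z
    unfolding D2_def by (simp add: vec_eq_iff sum_component axis_def if_distrib sum.delta cong: if_cong)
  show ?thesis unfolding e by (rule uO_sum) (intro O1_scaleR c O1_const)
qed
lemma O1_r: "O1 r" by (rule Or_imp_O1[OF Or_r])
lemma O1_e1: "O1 e1" unfolding e1_def by (intro uO_add O1_mult O1_const O1_Q O1_r O1_d1 O1_Ta)

section \<open>Coercivity of the remainder\<close>

text \<open>
  If \<open>g(x)\<close> were \<open>g(0)\<close>, the first and the last term of \<open>k1\<close> would cancel; this identity isolates the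
  deviations, which are small with \<open>r\<close>.
\<close>

lemma k1_deviation:
  fixes u w d y :: "real ^ 'n"
  assumes "qz \<noteq> 0"
  shows "(1 / qz) *\<^sub>R (2 *\<^sub>R u + rz *\<^sub>R d) - (b * (Qz / qz)) *\<^sub>R y - (2 * Qz / qz\<^sup>2) *\<^sub>R w
    = (1 / qz) *\<^sub>R (2 *\<^sub>R (u - w) + rz *\<^sub>R d) - (b * ((Qz - qz) / qz)) *\<^sub>R y - (2 * (Qz - qz) / qz\<^sup>2) *\<^sub>R w - b *\<^sub>R y"
  using assms by (simp add: vec_eq_iff) (simp add: field_simps power2_eq_square)

text \<open>
  Up to \<open>O(r)\<close> one has \<open>Q = q\<close>, \<open>Ta = T\<close> and \<open>k1 = -(\<beta> + 2) Y\<close>, so that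
  \<open>V = q l0 + (\<beta> + 2) q - T = (\<beta> - \<omega>) q\<close>. The trace disappears thanks to the choice of \<open>l0\<close>.
\<close>

lemma Or_V: "Or (\<lambda>z. V z - (\<beta> - \<omega>) * q z)"
proof -
  let ?k = "\<lambda>z. (1 / q z) *\<^sub>R (2 *\<^sub>R (Gam z *v (M z - GY z)) + r z *\<^sub>R D2 z)
     - ((\<beta> + 2) * ((Q z - q z) / q z)) *\<^sub>R Y z - (2 * (Q z - q z) / (q z)\<^sup>2) *\<^sub>R (Gam z *v GY z)"
  have k: "Or ?k"
    by (intro uO_diff uO_add Or_scaleR' Or_scaleR O1_div_q O1_const uO_Gam Or_MGY Or_r O1_D2 Or_mult' Or_div_q Or_Qq O1_Y Or_div_q2 O1_GY)
  have keq: "k1 z = ?k z - (\<beta> + 2) *\<^sub>R Y z" if "z \<in> S" for z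
    unfolding k1_def matrix_vector_mult_diff_distrib using q_lower(2)[OF that]
    by (intro k1_deviation) simp
  have "Or (\<lambda>z. (Q z - q z) * l0 z - (?k z \<bullet> M z) + (\<beta> + 2) * (Q z - q z)
     - ((Q z - q z) / q z * (r z * d1 z + Ta z) + r z * d1 z + (Ta z - T z)))"
    by (intro uO_diff uO_add Or_mult Or_mult' Or_Qq O1_l0 Or_inner k O1_M O1_const Or_div_q O1_mult O1_r O1_d1 O1_Ta Or_r Or_TaT)
  then show ?thesis
  proof (rule uO_cong)
    fix z assume z: "z \<in> S"
    have q0: "q z \<noteq> 0" using q_lower[OF z] by simp
    have YM: "Y z \<bullet> M z = Q z" by (simp add: Q_def inner_commute)
    have ql: "q z * l0 z = T z - (2 + \<omega>) * q z" using q0 by (simp add: l0_def algebra_simps)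
    have k1M: "k1 z \<bullet> M z = ?k z \<bullet> M z - (\<beta> + 2) * Q z" unfolding keq[OF z] by (simp add: inner_diff_left YM)
    have Qq: "Q z / q z = (Q z - q z) / q z + 1" using q0 by (simp add: diff_divide_distrib)
    have "V z = Q z * l0 z - (?k z \<bullet> M z - (\<beta> + 2) * Q z) - ((Q z - q z) / q z + 1) * (r z * d1 z + Ta z)"
      unfolding V_def k1M Qq ..
    also have "Q z * l0 z = (Q z - q z) * l0 z + (T z - (2 + \<omega>) * q z)" using ql by (simp add: algebra_simps)
    finally show "V z - (\<beta> - \<omega>) * q z = (Q z - q z) * l0 z - (?k z \<bullet> M z) + (\<beta> + 2) * (Q z - q z)
     - ((Q z - q z) / q z * (r z * d1 z + Ta z) + r z * d1 z + (Ta z - T z))"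
      by (simp add: algebra_simps)
  qed
qed

text \<open>
  Split \<open>p = \<xi> + \<alpha>Y\<close> with \<open>\<xi>\<close> tangential. The coefficient of the first form is
  \<open>\<beta> + 4 + \<omega> - 2P/q\<^sup>2\<close>, so the tangential part is at least
  \<open>((\<beta> + 4 + \<omega>) - 2 (2 + \<omega>)) (G\<xi>,\<xi>) = (\<beta> - \<omega>) (G\<xi>,\<xi>)\<close>. All terms that involve \<open>\<alpha>\<close>, a multiple of
  \<open>(GY,p)\<close>, are charged to the negative term on the right.
\<close>

lemma frozen_grad_form_lower:
  "\<exists>c>0. \<exists>C\<ge>0. \<forall>z\<in>S. \<forall>p. (h1 z \<bullet> GY z + T z / q z - l0 z) * ((G z *v p) \<bullet> p) - 2 / q z * ((Gam z *v (G z *v p)) \<bullet> (G z *v p))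
     \<ge> c * (norm p)\<^sup>2 - C * (GY z \<bullet> p)\<^sup>2"
proof -
  let ?b = "\<lambda>z. h1 z \<bullet> GY z + T z / q z - l0 z"
  have O1_b: "O1 ?b" by (intro uO_diff uO_add O1_inner O1_h1 O1_GY O1_div_q O1_T O1_l0)
  have O1_w: "O1 (\<lambda>z. (1 / q z) *\<^sub>R GY z)" by (intro O1_scaleR O1_inv_q O1_GY)
  have "O1 (\<lambda>z. ?b z * q z - 2 * P z / q z)"
    by (intro uO_diff O1_mult O1_b O1_q O1_div_q O1_const O1_P)
  then obtain C4 where C4: "C4 \<ge> 0" "\<And>z. z \<in> S \<Longrightarrow> \<bar>?b z * q z - 2 * P z / q z\<bar> \<le> C4" unfolding uO_def by auto
  obtain Bw where Bw: "Bw \<ge> 0" "\<And>z. z \<in> S \<Longrightarrow> norm ((1 / q z) *\<^sub>R GY z) \<le> Bw" using O1_w unfolding uO_def by auto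
  obtain Bi where Bi: "Bi \<ge> 0" "\<And>z. z \<in> S \<Longrightarrow> \<bar>1 / q z\<bar> \<le> Bi" using O1_inv_q unfolding uO_def by auto
  obtain Bq where Bq: "Bq \<ge> 0" "\<And>z. z \<in> S \<Longrightarrow> \<bar>q z\<bar> \<le> Bq" using O1_q unfolding uO_def by auto
  define \<epsilon> where "\<epsilon> = \<beta> - \<omega>"
  have eps: "\<epsilon> > 0" using \<omega> by (simp add: \<epsilon>_def)
  define C2 where "C2 = 4 * (K * K) * Bw"
  define C3 where "C3 = K * C2\<^sup>2 / (2 * \<epsilon>)"
  define C5 where "C5 = C3 + C4 + \<epsilon> / 2 * Bq"
  have C: "C2 \<ge> 0" "C3 \<ge> 0" "C5 \<ge> 0" using K Bw C4 Bq eps by (auto simp: C2_def C3_def C5_def)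
  have main: "?b z * ((G z *v p) \<bullet> p) - 2 / q z * ((Gam z *v (G z *v p)) \<bullet> (G z *v p))
     \<ge> \<epsilon> / (2 * K) * (norm p)\<^sup>2 - (C5 * Bi\<^sup>2) * (GY z \<bullet> p)\<^sup>2" if z: "z \<in> S" for z p
  proof -
    have q0: "q z > 0" by (rule q_lower[OF z])
    define \<alpha> where "\<alpha> = (GY z \<bullet> p) / q z"
    define \<xi> where "\<xi> = p - \<alpha> *\<^sub>R Y z"
    define N where "N = (G z *v \<xi>) \<bullet> \<xi>"
    define N2 where "N2 = (Gam z *v (G z *v \<xi>)) \<bullet> (G z *v \<xi>)"
    define X where "X = (Gam z *v (G z *v \<xi>)) \<bullet> GY z"
    have GYY: "GY z \<bullet> Y z = q z" by (simp add: GY_def q_def)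
    have orth: "GY z \<bullet> \<xi> = 0" using q0 by (simp add: \<xi>_def inner_diff_right GYY \<alpha>_def)
    have orth': "(G z *v \<xi>) \<bullet> Y z = 0" using orth sym(2)[OF z, of \<xi> "Y z"] by (simp add: GY_def inner_commute)
    have p: "p = \<xi> + \<alpha> *\<^sub>R Y z" by (simp add: \<xi>_def)
    have Gp: "G z *v p = G z *v \<xi> + \<alpha> *\<^sub>R GY z"
      by (subst p) (simp add: matrix_vector_right_distrib matrix_vector_mult_scaleR GY_def)
    have 1: "(G z *v p) \<bullet> p = N + \<alpha>\<^sup>2 * q z"
      unfolding Gp by (subst p) (simp add: inner_add_left inner_add_right orth orth' GYY N_def power2_eq_square)
    have X': "(Gam z *v GY z) \<bullet> (G z *v \<xi>) = X"
      using sym(3)[OF z, of "GY z" "G z *v \<xi>"] by (simp add: X_def inner_commute)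
    have 2: "(Gam z *v (G z *v p)) \<bullet> (G z *v p) = N2 + 2 * \<alpha> * X + \<alpha>\<^sup>2 * P z"
      unfolding Gp
      by (simp add: matrix_vector_right_distrib matrix_vector_mult_scaleR inner_add_left inner_add_right X' N2_def P_def
          power2_eq_square algebra_simps) (simp add: X_def)
    have "h1 z \<bullet> GY z = (\<beta> + 2) / q z * (Y z \<bullet> GY z) - 2 / (q z)\<^sup>2 * P z"
      by (simp add: h1_def inner_diff_left P_def)
    then have b: "?b z = \<beta> + 4 + \<omega> - 2 * (P z / (q z)\<^sup>2)"
      using q0 by (simp add: inner_commute[of "Y z"] GYY l0_def)
    have tg: "P z / (q z)\<^sup>2 * N + N2 / q z \<le> (2 + \<omega>) * N"
      using tang[OF z orth[unfolded GY_def]] unfolding P_def N_def N2_def q_def GY_def .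
    have N0: "(norm \<xi>)\<^sup>2 \<le> K * N" unfolding N_def by (rule ell[OF z])
    \<comment> \<open>Half of the tangential gain pays for the mixed term.\<close>
    have Xb: "\<bar>4 * \<alpha> / q z * X\<bar> \<le> \<epsilon> / 2 * N + C3 * \<alpha>\<^sup>2"
    proof -
      have "X / q z = (Gam z *v (G z *v \<xi>)) \<bullet> ((1 / q z) *\<^sub>R GY z)" by (simp add: X_def)
      then have "\<bar>X / q z\<bar> \<le> norm (Gam z *v (G z *v \<xi>)) * norm ((1 / q z) *\<^sub>R GY z)"
        by (simp only: Cauchy_Schwarz_ineq2)
      also have "\<dots> \<le> (K * (K * norm \<xi>)) * Bw"
        using Bw(2)[OF z] K order_trans[OF nb(3)[OF z, of "G z *v \<xi>"] mult_left_mono[OF nb(2)[OF z, of \<xi>]]]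
        by (intro mult_mono) auto
      finally have "\<bar>X / q z\<bar> \<le> K * (K * norm \<xi>) * Bw" .
      then have "4 * \<bar>\<alpha>\<bar> * \<bar>X / q z\<bar> \<le> 4 * \<bar>\<alpha>\<bar> * (K * (K * norm \<xi>) * Bw)" by (intro mult_left_mono) auto
      then have a: "\<bar>4 * \<alpha> / q z * X\<bar> \<le> C2 * \<bar>\<alpha>\<bar> * norm \<xi>" by (simp add: C2_def abs_mult mult_ac)
      have "0 \<le> \<epsilon> / (2 * K) * (norm \<xi> - K * C2 / \<epsilon> * \<bar>\<alpha>\<bar>)\<^sup>2" using eps K by simp
      also have "\<dots> = \<epsilon> / (2 * K) * (norm \<xi>)\<^sup>2 - C2 * \<bar>\<alpha>\<bar> * norm \<xi> + C3 * \<alpha>\<^sup>2"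
        using eps K by (simp add: C3_def power2_diff power_mult_distrib power_divide) (simp add: field_simps power2_eq_square)
      finally have "C2 * \<bar>\<alpha>\<bar> * norm \<xi> \<le> \<epsilon> / (2 * K) * (norm \<xi>)\<^sup>2 + C3 * \<alpha>\<^sup>2" by simp
      moreover have "\<epsilon> / (2 * K) * (norm \<xi>)\<^sup>2 \<le> \<epsilon> / (2 * K) * (K * N)" using N0 eps K by (intro mult_left_mono) auto
      moreover have "\<epsilon> / (2 * K) * (K * N) = \<epsilon> / 2 * N" using K by simp
      ultimately show ?thesis using a by linarith
    qed
    have "?b z * ((G z *v p) \<bullet> p) - 2 / q z * ((Gam z *v (G z *v p)) \<bullet> (G z *v p))
       = (?b z * N - 2 * (N2 / q z)) + \<alpha>\<^sup>2 * (?b z * q z - 2 * P z / q z) - 4 * \<alpha> / q z * X"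
      unfolding 1 2 using q0 by (simp add: field_simps)
    moreover have "?b z * N - 2 * (N2 / q z) \<ge> \<epsilon> * N"
    proof -
      have "?b z * N - 2 * (N2 / q z) = (\<beta> + 4 + \<omega>) * N - 2 * (P z / (q z)\<^sup>2 * N + N2 / q z)"
        unfolding b by (simp add: left_diff_distrib distrib_left)
      moreover have "(\<beta> + 4 + \<omega>) * N - 2 * ((2 + \<omega>) * N) = \<epsilon> * N" by (simp add: \<epsilon>_def algebra_simps)
      \<comment> \<open>Abstracting the nonlinear subterms leaves a problem of linear arithmetic.\<close>
      moreover have "L = A - 2 * X \<Longrightarrow> A - 2 * Y = E \<Longrightarrow> X \<le> Y \<Longrightarrow> E \<le> L" for L A X Y E :: real by linarith
      ultimately show ?thesis using tg by blast
    qed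
    then have "2 * (\<epsilon> / 2 * N) \<le> ?b z * N - 2 * (N2 / q z)" by simp
    moreover have "- (C4 * \<alpha>\<^sup>2) \<le> \<alpha>\<^sup>2 * (?b z * q z - 2 * P z / q z)"
    proof -
      have "\<alpha>\<^sup>2 * (- C4) \<le> \<alpha>\<^sup>2 * (?b z * q z - 2 * P z / q z)"
        by (rule mult_left_mono) (use C4(2)[OF z] in \<open>simp_all only: abs_le_iff zero_le_power2, linarith\<close>)
      then show ?thesis by (simp only: mult_minus_right mult.commute[of C4])
    qed
    moreover note Xb
    moreover have "F = W + U - X' \<Longrightarrow> 2 * H \<le> W \<Longrightarrow> - D4 \<le> U \<Longrightarrow> \<bar>X'\<bar> \<le> H + D3 \<Longrightarrow> H - (D3 + D4) \<le> F"
      for F W U X' H D3 D4 :: real by linarith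
    ultimately have low: "\<epsilon> / 2 * N - (C3 * \<alpha>\<^sup>2 + C4 * \<alpha>\<^sup>2) \<le> ?b z * ((G z *v p) \<bullet> p) - 2 / q z * ((Gam z *v (G z *v p)) \<bullet> (G z *v p))"
      by blast
    have Nlow: "\<epsilon> / 2 * N \<ge> \<epsilon> / (2 * K) * (norm p)\<^sup>2 - \<epsilon> / 2 * Bq * \<alpha>\<^sup>2"
    proof -
      have "(norm p)\<^sup>2 \<le> K * (N + \<alpha>\<^sup>2 * q z)" using ell[OF z, of p] unfolding 1 .
      then have "\<epsilon> / (2 * K) * (norm p)\<^sup>2 \<le> \<epsilon> / (2 * K) * (K * (N + \<alpha>\<^sup>2 * q z))" using eps K by (intro mult_left_mono) auto
      also have "\<dots> = \<epsilon> / 2 * N + \<epsilon> / 2 * (q z * \<alpha>\<^sup>2)" using K by (simp add: distrib_left mult.commute)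
      finally have "\<epsilon> / (2 * K) * (norm p)\<^sup>2 \<le> \<epsilon> / 2 * N + \<epsilon> / 2 * (q z * \<alpha>\<^sup>2)" .
      moreover have "\<epsilon> / 2 * (q z * \<alpha>\<^sup>2) \<le> \<epsilon> / 2 * (Bq * \<alpha>\<^sup>2)"
        using Bq(2)[OF z] eps by (intro mult_left_mono mult_right_mono) auto
      ultimately show ?thesis by (simp add: mult.assoc)
    qed
    have C5: "C5 * \<alpha>\<^sup>2 \<le> (C5 * Bi\<^sup>2) * (GY z \<bullet> p)\<^sup>2"
    proof -
      have "(1 / q z)\<^sup>2 \<le> Bi\<^sup>2" using Bi(2)[OF z] by (metis abs_le_square_iff abs_of_nonneg Bi(1))
      then have "(1 / q z)\<^sup>2 * (GY z \<bullet> p)\<^sup>2 \<le> Bi\<^sup>2 * (GY z \<bullet> p)\<^sup>2" by (intro mult_right_mono) auto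
      moreover have "\<alpha>\<^sup>2 = (1 / q z)\<^sup>2 * (GY z \<bullet> p)\<^sup>2" by (simp add: \<alpha>_def power_divide)
      ultimately have "C5 * \<alpha>\<^sup>2 \<le> C5 * (Bi\<^sup>2 * (GY z \<bullet> p)\<^sup>2)" using C by (intro mult_left_mono) auto
      then show ?thesis by (simp add: mult.assoc)
    qed
    have "C5 * \<alpha>\<^sup>2 = C3 * \<alpha>\<^sup>2 + C4 * \<alpha>\<^sup>2 + \<epsilon> / 2 * Bq * \<alpha>\<^sup>2" by (simp add: C5_def algebra_simps)
    moreover have "H - (D3 + D4) \<le> F \<Longrightarrow> n - D5 \<le> H \<Longrightarrow> D6 \<le> D7 \<Longrightarrow> D6 = D3 + D4 + D5 \<Longrightarrow> n - D7 \<le> F"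
      for F H D3 D4 D5 D6 D7 n :: real by linarith
    ultimately show ?thesis using low Nlow C5 by blast
  qed
  have "\<epsilon> / (2 * K) > 0" "C5 * Bi\<^sup>2 \<ge> 0" using eps K C by auto
  then show ?thesis using main by blast
qed

text \<open>
  Replacing \<open>g(x)\<close> by \<open>g(0)\<close> changes the gradient form by \<open>O(r) |p|\<^sup>2\<close>, and \<open>(GY,p)\<^sup>2\<close> is at
  most \<open>2 (M,p)\<^sup>2 + O(r) |p|\<^sup>2\<close> with \<open>M = g(x)Y\<close>.
\<close>

lemma grad_form_lower:
  "\<exists>c>0. \<exists>C\<ge>0. \<forall>z\<in>S. \<forall>p. grad_form z p \<ge> c * (norm p)\<^sup>2 - C * (M z \<bullet> p)\<^sup>2 - C * r z * (norm p)\<^sup>2"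
proof -
  obtain c C where c: "c > 0" "C \<ge> 0" and frozen: "\<And>z p. z \<in> S \<Longrightarrow>
     (h1 z \<bullet> GY z + T z / q z - l0 z) * ((G z *v p) \<bullet> p) - 2 / q z * ((Gam z *v (G z *v p)) \<bullet> (G z *v p))
     \<ge> c * (norm p)\<^sup>2 - C * (GY z \<bullet> p)\<^sup>2"
    using frozen_grad_form_lower by blast
  let ?bfr = "\<lambda>z. h1 z \<bullet> GY z + T z / q z - l0 z"
  let ?b = "\<lambda>z. h1 z \<bullet> M z + (r z * d1 z + Ta z) / q z - l0 z"
  have "O1 ?bfr" by (intro uO_diff uO_add O1_inner O1_h1 O1_GY O1_div_q O1_T O1_l0)
  then obtain B0 where B0: "B0 \<ge> 0" "\<And>z. z \<in> S \<Longrightarrow> \<bar>?bfr z\<bar> \<le> B0" unfolding uO_def by auto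
  have "Or (\<lambda>z. h1 z \<bullet> (M z - GY z) + (r z * d1 z + (Ta z - T z)) / q z)"
    by (intro uO_add Or_inner' O1_h1 Or_MGY Or_div_q Or_mult Or_r O1_d1 Or_TaT) 
  then have "Or (\<lambda>z. ?b z - ?bfr z)"
    by (rule uO_cong) (simp add: inner_diff_right add_divide_distrib diff_divide_distrib)
  then obtain Bb where Bb: "Bb \<ge> 0" "\<And>z. z \<in> S \<Longrightarrow> \<bar>?b z - ?bfr z\<bar> \<le> Bb * r z" unfolding uO_def by auto
  obtain Bi where Bi: "Bi \<ge> 0" "\<And>z. z \<in> S \<Longrightarrow> \<bar>1 / q z\<bar> \<le> Bi" using O1_inv_q unfolding uO_def by auto
  obtain Bm where Bm: "Bm \<ge> 0" "\<And>z. z \<in> S \<Longrightarrow> norm (M z - GY z) \<le> Bm * r z" using Or_MGY unfolding uO_def by auto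
  let ?n = "real CARD('n)"
  define E where "E = Bb * K + B0 * K + 2 * Bi * (?n * (K * K * K) + 2 * (K * K * K))"
  have E: "E \<ge> 0" using Bb B0 Bi K by (simp add: E_def)
  have dev: "\<bar>grad_form z p - (?bfr z * ((G z *v p) \<bullet> p) - 2 / q z * ((Gam z *v (G z *v p)) \<bullet> (G z *v p)))\<bar> \<le> E * r z * (norm p)\<^sup>2"
    if z: "z \<in> S" for z p
  proof -
    let ?ap = "a z *v p" and ?Gp = "G z *v p"
    let ?s = "\<Sum>i\<in>UNIV. ?ap $ i * ((D z i *v Y z) \<bullet> p)"
    have rz: "r z \<ge> 0" by (rule r0[OF z])
    have nd: "norm (?ap - ?Gp) \<le> K * r z * norm p" by (rule near[OF z])
    have 1: "\<bar>(?b z - ?bfr z) * (?ap \<bullet> p)\<bar> \<le> (Bb * r z) * (K * norm p * norm p)"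
      unfolding abs_mult using Bb(2)[OF z]
      by (intro mult_mono order_trans[OF Cauchy_Schwarz_ineq2] mult_right_mono nb z) (use Bb rz in auto)
    have 2: "\<bar>?bfr z * ((?ap - ?Gp) \<bullet> p)\<bar> \<le> B0 * (K * r z * norm p * norm p)"
      unfolding abs_mult using B0(2)[OF z]
      by (intro mult_mono order_trans[OF Cauchy_Schwarz_ineq2] mult_right_mono nd) (use B0 in auto)
    have 3: "\<bar>?s\<bar> \<le> ?n * (K * norm p * (K * K) * norm p)"
    proof -
      have "\<bar>?s\<bar> \<le> (\<Sum>i\<in>(UNIV::'n set). K * norm p * (K * K) * norm p)"
      proof (rule order_trans[OF sum_abs sum_mono])
        fix i :: 'n
        have "\<bar>?ap $ i\<bar> \<le> K * norm p" by (rule order_trans[OF component_le_norm_cart nb(1)[OF z]])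
        moreover have "norm (D z i *v Y z) \<le> K * K"
          by (rule order_trans[OF nb(4)[OF z]]) (use Yb(1)[OF z] K in \<open>auto intro: mult_left_mono\<close>)
        then have "\<bar>(D z i *v Y z) \<bullet> p\<bar> \<le> K * K * norm p"
          by (intro order_trans[OF Cauchy_Schwarz_ineq2] mult_right_mono) auto
        ultimately have "\<bar>?ap $ i\<bar> * \<bar>(D z i *v Y z) \<bullet> p\<bar> \<le> (K * norm p) * (K * K * norm p)"
          by (intro mult_mono) (use K in auto)
        then show "\<bar>?ap $ i * ((D z i *v Y z) \<bullet> p)\<bar> \<le> K * norm p * (K * K) * norm p"
          by (simp add: abs_mult mult_ac)
      qed
      then show ?thesis by simp
    qed
    have 4: "\<bar>(Gam z *v ?ap) \<bullet> ?ap - (Gam z *v ?Gp) \<bullet> ?Gp\<bar> \<le> 2 * (K * (K * r z * norm p) * (K * norm p))"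
    proof -
      have "(Gam z *v ?ap) \<bullet> ?ap - (Gam z *v ?Gp) \<bullet> ?Gp = (Gam z *v (?ap - ?Gp)) \<bullet> ?ap + (Gam z *v (?ap - ?Gp)) \<bullet> ?Gp"
        using sym(3)[OF z, of ?ap ?Gp]
        by (simp add: matrix_vector_mult_diff_distrib inner_diff_left inner_commute[of ?ap])
      moreover have "\<bar>(Gam z *v (?ap - ?Gp)) \<bullet> x\<bar> \<le> K * (K * r z * norm p) * (K * norm p)" if x: "norm x \<le> K * norm p" for x
      proof -
        have "norm (Gam z *v (?ap - ?Gp)) \<le> K * (K * r z * norm p)"
          by (rule order_trans[OF nb(3)[OF z] mult_left_mono[OF nd]]) (use K in simp)
        then show ?thesis by (intro order_trans[OF Cauchy_Schwarz_ineq2] mult_mono x) (use K rz in auto)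
      qed
      from this[OF nb(1)[OF z]] this[OF nb(2)[OF z]]
      have "\<bar>(Gam z *v (?ap - ?Gp)) \<bullet> ?ap\<bar> \<le> K * (K * r z * norm p) * (K * norm p)"
        "\<bar>(Gam z *v (?ap - ?Gp)) \<bullet> ?Gp\<bar> \<le> K * (K * r z * norm p) * (K * norm p)" .
      ultimately show ?thesis by linarith
    qed
    have 5: "\<bar>2 / q z * (r z * ?s + ((Gam z *v ?ap) \<bullet> ?ap - (Gam z *v ?Gp) \<bullet> ?Gp))\<bar>
       \<le> (2 * Bi) * (r z * (?n * (K * norm p * (K * K) * norm p)) + 2 * (K * (K * r z * norm p) * (K * norm p)))"
    proof -
      have "\<bar>r z * ?s\<bar> \<le> r z * (?n * (K * norm p * (K * K) * norm p))"
        unfolding abs_mult using 3 rz by (intro mult_mono) auto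
      then have "\<bar>r z * ?s + ((Gam z *v ?ap) \<bullet> ?ap - (Gam z *v ?Gp) \<bullet> ?Gp)\<bar>
        \<le> r z * (?n * (K * norm p * (K * K) * norm p)) + 2 * (K * (K * r z * norm p) * (K * norm p))"
        using 4 by linarith
      moreover have "\<bar>2 / q z\<bar> \<le> 2 * Bi" using Bi(2)[OF z] by (simp add: abs_divide)
      ultimately show ?thesis unfolding abs_mult by (intro mult_mono) (use Bi in auto)
    qed
    have "grad_form z p - (?bfr z * ((G z *v p) \<bullet> p) - 2 / q z * ((Gam z *v (G z *v p)) \<bullet> (G z *v p)))
      = (?b z - ?bfr z) * (?ap \<bullet> p) + ?bfr z * ((?ap - ?Gp) \<bullet> p)
        - 2 / q z * (r z * ?s + ((Gam z *v ?ap) \<bullet> ?ap - (Gam z *v ?Gp) \<bullet> ?Gp))"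
      unfolding grad_form_def by (simp add: inner_diff_left algebra_simps)
    then have "\<bar>grad_form z p - (?bfr z * ((G z *v p) \<bullet> p) - 2 / q z * ((Gam z *v (G z *v p)) \<bullet> (G z *v p)))\<bar>
      \<le> (Bb * r z) * (K * norm p * norm p) + B0 * (K * r z * norm p * norm p)
        + (2 * Bi) * (r z * (?n * (K * norm p * (K * K) * norm p)) + 2 * (K * (K * r z * norm p) * (K * norm p)))"
      using 1 2 5 by linarith
    also have "\<dots> = E * r z * (norm p)\<^sup>2" by (simp add: E_def power2_eq_square algebra_simps)
    finally show ?thesis .
  qed
  define C' where "C' = 2 * C + (E + 2 * C * Bm\<^sup>2)"
  have GYp: "(GY z \<bullet> p)\<^sup>2 \<le> 2 * (M z \<bullet> p)\<^sup>2 + 2 * Bm\<^sup>2 * r z * (norm p)\<^sup>2" if z: "z \<in> S" for z p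
  proof -
    let ?d = "(M z - GY z) \<bullet> p"
    have "\<bar>?d\<bar> \<le> Bm * r z * norm p"
      by (rule order_trans[OF Cauchy_Schwarz_ineq2 mult_right_mono[OF Bm(2)[OF z]]]) simp
    then have "?d\<^sup>2 \<le> (Bm * r z * norm p)\<^sup>2" by (rule abs_le_square_iff[THEN iffD1, OF order_trans]) simp
    also have "\<dots> = Bm\<^sup>2 * (norm p)\<^sup>2 * (r z * r z)" by (simp add: power2_eq_square mult_ac)
    also have "\<dots> \<le> Bm\<^sup>2 * (norm p)\<^sup>2 * (r z * 1)" using r[OF z] by (intro mult_left_mono) auto
    finally have d: "?d\<^sup>2 \<le> Bm\<^sup>2 * r z * (norm p)\<^sup>2" by (simp add: mult_ac)
    have id: "(x - y)\<^sup>2 + (x + y)\<^sup>2 = 2 * x\<^sup>2 + 2 * y\<^sup>2" for x y :: real by (simp add: power2_eq_square algebra_simps)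
    have "(x - y)\<^sup>2 \<le> 2 * x\<^sup>2 + 2 * y\<^sup>2" for x y :: real using id[of x y] zero_le_power2[of "x + y"] by linarith
    from this[of "M z \<bullet> p" ?d] have "(GY z \<bullet> p)\<^sup>2 \<le> 2 * (M z \<bullet> p)\<^sup>2 + 2 * ?d\<^sup>2"
      by (simp only: inner_diff_left diff_diff_eq2 add_diff_cancel_left' add_diff_cancel_left)
    also have "\<dots> \<le> 2 * (M z \<bullet> p)\<^sup>2 + 2 * (Bm\<^sup>2 * r z * (norm p)\<^sup>2)" by (intro add_left_mono mult_left_mono d) simp
    finally show ?thesis by (simp only: mult.assoc)
  qed
  have C'0: "C' \<ge> 0" "2 * C \<le> C'" "E + 2 * C * Bm\<^sup>2 \<le> C'" using c E by (auto simp: C'_def)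
  have "grad_form z p \<ge> c * (norm p)\<^sup>2 - C' * (M z \<bullet> p)\<^sup>2 - C' * r z * (norm p)\<^sup>2" if z: "z \<in> S" for z p
  proof -
    have "C * (GY z \<bullet> p)\<^sup>2 \<le> C * (2 * (M z \<bullet> p)\<^sup>2 + 2 * Bm\<^sup>2 * r z * (norm p)\<^sup>2)"
      using GYp[OF z] c by (intro mult_left_mono) auto
    then have "grad_form z p \<ge> c * (norm p)\<^sup>2 - (2 * C) * (M z \<bullet> p)\<^sup>2 - (E + 2 * C * Bm\<^sup>2) * (r z * (norm p)\<^sup>2)"
      using frozen[OF z, of p] dev[OF z, of p] by (simp add: algebra_simps abs_le_iff)
    moreover have "(2 * C) * (M z \<bullet> p)\<^sup>2 \<le> C' * (M z \<bullet> p)\<^sup>2" using C'0 by (intro mult_right_mono) auto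
    moreover have "(E + 2 * C * Bm\<^sup>2) * (r z * (norm p)\<^sup>2) \<le> C' * (r z * (norm p)\<^sup>2)"
      using C'0 r0[OF z] by (intro mult_right_mono) auto
    ultimately show ?thesis by (simp add: mult.assoc)
  qed
  then show ?thesis using c C'0 by blast
qed

text \<open>
  Keeps the linear bookkeeping of the eight terms of \<open>Rh\<close> apart from their nonlinear contents.
\<close>

lemma collect_lower_bounds:
  fixes g :: real
  shows "A \<le> g \<Longrightarrow> \<bar>x2\<bar> \<le> y2 \<Longrightarrow> \<bar>x3\<bar> \<le> y3 \<Longrightarrow> \<bar>x4\<bar> \<le> y4 \<Longrightarrow> x5 \<le> y5 \<Longrightarrow> x6 \<le> y6 \<Longrightarrow> \<bar>x7\<bar> \<le> y7 \<Longrightarrow> \<bar>x8\<bar> \<le> y8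
    \<Longrightarrow> A - y2 - y3 - y4 + x5 + x6 - y7 - y8 \<le> g - x2 - x3 + x4 + y5 + y6 + x7 + x8"
  by linarith

text \<open>
  Each of the eight terms of \<open>Rh\<close> is compared with the corresponding term of \<open>quadratic_absorption\<close>, with a
  single constant \<open>B\<close> that is the maximum of all bounds involved. The gradient part gives \<open>|p|\<^sup>2\<close>, the
  term with \<open>V\<close> gives \<open>t\<^sup>2\<nu>\<^sup>2\<close>, and the product of the first-order terms gives \<open>t (M,p)\<^sup>2\<close>.
\<close>

theorem Rh_coercive:
  "\<exists>c>0. \<exists>\<rho>>0. \<exists>t0\<ge>1. \<forall>z\<in>S. r z \<le> \<rho> \<longrightarrow> (\<forall>t\<ge>t0. \<forall>p \<nu>.
     c * ((norm p)\<^sup>2 + t * (M z \<bullet> p)\<^sup>2 + t\<^sup>2 * \<nu>\<^sup>2) \<le> Rh z t p \<nu>)"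
proof -
  obtain c C where c: "c > 0" "C \<ge> 0" and grad: "\<And>z p. z \<in> S \<Longrightarrow>
     grad_form z p \<ge> c * (norm p)\<^sup>2 - C * (M z \<bullet> p)\<^sup>2 - C * r z * (norm p)\<^sup>2"
    using grad_form_lower by blast
  have \<beta>: "\<beta> > 0" using \<omega> by simp
  obtain Bh where Bh: "Bh \<ge> 0" "\<And>z. z \<in> S \<Longrightarrow> norm (h1 z) \<le> Bh" using O1_h1 unfolding uO_def by auto
  obtain Bl where Bl: "Bl \<ge> 0" "\<And>z. z \<in> S \<Longrightarrow> norm (l1 z) \<le> Bl" using O1_l1 unfolding uO_def by auto
  have "O1 (\<lambda>z. (1 / q z) *\<^sub>R M z)" by (intro O1_scaleR O1_inv_q O1_M)
  then obtain Bm where Bm: "Bm \<ge> 0" "\<And>z. z \<in> S \<Longrightarrow> norm ((1 / q z) *\<^sub>R M z) \<le> Bm" unfolding uO_def by auto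
  obtain Bv where Bv: "Bv \<ge> 0" "\<And>z. z \<in> S \<Longrightarrow> \<bar>V z - (\<beta> - \<omega>) * q z\<bar> \<le> Bv * r z" using Or_V unfolding uO_def by auto
  have "O1 (\<lambda>z. 2 * \<beta> * l0 z + 2 * \<beta> * e1 z / q z)"
    by (intro uO_add O1_mult O1_div_q O1_const O1_l0 O1_e1)
  then obtain Bc where Bc: "Bc \<ge> 0" "\<And>z. z \<in> S \<Longrightarrow> \<bar>2 * \<beta> * l0 z + 2 * \<beta> * e1 z / q z\<bar> \<le> Bc" unfolding uO_def by auto
  have "O1 (\<lambda>z. \<beta> * e1 z * l0 z)" by (intro O1_mult O1_const O1_l0 O1_e1)
  then obtain Bd where Bd: "Bd \<ge> 0" "\<And>z. z \<in> S \<Longrightarrow> \<bar>\<beta> * e1 z * l0 z\<bar> \<le> Bd" unfolding uO_def by auto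
  obtain Bq where Bq: "Bq \<ge> 0" "\<And>z. z \<in> S \<Longrightarrow> \<bar>q z\<bar> \<le> Bq" using O1_q unfolding uO_def by auto
  obtain Bi where Bi: "Bi \<ge> 0" "\<And>z. z \<in> S \<Longrightarrow> \<bar>1 / q z\<bar> \<le> Bi" using O1_inv_q unfolding uO_def by auto
  let ?n = "real CARD('n)"
  let ?X = "{1, 1 / c, C, 2 * (Bh * K), Bl * K, ?n * (Bm * K), (Bi + 1) / (\<beta>\<^sup>2 * (\<beta> - \<omega>)), \<beta>\<^sup>2 * Bv, (Bq + 1) / (4 * \<beta>), Bc, Bd}"
  define B where "B = Max ?X"
  have Bge: "x \<le> B" if "x \<in> ?X" for x unfolding B_def by (rule Max_ge) (use that in auto)
  have B1: "B \<ge> 1" by (rule Bge) simp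
  obtain c' \<rho> t0 where abs: "c' > 0" "\<rho> > 0" "t0 \<ge> 1"
    "\<And>r t p \<mu> \<nu> X. 0 < r \<Longrightarrow> r \<le> \<rho> \<Longrightarrow> t0 \<le> t \<Longrightarrow> 0 \<le> p \<Longrightarrow>
       p\<^sup>2 / B - B * \<mu>\<^sup>2 - B * r * p\<^sup>2 - B * p * \<bar>\<mu>\<bar> - B * p * \<bar>\<nu>\<bar> - B * r * p\<^sup>2 + t\<^sup>2 * \<nu>\<^sup>2 * (1 / B - B * r)
        + t * \<mu>\<^sup>2 / B - B * t * \<bar>\<mu>\<bar> * \<bar>\<nu>\<bar> - B * t * \<nu>\<^sup>2 \<le> X \<Longrightarrow> c' * (p\<^sup>2 + t * \<mu>\<^sup>2 + t\<^sup>2 * \<nu>\<^sup>2) \<le> X"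
    using quadratic_absorption[OF B1] by blast
  have "c' * ((norm p)\<^sup>2 + t * (M z \<bullet> p)\<^sup>2 + t\<^sup>2 * \<nu>\<^sup>2) \<le> Rh z t p \<nu>"
    if z: "z \<in> S" and rz: "r z \<le> \<rho>" and t: "t \<ge> t0" for z t p \<nu>
  proof (rule abs(4)[OF r(1)[OF z] rz t norm_ge_zero])
    define \<mu> where "\<mu> = M z \<bullet> p"
    have q0: "q z > 0" by (rule q_lower[OF z])
    have t1: "t > 0" using t abs(3) by linarith
    have r0': "r z \<ge> 0" by (rule r0[OF z])
    have nap: "norm (a z *v p) \<le> K * norm p" by (rule nb(1)[OF z])
    have 1: "(norm p)\<^sup>2 / B - B * \<mu>\<^sup>2 - B * r z * (norm p)\<^sup>2 \<le> grad_form z p"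
    proof -
      have "1 / B \<le> c" using Bge[of "1 / c"] c B1 by (simp add: field_simps)
      then have "1 / B * (norm p)\<^sup>2 \<le> c * (norm p)\<^sup>2" by (intro mult_right_mono) auto
      moreover have "C * \<mu>\<^sup>2 \<le> B * \<mu>\<^sup>2" by (intro mult_right_mono Bge) auto
      moreover have "C * (r z * (norm p)\<^sup>2) \<le> B * (r z * (norm p)\<^sup>2)" by (intro mult_right_mono Bge) (use r0' in auto)
      ultimately show ?thesis using grad[OF z, of p] by (simp add: \<mu>_def mult.assoc)
    qed
    have 2: "\<bar>2 * (h1 z \<bullet> (a z *v p)) * \<mu>\<bar> \<le> B * norm p * \<bar>\<mu>\<bar>"
    proof -
      have "\<bar>h1 z \<bullet> (a z *v p)\<bar> \<le> Bh * (K * norm p)"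
        by (rule order_trans[OF Cauchy_Schwarz_ineq2 mult_mono[OF Bh(2)[OF z] nap]]) (use Bh in auto)
      then have "2 * \<bar>h1 z \<bullet> (a z *v p)\<bar> \<le> (2 * (Bh * K)) * norm p" by (simp add: mult_ac)
      also have "\<dots> \<le> B * norm p" by (intro mult_right_mono Bge) auto
      finally have "2 * \<bar>h1 z \<bullet> (a z *v p)\<bar> * \<bar>\<mu>\<bar> \<le> B * norm p * \<bar>\<mu>\<bar>" by (intro mult_right_mono) auto
      then show ?thesis by (simp add: abs_mult)
    qed
    have 3: "\<bar>\<nu> * (l1 z \<bullet> (a z *v p))\<bar> \<le> B * norm p * \<bar>\<nu>\<bar>"
    proof -
      have "\<bar>l1 z \<bullet> (a z *v p)\<bar> \<le> Bl * (K * norm p)"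
        by (rule order_trans[OF Cauchy_Schwarz_ineq2 mult_mono[OF Bl(2)[OF z] nap]]) (use Bl in auto)
      also have "\<dots> \<le> B * norm p" using Bge[of "Bl * K"] mult_right_mono[of "Bl * K" B "norm p"] by (simp add: mult.assoc)
      finally have "\<bar>l1 z \<bullet> (a z *v p)\<bar> * \<bar>\<nu>\<bar> \<le> B * norm p * \<bar>\<nu>\<bar>" by (intro mult_right_mono) auto
      then show ?thesis by (simp add: abs_mult mult.commute)
    qed
    have 4: "\<bar>r z / q z * (\<Sum>k\<in>UNIV. M z $ k * ((D z k *v p) \<bullet> p))\<bar> \<le> B * r z * (norm p)\<^sup>2"
    proof -
      have "\<bar>\<Sum>k\<in>UNIV. ((1 / q z) *\<^sub>R M z) $ k * ((D z k *v p) \<bullet> p)\<bar> \<le> (\<Sum>k\<in>(UNIV::'n set). Bm * (K * norm p * norm p))"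
      proof (rule order_trans[OF sum_abs sum_mono])
        fix k :: 'n
        have "\<bar>((1 / q z) *\<^sub>R M z) $ k\<bar> \<le> Bm" by (rule order_trans[OF component_le_norm_cart Bm(2)[OF z]])
        moreover have "\<bar>(D z k *v p) \<bullet> p\<bar> \<le> K * norm p * norm p"
          by (rule order_trans[OF Cauchy_Schwarz_ineq2 mult_right_mono[OF nb(4)[OF z]]]) simp
        ultimately show "\<bar>((1 / q z) *\<^sub>R M z) $ k * ((D z k *v p) \<bullet> p)\<bar> \<le> Bm * (K * norm p * norm p)"
          unfolding abs_mult by (intro mult_mono) (use Bm in auto)
      qed
      also have "\<dots> = (?n * (Bm * K)) * (norm p)\<^sup>2" by (simp add: power2_eq_square mult_ac)
      also have "\<dots> \<le> B * (norm p)\<^sup>2" by (intro mult_right_mono Bge) auto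
      finally have "r z * \<bar>\<Sum>k\<in>UNIV. ((1 / q z) *\<^sub>R M z) $ k * ((D z k *v p) \<bullet> p)\<bar> \<le> r z * (B * (norm p)\<^sup>2)"
        using r0' by (intro mult_left_mono) auto
      moreover have "(\<Sum>k\<in>UNIV. ((1 / q z) *\<^sub>R M z) $ k * ((D z k *v p) \<bullet> p)) = (\<Sum>k\<in>UNIV. M z $ k * ((D z k *v p) \<bullet> p)) / q z"
        by (simp add: sum_divide_distrib)
      ultimately show ?thesis using r0' q0 by (simp add: abs_mult abs_divide mult_ac)
    qed
    have 5: "t\<^sup>2 * \<nu>\<^sup>2 * (1 / B - B * r z) \<le> t\<^sup>2 * \<beta>\<^sup>2 * \<nu>\<^sup>2 * V z"
    proof -
      have e: "\<beta>\<^sup>2 * (\<beta> - \<omega>) > 0" using \<beta> \<omega> by simp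
      have iq: "1 / q z \<le> Bi + 1" using Bi(2)[OF z] q0 by simp
      have "1 / B \<le> (\<beta>\<^sup>2 * (\<beta> - \<omega>)) * q z"
      proof -
        have "(Bi + 1) / (\<beta>\<^sup>2 * (\<beta> - \<omega>)) \<le> B" by (rule Bge) simp
        then have "Bi + 1 \<le> B * (\<beta>\<^sup>2 * (\<beta> - \<omega>))" using e by (simp add: pos_divide_le_eq)
        then have "1 / q z \<le> B * (\<beta>\<^sup>2 * (\<beta> - \<omega>))" using iq by linarith
        then show ?thesis using q0 B1 by (simp add: field_simps)
      qed
      moreover have "\<beta>\<^sup>2 * (Bv * r z) \<le> B * r z"
        using Bge[of "\<beta>\<^sup>2 * Bv"] r0' mult_right_mono[of "\<beta>\<^sup>2 * Bv" B "r z"] by (simp add: mult.assoc)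
      moreover have "\<beta>\<^sup>2 * ((\<beta> - \<omega>) * q z - Bv * r z) \<le> \<beta>\<^sup>2 * V z"
        using Bv(2)[OF z] by (intro mult_left_mono) (auto simp: abs_le_iff)
      ultimately have "1 / B - B * r z \<le> \<beta>\<^sup>2 * V z" by (simp add: algebra_simps)
      then have "(t\<^sup>2 * \<nu>\<^sup>2) * (1 / B - B * r z) \<le> (t\<^sup>2 * \<nu>\<^sup>2) * (\<beta>\<^sup>2 * V z)" by (intro mult_left_mono) auto
      then show ?thesis by (simp add: mult_ac)
    qed
    have 6: "t * \<mu>\<^sup>2 / B \<le> 4 * t * \<beta> * \<mu>\<^sup>2 / q z"
    proof -
      have "(Bq + 1) / (4 * \<beta>) \<le> B" by (rule Bge) simp
      then have "q z \<le> B * (4 * \<beta>)" using Bq(2)[OF z] \<beta> by (simp add: pos_divide_le_eq)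
      then have "1 / B \<le> 4 * \<beta> / q z" using q0 B1 by (simp add: field_simps)
      then have "(t * \<mu>\<^sup>2) * (1 / B) \<le> (t * \<mu>\<^sup>2) * (4 * \<beta> / q z)" using t1 by (intro mult_left_mono) auto
      then show ?thesis by (simp add: mult_ac)
    qed
    have 7: "\<bar>t * (2 * \<beta> * l0 z + 2 * \<beta> * e1 z / q z) * \<mu> * \<nu>\<bar> \<le> B * t * \<bar>\<mu>\<bar> * \<bar>\<nu>\<bar>"
    proof -
      have "\<bar>2 * \<beta> * l0 z + 2 * \<beta> * e1 z / q z\<bar> \<le> B" by (rule order_trans[OF Bc(2)[OF z]]) (rule Bge, simp)
      then have "\<bar>2 * \<beta> * l0 z + 2 * \<beta> * e1 z / q z\<bar> * (t * \<bar>\<mu>\<bar> * \<bar>\<nu>\<bar>) \<le> B * (t * \<bar>\<mu>\<bar> * \<bar>\<nu>\<bar>)"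
        using t1 by (intro mult_right_mono) auto
      then show ?thesis using t1 by (simp add: abs_mult mult_ac)
    qed
    have 8: "\<bar>t * (\<beta> * e1 z * l0 z) * \<nu>\<^sup>2\<bar> \<le> B * t * \<nu>\<^sup>2"
    proof -
      have "\<bar>\<beta> * e1 z * l0 z\<bar> \<le> B" by (rule order_trans[OF Bd(2)[OF z]]) (rule Bge, simp)
      then have "\<bar>\<beta> * e1 z * l0 z\<bar> * (t * \<nu>\<^sup>2) \<le> B * (t * \<nu>\<^sup>2)" using t1 by (intro mult_right_mono) auto
      then show ?thesis using t1 by (simp add: abs_mult mult_ac)
    qed
    have R: "Rh z t p \<nu> = grad_form z p - 2 * (h1 z \<bullet> (a z *v p)) * \<mu> - \<nu> * (l1 z \<bullet> (a z *v p))
      + r z / q z * (\<Sum>k\<in>UNIV. M z $ k * ((D z k *v p) \<bullet> p)) + t\<^sup>2 * \<beta>\<^sup>2 * \<nu>\<^sup>2 * V z + 4 * t * \<beta> * \<mu>\<^sup>2 / q z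
      + t * (2 * \<beta> * l0 z + 2 * \<beta> * e1 z / q z) * \<mu> * \<nu> + t * (\<beta> * e1 z * l0 z) * \<nu>\<^sup>2"
      unfolding Rh_def \<mu>_def[symmetric] using q0 by (simp add: field_simps power2_eq_square)
    show "(norm p)\<^sup>2 / B - B * (M z \<bullet> p)\<^sup>2 - B * r z * (norm p)\<^sup>2 - B * norm p * \<bar>M z \<bullet> p\<bar> - B * norm p * \<bar>\<nu>\<bar> - B * r z * (norm p)\<^sup>2
        + t\<^sup>2 * \<nu>\<^sup>2 * (1 / B - B * r z) + t * (M z \<bullet> p)\<^sup>2 / B - B * t * \<bar>M z \<bullet> p\<bar> * \<bar>\<nu>\<bar> - B * t * \<nu>\<^sup>2 \<le> Rh z t p \<nu>"
      unfolding R \<mu>_def[symmetric] by (rule collect_lower_bounds[OF 1 2 3 4 5 6 7 8])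
  qed
  then show ?thesis using abs(1,2,3) by blast
qed

lemma multiplier_bound:
  "\<exists>B\<ge>0. \<forall>z\<in>S. \<forall>p \<nu>. (2 * (M z \<bullet> p) / q z + l0 z * \<nu>)\<^sup>2 \<le> B * ((M z \<bullet> p)\<^sup>2 + \<nu>\<^sup>2)"
proof -
  obtain Bi where Bi: "Bi \<ge> 0" "\<And>z. z \<in> S \<Longrightarrow> \<bar>1 / q z\<bar> \<le> Bi" using O1_inv_q unfolding uO_def by auto
  obtain Bl where Bl: "Bl \<ge> 0" "\<And>z. z \<in> S \<Longrightarrow> \<bar>l0 z\<bar> \<le> Bl" using O1_l0 unfolding uO_def by auto
  define B where "B = 8 * Bi\<^sup>2 + 2 * Bl\<^sup>2"
  have "(2 * (M z \<bullet> p) / q z + l0 z * \<nu>)\<^sup>2 \<le> B * ((M z \<bullet> p)\<^sup>2 + \<nu>\<^sup>2)" if z: "z \<in> S" for z p \<nu>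
  proof -
    define \<mu> where "\<mu> = M z \<bullet> p"
    have i2: "(1 / q z)\<^sup>2 \<le> Bi\<^sup>2" using Bi(2)[OF z] by (metis abs_le_square_iff abs_of_nonneg Bi(1))
    have l2: "(l0 z)\<^sup>2 \<le> Bl\<^sup>2" using Bl(2)[OF z] by (metis abs_le_square_iff abs_of_nonneg Bl(1))
    have "0 \<le> (2 * (1 / q z * \<mu>) - l0 z * \<nu>)\<^sup>2" by simp
    moreover have "(2 * x + y)\<^sup>2 + (2 * x - y)\<^sup>2 = 8 * x\<^sup>2 + 2 * y\<^sup>2" for x y :: real
      by (simp add: power2_eq_square algebra_simps)
    from this[of "1 / q z * \<mu>" "l0 z * \<nu>"]
    have "(2 * (1 / q z * \<mu>) + l0 z * \<nu>)\<^sup>2 + (2 * (1 / q z * \<mu>) - l0 z * \<nu>)\<^sup>2 = 8 * ((1 / q z)\<^sup>2 * \<mu>\<^sup>2) + 2 * ((l0 z)\<^sup>2 * \<nu>\<^sup>2)"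
      by (simp only: power_mult_distrib)
    ultimately have "(2 * (1 / q z * \<mu>) + l0 z * \<nu>)\<^sup>2 \<le> 8 * ((1 / q z)\<^sup>2 * \<mu>\<^sup>2) + 2 * ((l0 z)\<^sup>2 * \<nu>\<^sup>2)"
      by linarith
    also have "\<dots> \<le> 8 * (Bi\<^sup>2 * \<mu>\<^sup>2) + 2 * (Bl\<^sup>2 * \<nu>\<^sup>2)"
      using i2 l2 by (intro add_mono mult_left_mono mult_right_mono) auto
    also have "\<dots> \<le> B * (\<mu>\<^sup>2 + \<nu>\<^sup>2)" by (simp add: B_def algebra_simps)
    finally show ?thesis by (simp add: \<mu>_def)
  qed
  moreover have "B \<ge> 0" by (simp add: B_def)
  ultimately show ?thesis by blast
qed

end

section \<open>The divergence identity and the pointwise estimate\<close>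

text \<open>
  The product rule for \<open>\<partial>\<^sub>i X\<^sup>i\<close>, with the derivatives of all factors as parameters: \<open>H i\<close> stands for
  \<open>\<partial>\<^sub>i \<nabla>v\<close>, and \<open>dh\<close>, \<open>dl\<close>, \<open>dk\<close> for the gradients of \<open>h\<close>, \<open>l\<close> and \<open>k = \<kappa>\<^sup>2 Q h\<close>. In this form the
  divergence identity is pure algebra.
\<close>

definition flux_deriv where
  "flux_deriv a D Gam y p H v h l k dh dl dk i =
    (let m = a *v y; m' = D i *v y + a *v (Gam *v axis i 1); ap = a *v p in
      (2 * (dh $ i * (m \<bullet> p) + h * (m' \<bullet> p + m \<bullet> H i)) + (dl $ i * v + l * p $ i)) * ap $ i
      + (2 * (h * (m \<bullet> p)) + l * v) * ((D i *v p) $ i + (a *v H i) $ i)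
      - ((dh $ i * m $ i + h * m' $ i) * (ap \<bullet> p) + h * m $ i * ((D i *v p + a *v H i) \<bullet> p + ap \<bullet> H i))
      + ((dk $ i * m $ i + k * m' $ i) * v\<^sup>2 + k * m $ i * (2 * v * p $ i)))"

text \<open>
  Second derivatives of \<open>v\<close> survive only in \<open>N div (g\<nabla>v)\<close>: the terms \<open>2h (gp)\<^sup>i (m,H\<^sub>i)\<close> and
  \<open>2h m\<^sup>i (gp,H\<^sub>i)\<close>, of opposite sign, have the same sum over \<open>i\<close> because the Hessian is symmetric.
\<close>

lemma sum_flux_deriv:
  fixes a Gam :: "real ^ 'n ^ 'n" and D :: "'n \<Rightarrow> real ^ 'n ^ 'n" and H :: "'n \<Rightarrow> real ^ 'n"
    and y p dh dl dk :: "real ^ 'n" and v h l k :: real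
  assumes sym: "\<And>x y. (a *v x) \<bullet> y = x \<bullet> (a *v y)" and H: "\<And>i j. H i $ j = H j $ i"
  defines "m \<equiv> a *v y" and "ap \<equiv> a *v p"
  defines "m' \<equiv> \<lambda>i. D i *v y + a *v (Gam *v axis i 1)"
  shows "(\<Sum>i\<in>UNIV. flux_deriv a D Gam y p H v h l k dh dl dk i) =
     (2 * h * (m \<bullet> p) + l * v) * (\<Sum>i\<in>UNIV. (D i *v p) $ i + (a *v H i) $ i)
     + 2 * (dh \<bullet> ap) * (m \<bullet> p) + 2 * h * (\<Sum>i\<in>UNIV. ap $ i * (m' i \<bullet> p)) + v * (dl \<bullet> ap) + l * (ap \<bullet> p)
     - (dh \<bullet> m + h * (\<Sum>i\<in>UNIV. m' i $ i)) * (ap \<bullet> p) - h * (\<Sum>i\<in>UNIV. m $ i * ((D i *v p) \<bullet> p))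
     + (dk \<bullet> m + k * (\<Sum>i\<in>UNIV. m' i $ i)) * v\<^sup>2 + 2 * k * v * (m \<bullet> p)"
proof -
  have swap: "(\<Sum>i\<in>UNIV. x $ i * (w \<bullet> H i)) = (\<Sum>i\<in>UNIV. w $ i * (x \<bullet> H i))" for x w
  proof -
    have "(\<Sum>i\<in>UNIV. x $ i * (w \<bullet> H i)) = (\<Sum>i\<in>UNIV. \<Sum>j\<in>UNIV. x $ i * (w $ j * H i $ j))"
      by (simp add: inner_vec_def sum_distrib_left)
    also have "\<dots> = (\<Sum>j\<in>UNIV. \<Sum>i\<in>UNIV. x $ i * (w $ j * H i $ j))" by (rule sum.swap)
    also have "\<dots> = (\<Sum>j\<in>UNIV. \<Sum>i\<in>UNIV. w $ j * (x $ i * H j $ i))"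
    proof (intro sum.cong refl)
      fix i j show "x $ i * (w $ j * H i $ j) = w $ j * (x $ i * H j $ i)" using H[of i j] by simp
    qed
    also have "\<dots> = (\<Sum>i\<in>UNIV. w $ i * (x \<bullet> H i))" by (simp add: inner_vec_def sum_distrib_left)
    finally show ?thesis .
  qed
  have e: "flux_deriv a D Gam y p H v h l k dh dl dk i =
      2 * (m \<bullet> p) * (dh $ i * ap $ i) + 2 * h * (ap $ i * (m' i \<bullet> p)) + 2 * h * (ap $ i * (m \<bullet> H i))
      + v * (dl $ i * ap $ i) + l * (ap $ i * p $ i)
      + (2 * h * (m \<bullet> p) + l * v) * ((D i *v p) $ i + (a *v H i) $ i)
      - (ap \<bullet> p) * (dh $ i * m $ i) - h * (ap \<bullet> p) * (m' i $ i) - h * (m $ i * ((D i *v p) \<bullet> p)) - 2 * h * (m $ i * (ap \<bullet> H i))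
      + v\<^sup>2 * (dk $ i * m $ i) + k * v\<^sup>2 * (m' i $ i) + 2 * k * v * (m $ i * p $ i)" for i
  proof -
    have "(a *v H i) \<bullet> p = ap \<bullet> H i" using sym[of "H i" p] by (simp add: ap_def inner_commute)
    then have q: "(D i *v p + a *v H i) \<bullet> p + ap \<bullet> H i = (D i *v p) \<bullet> p + 2 * (ap \<bullet> H i)" by (simp add: inner_add_left)
    have mi: "D i *v y + a *v (Gam *v axis i 1) = m' i" by (simp add: m'_def)
    show ?thesis
      unfolding flux_deriv_def Let_def mi m_def[symmetric] ap_def[symmetric] q by (simp add: algebra_simps)
  qed
  have in1: "(\<Sum>i\<in>UNIV. x $ i * w $ i) = x \<bullet> w" for x w :: "real ^ 'n" by (simp add: inner_vec_def)
  show ?thesis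
    unfolding e sum.distrib sum_subtractf sum_distrib_left[symmetric] in1 swap[of ap m]
    by (simp add: sum.distrib algebra_simps inner_commute)
qed

text \<open>
  The conjugated operator \<open>w\<^sup>-\<^sup>\<tau> \<Delta>\<^sub>g w\<^sup>\<tau> v\<close> in terms of \<open>p = \<nabla>v\<close> and \<open>H = \<nabla>\<^sup>2v\<close>. The number
  \<open>b = \<beta> + 2\<close> arises from \<open>\<nabla>\<kappa> = -(\<beta> + 2) (\<kappa>/s) y\<close>.
\<close>

definition conj_lap where
  "conj_lap a D Gam y p H v \<kappa> b s =
    (\<Sum>i\<in>UNIV. (D i *v p) $ i + (a *v H i) $ i) + 2 * \<kappa> * ((a *v y) \<bullet> p) + \<kappa>\<^sup>2 * ((a *v y) \<bullet> y) * v
      + \<kappa> * ((\<Sum>i\<in>UNIV. (D i *v y + a *v (Gam *v axis i 1)) $ i) - b * ((a *v y) \<bullet> y) / s) * v"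

context frames
begin

text \<open>
  The same coefficients in the original, unscaled variables, with \<open>\<rho> = \<sigma>\<^sup>\<beta>\<close> as a free parameter:
  \<open>yv = \<Gamma>x\<close>, \<open>sv = \<sigma>\<^sup>2\<close>, and so on. The vectors \<open>dhv\<close>, \<open>dlv\<close>, \<open>dQv\<close> and \<open>dkv\<close> are the
  gradients of \<open>hv\<close>, \<open>lv\<close>, \<open>Qv\<close> and \<open>kv\<close>.
\<close>

definition "yv z = r z *\<^sub>R Y z"
definition "mv z = a z *v yv z"
definition "sv z = (r z)\<^sup>2"
definition "qv z = (G z *v yv z) \<bullet> yv z"
definition "Qv z = mv z \<bullet> yv z"
definition "hv z \<rho> = \<rho> * sv z / qv z"
definition "lv z \<rho> = hv z \<rho> * T z - (2 + \<omega>) * \<rho>"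
definition "kv z \<rho> \<tau> = \<tau>\<^sup>2 * \<beta>\<^sup>2 * (Qv z / (\<rho> * sv z * qv z))"
definition "dhv z \<rho> = ((\<beta> + 2) * \<rho> / qv z) *\<^sub>R yv z - (2 * \<rho> * sv z / (qv z)\<^sup>2) *\<^sub>R (Gam z *v (G z *v yv z))"
definition "dlv z \<rho> = T z *\<^sub>R dhv z \<rho> - ((2 + \<omega>) * \<beta> * \<rho> / sv z) *\<^sub>R yv z"
definition "dQv z = (\<chi> i. (D z i *v yv z) \<bullet> yv z) + 2 *\<^sub>R (Gam z *v mv z)"
definition "dkv z \<rho> \<tau> = (\<tau>\<^sup>2 * \<beta>\<^sup>2) *\<^sub>R ((1 / (\<rho> * sv z * qv z)) *\<^sub>R dQv z - ((\<beta> + 2) * Qv z / (\<rho> * (sv z)\<^sup>2 * qv z)) *\<^sub>R yv z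
    - (2 * Qv z / (\<rho> * sv z * (qv z)\<^sup>2)) *\<^sub>R (Gam z *v (G z *v yv z)))"
definition "\<kappa>v z \<rho> \<tau> = \<tau> * \<beta> / (\<rho> * sv z)"
definition "Nv z \<rho> p v = 2 * hv z \<rho> * (mv z \<bullet> p) + lv z \<rho> * v"
definition "divF z \<rho> \<tau> p v H = (\<Sum>i\<in>UNIV. flux_deriv (a z) (D z) (Gam z) (yv z) p H v (hv z \<rho>) (lv z \<rho>) (kv z \<rho> \<tau>) (dhv z \<rho>) (dlv z \<rho>) (dkv z \<rho> \<tau>) i)"
definition "Av z \<rho> \<tau> p v H = conj_lap (a z) (D z) (Gam z) (yv z) p H v (\<kappa>v z \<rho> \<tau>) (\<beta> + 2) (sv z)"

lemma scaled:
  assumes z: "z \<in> S" and \<rho>: "\<rho> > 0"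
  shows "mv z = r z *\<^sub>R M z" "qv z = (r z)\<^sup>2 * q z" "Qv z = (r z)\<^sup>2 * Q z" "hv z \<rho> = \<rho> / q z" "lv z \<rho> = \<rho> * l0 z"
    "dhv z \<rho> = (\<rho> / r z) *\<^sub>R h1 z" "dlv z \<rho> = (\<rho> / r z) *\<^sub>R l1 z"
    "kv z \<rho> \<tau> = \<rho> * (\<tau> / \<rho>)\<^sup>2 * \<beta>\<^sup>2 * Q z / ((r z)\<^sup>2 * q z)"
    "dkv z \<rho> \<tau> = (\<rho> * (\<tau> / \<rho>)\<^sup>2 * \<beta>\<^sup>2 / (r z) ^ 3) *\<^sub>R k1 z" "\<kappa>v z \<rho> \<tau> = (\<tau> / \<rho>) * \<beta> / (r z)\<^sup>2"
    "(\<Sum>i\<in>UNIV. (D z i *v yv z + a z *v (Gam z *v axis i 1)) $ i) = r z * d1 z + Ta z"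
proof -
  have r0: "r z \<noteq> 0" using r(1)[OF z] by simp
  have q0: "q z \<noteq> 0" using q_lower[OF z] by simp
  show mv: "mv z = r z *\<^sub>R M z" by (simp add: mv_def yv_def M_def matrix_vector_mult_scaleR)
  have GY': "G z *v yv z = r z *\<^sub>R GY z" by (simp add: yv_def GY_def matrix_vector_mult_scaleR)
  show qv: "qv z = (r z)\<^sup>2 * q z" by (simp add: qv_def GY') (simp add: yv_def GY_def q_def power2_eq_square)
  show Qv: "Qv z = (r z)\<^sup>2 * Q z" by (simp add: Qv_def mv yv_def Q_def power2_eq_square)
  show hv: "hv z \<rho> = \<rho> / q z" using r0 by (simp add: hv_def sv_def qv)
  show lv: "lv z \<rho> = \<rho> * l0 z" by (simp add: lv_def hv l0_def algebra_simps)
  show dhv: "dhv z \<rho> = (\<rho> / r z) *\<^sub>R h1 z"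
    using r0 q0 unfolding dhv_def GY' unfolding qv sv_def h1_def yv_def
    by (simp add: matrix_vector_mult_scaleR vec_eq_iff) (simp add: field_simps power2_eq_square)
  show dlv: "dlv z \<rho> = (\<rho> / r z) *\<^sub>R l1 z"
    using r0 unfolding dlv_def dhv l1_def yv_def sv_def
    by (simp add: vec_eq_iff) (simp add: field_simps power2_eq_square)
  show "kv z \<rho> \<tau> = \<rho> * (\<tau> / \<rho>)\<^sup>2 * \<beta>\<^sup>2 * Q z / ((r z)\<^sup>2 * q z)"
    using r0 q0 \<rho> unfolding kv_def Qv sv_def qv by (simp add: field_simps power2_eq_square)
  have dQ: "dQv z = r z *\<^sub>R (2 *\<^sub>R (Gam z *v M z) + r z *\<^sub>R D2 z)"
    by (simp add: dQv_def mv yv_def D2_def vec_eq_iff matrix_vector_mult_scaleR algebra_simps)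
  show "dkv z \<rho> \<tau> = (\<rho> * (\<tau> / \<rho>)\<^sup>2 * \<beta>\<^sup>2 / (r z) ^ 3) *\<^sub>R k1 z"
    using r0 q0 \<rho> unfolding dkv_def dQ Qv sv_def qv GY' unfolding yv_def k1_def matrix_vector_mult_scaleR
    by (simp add: vec_eq_iff) (simp add: field_simps power2_eq_square power3_eq_cube power4_eq_xxxx)
  show "\<kappa>v z \<rho> \<tau> = (\<tau> / \<rho>) * \<beta> / (r z)\<^sup>2" by (simp add: \<kappa>v_def sv_def)
  show "(\<Sum>i\<in>UNIV. (D z i *v yv z + a z *v (Gam z *v axis i 1)) $ i) = r z * d1 z + Ta z"
    by (simp add: yv_def d1_def Ta_def sum.distrib matrix_vector_mult_scaleR sum_distrib_left)
qed

text \<open>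
  All quantities are monomials in \<open>r\<close>, \<open>\<rho>\<close> and \<open>t = \<tau>/\<rho>\<close> times their scaled versions. In the difference
  \<open>A N - div X\<close> the terms with second derivatives cancel, and so do the terms in
  \<open>\<kappa>\<^sup>2 (gy,\<nabla>v) v\<close>, which is what the coefficient \<open>k = \<kappa>\<^sup>2 Q h\<close> of the flux is made for.
\<close>

theorem divergence_identity:
  assumes z: "z \<in> S" and \<rho>: "\<rho> > 0" and H: "\<And>i j. H i $ j = H j $ i"
  shows "Av z \<rho> \<tau> p v H * Nv z \<rho> p v = divF z \<rho> \<tau> p v H + \<rho> * Rh z (\<tau> / \<rho>) p (v / r z)"
proof -
  note sc = scaled[OF z \<rho>]
  have r0: "r z \<noteq> 0" using r(1)[OF z] by simp
  have q0: "q z \<noteq> 0" using q_lower[OF z] by simp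
  define t where "t = \<tau> / \<rho>"
  define \<nu> where "\<nu> = v / r z"
  have v: "v = r z * \<nu>" using r0 by (simp add: \<nu>_def)
  define L where "L = (\<Sum>i\<in>UNIV. (D z i *v p) $ i + (a z *v H i) $ i)"
  define W where "W = (\<Sum>i\<in>UNIV. (a z *v p) $ i * ((D z i *v Y z) \<bullet> p))"
  define Z where "Z = (\<Sum>k\<in>UNIV. M z $ k * ((D z k *v p) \<bullet> p))"
  define \<mu> where "\<mu> = M z \<bullet> p"
  define ap where "ap = a z *v p"
  define e where "e = r z * d1 z + Ta z"
  have s1: "(\<Sum>i\<in>UNIV. ap $ i * ((D z i *v yv z + a z *v (Gam z *v axis i 1)) \<bullet> p)) = r z * W + (Gam z *v ap) \<bullet> ap"
  proof -
    have "(a z *v (Gam z *v axis i 1)) \<bullet> p = (Gam z *v ap) $ i" for i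
      using sym(1)[OF z, of "Gam z *v axis i 1" p] sym(3)[OF z, of "axis i 1" ap] by (simp add: ap_def inner_axis')
    then show ?thesis unfolding W_def ap_def[symmetric] inner_vec_def[of "Gam z *v ap"]
      by (simp add: yv_def inner_add_left matrix_vector_mult_scaleR sum.distrib sum_distrib_left algebra_simps)
  qed
  have s2: "(\<Sum>i\<in>UNIV. mv z $ i * ((D z i *v p) \<bullet> p)) = r z * Z"
    unfolding Z_def sc(1) by (simp add: sum_distrib_left mult.assoc)
  have F: "divF z \<rho> \<tau> p v H = (2 * (\<rho> / q z) * (r z * \<mu>) + \<rho> * l0 z * v) * L
     + 2 * ((\<rho> / r z) * (h1 z \<bullet> ap)) * (r z * \<mu>) + 2 * (\<rho> / q z) * (r z * W + (Gam z *v ap) \<bullet> ap)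
     + v * ((\<rho> / r z) * (l1 z \<bullet> ap)) + \<rho> * l0 z * (ap \<bullet> p)
     - ((\<rho> / r z) * (r z * (h1 z \<bullet> M z)) + \<rho> / q z * e) * (ap \<bullet> p) - \<rho> / q z * (r z * Z)
     + ((\<rho> * t\<^sup>2 * \<beta>\<^sup>2 / (r z) ^ 3) * (r z * (k1 z \<bullet> M z)) + \<rho> * t\<^sup>2 * \<beta>\<^sup>2 * Q z / ((r z)\<^sup>2 * q z) * e) * v\<^sup>2
     + 2 * (\<rho> * t\<^sup>2 * \<beta>\<^sup>2 * Q z / ((r z)\<^sup>2 * q z)) * v * (r z * \<mu>)"
    unfolding divF_def sum_flux_deriv[OF sym(1)[OF z] H] mv_def[symmetric] ap_def[symmetric] s1 s2
    unfolding sc L_def[symmetric] by (simp add: \<mu>_def t_def e_def mult_ac)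
  have A: "Av z \<rho> \<tau> p v H = L + 2 * (t * \<beta> / (r z)\<^sup>2) * (r z * \<mu>) + (t * \<beta> / (r z)\<^sup>2)\<^sup>2 * ((r z)\<^sup>2 * Q z) * v
     + (t * \<beta> / (r z)\<^sup>2) * (e - (\<beta> + 2) * ((r z)\<^sup>2 * Q z) / (r z)\<^sup>2) * v"
    unfolding Av_def conj_lap_def mv_def[symmetric] Qv_def[symmetric]
    unfolding sc L_def[symmetric]
    by (simp add: \<mu>_def t_def e_def sv_def)
  have N: "Nv z \<rho> p v = 2 * (\<rho> / q z) * (r z * \<mu>) + \<rho> * l0 z * v"
    unfolding Nv_def sc by (simp add: \<mu>_def)
  have R: "Rh z t p \<nu> = (h1 z \<bullet> M z + e / q z - l0 z) * (ap \<bullet> p) - 2 / q z * (r z * W + (Gam z *v ap) \<bullet> ap)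
     - 2 * (h1 z \<bullet> ap) * \<mu> - \<nu> * (l1 z \<bullet> ap) + r z / q z * Z + t\<^sup>2 * \<beta>\<^sup>2 * \<nu>\<^sup>2 * (Q z * l0 z - k1 z \<bullet> M z - Q z / q z * e)
     + 4 * t * \<beta> * \<mu>\<^sup>2 / q z + 2 * t * \<beta> * l0 z * \<mu> * \<nu> + t * \<beta> * (e - (\<beta> + 2) * Q z) * \<nu> * (2 * \<mu> / q z + l0 z * \<nu>)"
    unfolding Rh_def grad_form_def V_def e1_def W_def Z_def \<mu>_def ap_def e_def by (simp add: algebra_simps)
  show ?thesis
    unfolding F A N t_def[symmetric] \<nu>_def[symmetric] R unfolding v
    using r0 q0 by (simp add: field_simps power2_eq_square power3_eq_cube)
qed

text \<open>
  By Young's inequality \<open>A N\<close> is at most a multiple of \<open>\<rho>\<^sup>2 \<sigma>\<^sup>2 A\<^sup>2/\<tau>\<close> plus a small multiple of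
  \<open>\<tau> (N/(\<rho>\<sigma>))\<^sup>2\<close>, and the latter is absorbed by the terms \<open>\<tau>\<mu>\<^sup>2\<close> and \<open>\<tau>t\<nu>\<^sup>2\<close> of the coercivity estimate.
  The gradient of \<open>u\<close> is recovered from \<open>w\<^sup>-\<^sup>\<tau> \<nabla>u = \<nabla>v + \<kappa> v y\<close>, where \<open>\<kappa> v y = t\<beta>\<nu> Y\<close> is controlled by
  \<open>t\<^sup>2\<nu>\<^sup>2\<close>. The condition \<open>\<rho> \<le> 1\<close> ensures \<open>t \<ge> \<tau>\<close>.
\<close>

theorem pointwise_carleman:
  "\<exists>C\<ge>1. \<exists>C'. \<exists>r0>0. \<exists>\<tau>1\<ge>1. \<forall>z\<in>S. r z \<le> r0 \<longrightarrow> (\<forall>\<rho> \<tau> p v H. 0 < \<rho> \<longrightarrow> \<rho> \<le> 1 \<longrightarrow> \<tau>1 \<le> \<tau> \<longrightarrow>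
     (\<forall>i j. H i $ j = H j $ i) \<longrightarrow>
     \<tau> * \<rho> * ((a z *v (p + (\<kappa>v z \<rho> \<tau> * v) *\<^sub>R yv z)) \<bullet> (p + (\<kappa>v z \<rho> \<tau> * v) *\<^sub>R yv z)) + \<tau> ^ 3 * v\<^sup>2 / (\<rho> * sv z)
     \<le> C * (\<rho>\<^sup>2 * sv z * (Av z \<rho> \<tau> p v H)\<^sup>2) - C' * \<tau> * divF z \<rho> \<tau> p v H)"
proof -
  obtain c r0 t0 where c: "c > 0" "r0 > 0" "t0 \<ge> 1" and coer: "\<And>z t p \<nu>. z \<in> S \<Longrightarrow> r z \<le> r0 \<Longrightarrow> t \<ge> t0 \<Longrightarrow>
     c * ((norm p)\<^sup>2 + t * (M z \<bullet> p)\<^sup>2 + t\<^sup>2 * \<nu>\<^sup>2) \<le> Rh z t p \<nu>"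
    using Rh_coercive by blast
  obtain B where B: "B \<ge> 0" "\<And>z p \<nu>. z \<in> S \<Longrightarrow> (2 * (M z \<bullet> p) / q z + l0 z * \<nu>)\<^sup>2 \<le> B * ((M z \<bullet> p)\<^sup>2 + \<nu>\<^sup>2)"
    using multiplier_bound by blast
  \<comment> \<open>The weight in Young's inequality, so small that half of the gain suffices.\<close>
  define \<delta> where "\<delta> = c / (B + 1)"
  have \<delta>: "\<delta> > 0" "\<delta> * B \<le> c" using c B by (simp_all add: \<delta>_def field_simps)
  define K2 where "K2 = 2 * K + 2 * K * \<beta>\<^sup>2 * K\<^sup>2 + 1"
  have K2: "K2 > 0" "2 * K \<le> K2" "2 * K * \<beta>\<^sup>2 * K\<^sup>2 + 1 \<le> K2" using K by (auto simp: K2_def add_nonneg_pos)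
  define C where "C = max 1 (K2 / (\<delta> * c))"
  define C' where "C' = 2 * K2 / c"
  have C1: "C \<ge> 1" "K2 / (\<delta> * c) \<le> C" by (auto simp: C_def)
  have main: "\<tau> * \<rho> * ((a z *v (p + (\<kappa>v z \<rho> \<tau> * v) *\<^sub>R yv z)) \<bullet> (p + (\<kappa>v z \<rho> \<tau> * v) *\<^sub>R yv z)) + \<tau> ^ 3 * v\<^sup>2 / (\<rho> * sv z)
     \<le> C * (\<rho>\<^sup>2 * sv z * (Av z \<rho> \<tau> p v H)\<^sup>2) - C' * \<tau> * divF z \<rho> \<tau> p v H"
    if z: "z \<in> S" and rz: "r z \<le> r0" and \<rho>: "0 < \<rho>" "\<rho> \<le> 1" and \<tau>: "t0 \<le> \<tau>" and H: "\<forall>i j. H i $ j = H j $ i"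
    for z \<rho> \<tau> p v H
  proof -
    define t where "t = \<tau> / \<rho>"
    define \<nu> where "\<nu> = v / r z"
    define \<mu> where "\<mu> = M z \<bullet> p"
    define A where "A = Av z \<rho> \<tau> p v H"
    define F where "F = divF z \<rho> \<tau> p v H"
    define nh where "nh = 2 * \<mu> / q z + l0 z * \<nu>"
    have r0: "r z > 0" using r(1)[OF z] by simp
    have q0: "q z > 0" using q_lower[OF z] by simp
    have \<tau>0: "\<tau> \<ge> 1" using \<tau> c by linarith
    have tt: "t \<ge> t0" "t \<ge> 1" "\<tau> = t * \<rho>"
    proof -
      have "\<tau> * \<rho> \<le> \<tau> * 1" using \<rho> \<tau>0 by (intro mult_left_mono) auto
      then have "t \<ge> \<tau>" using \<rho> by (simp add: t_def field_simps)
      then show "t \<ge> t0" "t \<ge> 1" using \<tau> \<tau>0 by auto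
      show "\<tau> = t * \<rho>" using \<rho> by (simp add: t_def)
    qed
    note sc = scaled[OF z \<rho>(1)]
    have v: "v = r z * \<nu>" using r0 by (simp add: \<nu>_def)
    have N: "Nv z \<rho> p v = \<rho> * r z * nh"
      unfolding Nv_def sc nh_def \<mu>_def v using q0 by (simp add: algebra_simps)
    have id: "A * (\<rho> * r z * nh) = F + \<rho> * Rh z t p \<nu>"
      using divergence_identity[OF z \<rho>(1), of H \<tau> p v] H unfolding N A_def F_def t_def \<nu>_def by blast
    have "c * ((norm p)\<^sup>2 + t * \<mu>\<^sup>2 + t\<^sup>2 * \<nu>\<^sup>2) \<le> Rh z t p \<nu>" unfolding \<mu>_def by (rule coer[OF z rz tt(1)])
    then have 1: "\<rho> * (c * ((norm p)\<^sup>2 + t * \<mu>\<^sup>2 + t\<^sup>2 * \<nu>\<^sup>2)) \<le> A * (\<rho> * r z * nh) - F"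
      using id \<rho> by (simp add: mult_left_mono)
    have 2: "A * (\<rho> * r z * nh) \<le> \<rho>\<^sup>2 * (r z)\<^sup>2 * A\<^sup>2 / (2 * (\<delta> * \<tau>)) + \<delta> * \<tau> / 2 * nh\<^sup>2"
    proof -
      have young: "x * y \<le> x\<^sup>2 / (2 * d) + d / 2 * y\<^sup>2" if "d > 0" for x y d :: real
      proof -
        have "0 \<le> (x - d * y)\<^sup>2 / (2 * d)" using that by simp
        also have "\<dots> = x\<^sup>2 / (2 * d) + d / 2 * y\<^sup>2 - x * y"
          using that by (simp add: power2_eq_square field_simps)
        finally show ?thesis by simp
      qed
      have dt: "\<delta> * \<tau> > 0" using \<delta> \<tau>0 by simp
      have "A * (\<rho> * r z * nh) = (\<rho> * r z * A) * nh" by (simp only: mult_ac)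
      also have "\<dots> \<le> (\<rho> * r z * A)\<^sup>2 / (2 * (\<delta> * \<tau>)) + \<delta> * \<tau> / 2 * nh\<^sup>2" by (rule young[OF dt])
      finally show ?thesis by (simp only: power_mult_distrib)
    qed
    have 3: "\<delta> * \<tau> / 2 * nh\<^sup>2 \<le> c / 2 * (\<tau> * (\<mu>\<^sup>2 + t * \<nu>\<^sup>2))"
    proof -
      have "\<delta> * \<tau> / 2 * nh\<^sup>2 \<le> \<delta> * \<tau> / 2 * (B * (\<mu>\<^sup>2 + \<nu>\<^sup>2))"
        unfolding nh_def \<mu>_def using \<delta> \<tau>0 by (intro mult_left_mono B z) auto
      also have "\<dots> = (\<delta> * B) * (\<tau> / 2 * (\<mu>\<^sup>2 + \<nu>\<^sup>2))" by (simp add: mult_ac)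
      also have "\<dots> \<le> c * (\<tau> / 2 * (\<mu>\<^sup>2 + \<nu>\<^sup>2))" using \<delta> \<tau>0 by (intro mult_right_mono) auto
      also have "\<dots> \<le> c * (\<tau> / 2 * (\<mu>\<^sup>2 + t * \<nu>\<^sup>2))"
      proof -
        have "1 * \<nu>\<^sup>2 \<le> t * \<nu>\<^sup>2" using tt by (intro mult_right_mono) auto
        then show ?thesis using c \<tau>0 by (intro mult_left_mono) auto
      qed
      finally show ?thesis by (simp add: mult_ac)
    qed
    have 4: "\<rho> * (c * ((norm p)\<^sup>2 + t * \<mu>\<^sup>2 + t\<^sup>2 * \<nu>\<^sup>2)) = \<rho> * c * (norm p)\<^sup>2 + c * (\<tau> * (\<mu>\<^sup>2 + t * \<nu>\<^sup>2))"
      unfolding tt(3) by (simp add: power2_eq_square algebra_simps)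
    have 6: "c / 2 * (\<rho> * ((norm p)\<^sup>2 + t\<^sup>2 * \<nu>\<^sup>2)) \<le> \<rho>\<^sup>2 * (r z)\<^sup>2 * A\<^sup>2 / (2 * (\<delta> * \<tau>)) - F"
    proof -
      have e: "c * (\<tau> * (\<mu>\<^sup>2 + t * \<nu>\<^sup>2)) = c / 2 * (\<tau> * (\<mu>\<^sup>2 + t * \<nu>\<^sup>2)) + (c / 2 * (\<tau> * \<mu>\<^sup>2) + c / 2 * (\<rho> * (t\<^sup>2 * \<nu>\<^sup>2)))"
        unfolding tt(3) by (simp add: power2_eq_square algebra_simps)
      have nn: "c / 2 * (\<tau> * \<mu>\<^sup>2) \<ge> 0" "c / 2 * (\<rho> * (norm p)\<^sup>2) \<ge> 0" using c \<tau>0 \<rho> by auto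
      have e2: "\<rho> * c * (norm p)\<^sup>2 = c / 2 * (\<rho> * (norm p)\<^sup>2) + c / 2 * (\<rho> * (norm p)\<^sup>2)" by (simp add: algebra_simps)
      have e3: "c / 2 * (\<rho> * ((norm p)\<^sup>2 + t\<^sup>2 * \<nu>\<^sup>2)) = c / 2 * (\<rho> * (norm p)\<^sup>2) + c / 2 * (\<rho> * (t\<^sup>2 * \<nu>\<^sup>2))"
        by (simp add: algebra_simps)
      have gen: "x = y1 + y1 + (y2 + (y3 + y4)) \<Longrightarrow> x \<le> An - F \<Longrightarrow> An \<le> A2 + nn \<Longrightarrow> nn \<le> y2 \<Longrightarrow> 0 \<le> y3 \<Longrightarrow> 0 \<le> y1 \<Longrightarrow> y1 + y4 \<le> A2 - F"
        for x y1 y2 y3 y4 An F A2 nn :: real by linarith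
      show ?thesis unfolding e3
        by (rule gen[OF _ 1 2 3 nn]) (simp only: 4 e e2)
    qed
    define w where "w = p + (\<kappa>v z \<rho> \<tau> * v) *\<^sub>R yv z"
    have w: "w = p + (t * \<beta> * \<nu>) *\<^sub>R Y z"
      using r0 unfolding w_def sc v t_def[symmetric] by (simp add: yv_def power2_eq_square)
    have aw: "(a z *v w) \<bullet> w \<le> 2 * K * (norm p)\<^sup>2 + 2 * K * \<beta>\<^sup>2 * K\<^sup>2 * (t\<^sup>2 * \<nu>\<^sup>2)"
    proof -
      have "(a z *v w) \<bullet> w \<le> norm (a z *v w) * norm w" by (rule norm_cauchy_schwarz)
      also have "\<dots> \<le> (K * norm w) * norm w" by (intro mult_right_mono nb z) auto
      also have "\<dots> = K * (norm w)\<^sup>2" by (simp add: power2_eq_square mult.assoc)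
      also have "\<dots> \<le> K * (2 * (norm p)\<^sup>2 + 2 * (norm ((t * \<beta> * \<nu>) *\<^sub>R Y z))\<^sup>2)"
      proof (rule mult_left_mono)
        have "norm w \<le> norm p + norm ((t * \<beta> * \<nu>) *\<^sub>R Y z)" unfolding w by (rule norm_triangle_ineq)
        then have "(norm w)\<^sup>2 \<le> (norm p + norm ((t * \<beta> * \<nu>) *\<^sub>R Y z))\<^sup>2" by (rule power_mono) simp
        also have "\<dots> \<le> 2 * (norm p)\<^sup>2 + 2 * (norm ((t * \<beta> * \<nu>) *\<^sub>R Y z))\<^sup>2"
        proof -
          have "(x + y)\<^sup>2 \<le> 2 * x\<^sup>2 + 2 * y\<^sup>2" for x y :: real
            using zero_le_power2[of "x - y"] by (simp add: power2_eq_square algebra_simps)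
          then show ?thesis .
        qed
        finally show "(norm w)\<^sup>2 \<le> 2 * (norm p)\<^sup>2 + 2 * (norm ((t * \<beta> * \<nu>) *\<^sub>R Y z))\<^sup>2" .
      qed (use K in simp)
      also have "(norm ((t * \<beta> * \<nu>) *\<^sub>R Y z))\<^sup>2 = (\<beta>\<^sup>2 * (t\<^sup>2 * \<nu>\<^sup>2)) * (norm (Y z))\<^sup>2"
        by (simp add: power_mult_distrib mult_ac)
      also have "K * (2 * (norm p)\<^sup>2 + 2 * ((\<beta>\<^sup>2 * (t\<^sup>2 * \<nu>\<^sup>2)) * (norm (Y z))\<^sup>2))
          \<le> K * (2 * (norm p)\<^sup>2 + 2 * ((\<beta>\<^sup>2 * (t\<^sup>2 * \<nu>\<^sup>2)) * K\<^sup>2))"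
        using Yb(1)[OF z] K by (intro mult_left_mono add_left_mono power_mono) auto
      finally show ?thesis by (simp add: algebra_simps)
    qed
    have sv: "sv z = (r z)\<^sup>2" by (simp add: sv_def)
    have t3: "\<tau> ^ 3 * v\<^sup>2 / (\<rho> * sv z) = \<tau> * \<rho> * (t\<^sup>2 * \<nu>\<^sup>2)"
      unfolding sv v using r0 \<rho> by (simp add: tt(3) power2_eq_square power3_eq_cube)
    have "\<tau> * \<rho> * ((a z *v w) \<bullet> w) + \<tau> ^ 3 * v\<^sup>2 / (\<rho> * sv z) = \<tau> * \<rho> * ((a z *v w) \<bullet> w + t\<^sup>2 * \<nu>\<^sup>2)"
      unfolding t3 by (simp add: algebra_simps)
    also have "\<dots> \<le> \<tau> * \<rho> * (K2 * ((norm p)\<^sup>2 + t\<^sup>2 * \<nu>\<^sup>2))"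
    proof (rule mult_left_mono)
      have "2 * K * (norm p)\<^sup>2 \<le> K2 * (norm p)\<^sup>2" using K2 by (intro mult_right_mono) auto
      moreover have "(2 * K * \<beta>\<^sup>2 * K\<^sup>2 + 1) * (t\<^sup>2 * \<nu>\<^sup>2) \<le> K2 * (t\<^sup>2 * \<nu>\<^sup>2)" using K2 by (intro mult_right_mono) auto
      ultimately show "(a z *v w) \<bullet> w + t\<^sup>2 * \<nu>\<^sup>2 \<le> K2 * ((norm p)\<^sup>2 + t\<^sup>2 * \<nu>\<^sup>2)"
        using aw by (simp add: algebra_simps)
    qed (use \<tau>0 \<rho> in auto)
    also have "\<dots> = (2 * \<tau> * K2 / c) * (c / 2 * (\<rho> * ((norm p)\<^sup>2 + t\<^sup>2 * \<nu>\<^sup>2)))" using c by simp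
    also have "\<dots> \<le> (2 * \<tau> * K2 / c) * (\<rho>\<^sup>2 * (r z)\<^sup>2 * A\<^sup>2 / (2 * (\<delta> * \<tau>)) - F)"
      by (rule mult_left_mono[OF 6]) (use \<tau>0 K2 c in auto)
    also have "\<dots> = K2 / (\<delta> * c) * (\<rho>\<^sup>2 * sv z * A\<^sup>2) - C' * \<tau> * F"
      using \<tau>0 \<delta> c unfolding sv C'_def by (simp add: field_simps)
    also have "\<dots> \<le> C * (\<rho>\<^sup>2 * sv z * A\<^sup>2) - C' * \<tau> * F"
    proof -
      have "0 \<le> \<rho>\<^sup>2 * sv z * A\<^sup>2" by (simp add: sv)
      then have "K2 / (\<delta> * c) * (\<rho>\<^sup>2 * sv z * A\<^sup>2) \<le> C * (\<rho>\<^sup>2 * sv z * A\<^sup>2)" by (rule mult_right_mono[OF C1(2)])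
      then show ?thesis by simp
    qed
    finally show ?thesis unfolding w_def A_def F_def .
  qed
  show ?thesis
    by (rule exI[of _ C], rule conjI[OF C1(1)], rule exI[of _ C'], rule exI[of _ r0], rule conjI[OF c(2)],
        rule exI[of _ t0], rule conjI[OF c(3)]) (use main in blast)
qed

end

section \<open>The conjugated function and its flux\<close>

lemma has_pd_eq: "has_pd i f D x \<Longrightarrow> D = D' \<Longrightarrow> has_pd i f D' x"
  by simp

lemma has_pd_matrix_vector:
  fixes A :: "real ^ 'n \<Rightarrow> real ^ 'n ^ 'n" and f :: "real ^ 'n \<Rightarrow> real ^ 'n"
  assumes "\<And>k l. has_pd i (\<lambda>y. A y $ k $ l) (DA $ k $ l) x" "\<And>l. has_pd i (\<lambda>y. f y $ l) (F $ l) x"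
  shows "has_pd i (\<lambda>y. (A y *v f y) $ k) ((DA *v f x + A x *v F) $ k) x"
proof -
  have "has_pd i (\<lambda>y. \<Sum>l\<in>UNIV. A y $ k $ l * f y $ l) (\<Sum>l\<in>UNIV. DA $ k $ l * f x $ l + A x $ k $ l * F $ l) x"
    by (intro has_pd_sum has_pd_mult assms)
  then show ?thesis by (simp add: matrix_vector_mult_def sum.distrib)
qed

locale carleman_fn = gram_pair "g 0" \<Gamma> K for g :: "real ^ 'n \<Rightarrow> real ^ 'n ^ 'n" and \<Gamma> K +
  fixes u :: "real ^ 'n \<Rightarrow> real" and \<beta> \<omega> \<tau> :: real
  assumes smooth_u: "smooth u" and \<beta>: "\<beta> > 0" and symg: "transpose (g x) = g x"
begin

text \<open>
  In the notation of the beginning, \<open>E = w\<^sup>-\<^sup>\<tau>\<close>, \<open>vv = v\<close>, \<open>gu = \<nabla>u\<close>, \<open>pp = \<nabla>v\<close>, \<open>mm = gy\<close>, \<open>kap = \<kappa>\<close>; \<open>hh\<close> and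
  \<open>ll\<close> are the coefficients of the multiplier and \<open>kk = \<kappa>\<^sup>2 Q h\<close>. The powers of \<open>\<sigma>\<close> are written as
  powers of the quadratic form \<open>s\<close>, which is smooth.
\<close>

definition "rho y = s y powr (\<beta> / 2)"
definition "E y = exp (\<tau> / rho y)"
definition "kap y = \<tau> * \<beta> / (rho y * s y)"
definition "vv y = E y * u y"
definition "gu y = (\<chi> j. pd j u y)"
definition "pp y = E y *\<^sub>R (gu y - (kap y * u y) *\<^sub>R (\<Gamma> *v y))"
definition "mm y = g y *v (\<Gamma> *v y)"
definition "QQ y = mm y \<bullet> (\<Gamma> *v y)"
definition "hh y = rho y * s y / q y"
definition "ll y = hh y * T - (2 + \<omega>) * rho y"
definition "kk y = \<tau>\<^sup>2 * \<beta>\<^sup>2 * (QQ y / (rho y * s y * q y))"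
definition "flux i y = (2 * (hh y * (mm y \<bullet> pp y)) + ll y * vv y) * (g y *v pp y) $ i
   - hh y * mm y $ i * ((g y *v pp y) \<bullet> pp y) + kk y * mm y $ i * (vv y)\<^sup>2"

text \<open>
  Rows of the Hessians of \<open>u\<close> and of \<open>v\<close>, and the gradients of the coefficients of the flux. The
  derivatives of \<open>g\<close> enter as a parameter \<open>D\<close>, because they need not exist at every point.
\<close>

definition "U y i = (\<chi> j. pd i (pd j u) y)"
definition "HH y i = E y *\<^sub>R (U y i - (kap y * pd i u y) *\<^sub>R (\<Gamma> *v y) - (kap y * u y) *\<^sub>R (\<Gamma> *v axis i 1)
     + (kap y * (\<beta> + 2) / s y * (\<Gamma> *v y) $ i * u y) *\<^sub>R (\<Gamma> *v y))
   - (kap y * (\<Gamma> *v y) $ i) *\<^sub>R pp y"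
definition "dhh y = ((\<beta> + 2) * rho y / q y) *\<^sub>R (\<Gamma> *v y) - (2 * rho y * s y / (q y)\<^sup>2) *\<^sub>R (\<Gamma> *v (g 0 *v (\<Gamma> *v y)))"
definition "dll y = T *\<^sub>R dhh y - ((2 + \<omega>) * \<beta> * rho y / s y) *\<^sub>R (\<Gamma> *v y)"
definition "dQQ D y = (\<chi> i. (D i *v (\<Gamma> *v y)) \<bullet> (\<Gamma> *v y)) + 2 *\<^sub>R (\<Gamma> *v mm y)"
definition "dkk D y = (\<tau>\<^sup>2 * \<beta>\<^sup>2) *\<^sub>R ((1 / (rho y * s y * q y)) *\<^sub>R dQQ D y - ((\<beta> + 2) * QQ y / (rho y * (s y)\<^sup>2 * q y)) *\<^sub>R (\<Gamma> *v y)
    - (2 * QQ y / (rho y * s y * (q y)\<^sup>2)) *\<^sub>R (\<Gamma> *v (g 0 *v (\<Gamma> *v y))))"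

lemma innerg: "(g y *v x) \<bullet> z = x \<bullet> (g y *v z)" by (rule symmetric_matrix_inner[OF symg])

lemma rho_pos: "x \<noteq> 0 \<Longrightarrow> rho x > 0" unfolding rho_def using s_pos[of x] by simp

lemma has_pd_\<Gamma>: "has_pd i (\<lambda>y. (\<Gamma> *v y) $ k) ((\<Gamma> *v axis i 1) $ k) x" by (rule has_pd_component)

lemma has_pd_rho: assumes "x \<noteq> 0" shows "has_pd i rho (\<beta> * rho x / s x * (\<Gamma> *v x) $ i) x"
proof -
  have s0: "s x > 0" by (rule s_pos[OF assms])
  have "has_pd i (\<lambda>y. s y powr (\<beta> / 2)) (\<beta> / 2 * s x powr (\<beta> / 2 - 1) * (2 * (\<Gamma> *v x) $ i)) x"
    by (rule has_pd_chain[OF has_pd_s has_real_derivative_powr[OF s0]])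
  moreover have "s x powr (\<beta> / 2 - 1) = rho x / s x" using s0 by (simp add: powr_diff rho_def)
  ultimately show ?thesis by (simp add: rho_def[abs_def] mult.assoc)
qed

lemma has_pd_inv_rho_s:
  assumes "x \<noteq> 0"
  shows "has_pd i (\<lambda>y. c / (rho y * s y)) (- (c / (rho x * s x)) * ((\<beta> + 2) / s x) * (\<Gamma> *v x) $ i) x"
proof (rule has_pd_eq)
  have s0: "s x > 0" "rho x > 0" by (rule s_pos[OF assms], rule rho_pos[OF assms])
  show "has_pd i (\<lambda>y. c / (rho y * s y)) (0 / (rho x * s x) - c * (\<beta> * rho x / s x * (\<Gamma> *v x) $ i * s x + rho x * (2 * (\<Gamma> *v x) $ i)) / (rho x * s x)\<^sup>2) x"
    by (rule has_pd_divide[OF has_pd_const has_pd_mult[OF has_pd_rho[OF assms] has_pd_s]]) (use s0 in simp)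
  show "0 / (rho x * s x) - c * (\<beta> * rho x / s x * (\<Gamma> *v x) $ i * s x + rho x * (2 * (\<Gamma> *v x) $ i)) / (rho x * s x)\<^sup>2
     = - (c / (rho x * s x)) * ((\<beta> + 2) / s x) * (\<Gamma> *v x) $ i"
    using s0 by (simp add: field_simps power2_eq_square)
qed

lemma has_pd_E: assumes "x \<noteq> 0" shows "has_pd i E (- (kap x * (\<Gamma> *v x) $ i) * E x) x"
proof -
  have s0: "s x > 0" "rho x > 0" by (rule s_pos[OF assms], rule rho_pos[OF assms])
  have "has_pd i (\<lambda>y. \<tau> / rho y) (0 / rho x - \<tau> * (\<beta> * rho x / s x * (\<Gamma> *v x) $ i) / (rho x)\<^sup>2) x"
    by (rule has_pd_divide[OF has_pd_const has_pd_rho[OF assms]]) (use s0 in simp)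
  from has_pd_chain[OF this DERIV_exp]
  have "has_pd i E (exp (\<tau> / rho x) * (0 / rho x - \<tau> * (\<beta> * rho x / s x * (\<Gamma> *v x) $ i) / (rho x)\<^sup>2)) x"
    by (simp only: E_def[abs_def])
  then show ?thesis
  proof (rule has_pd_eq)
    show "exp (\<tau> / rho x) * (0 / rho x - \<tau> * (\<beta> * rho x / s x * (\<Gamma> *v x) $ i) / (rho x)\<^sup>2) = - (kap x * (\<Gamma> *v x) $ i) * E x"
      using s0 by (simp add: kap_def E_def field_simps power2_eq_square)
  qed
qed

lemma has_pd_u: "has_pd i u (pd i u x) x" by (rule smooth_has_pd[OF smooth_u])
lemma has_pd_pd_u: "has_pd i (pd j u) (pd i (pd j u) x) x" by (rule smooth_has_pd[OF smooth_pd[OF smooth_u]])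

lemma has_pd_vv: assumes "x \<noteq> 0" shows "has_pd i vv (pp x $ i) x"
proof (rule has_pd_eq)
  show "has_pd i vv (- (kap x * (\<Gamma> *v x) $ i) * E x * u x + E x * pd i u x) x"
    unfolding vv_def[abs_def] by (rule has_pd_mult[OF has_pd_E[OF assms] has_pd_u])
  show "- (kap x * (\<Gamma> *v x) $ i) * E x * u x + E x * pd i u x = pp x $ i"
    by (simp add: pp_def gu_def algebra_simps)
qed

lemma has_pd_pp: assumes "x \<noteq> 0" shows "has_pd i (\<lambda>y. pp y $ j) (HH x i $ j) x"
proof (rule has_pd_eq)
  have k: "has_pd i kap (- kap x * ((\<beta> + 2) / s x) * (\<Gamma> *v x) $ i) x"
    unfolding kap_def[abs_def] by (rule has_pd_inv_rho_s[OF assms])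
  have "has_pd i (\<lambda>y. E y * (pd j u y - kap y * u y * (\<Gamma> *v y) $ j))
     (- (kap x * (\<Gamma> *v x) $ i) * E x * (pd j u x - kap x * u x * (\<Gamma> *v x) $ j)
      + E x * (pd i (pd j u) x - ((- kap x * ((\<beta> + 2) / s x) * (\<Gamma> *v x) $ i * u x + kap x * pd i u x) * (\<Gamma> *v x) $ j
         + kap x * u x * (\<Gamma> *v axis i 1) $ j))) x"
    by (intro has_pd_mult has_pd_diff has_pd_E k has_pd_u has_pd_pd_u has_pd_\<Gamma> assms)
  then show "has_pd i (\<lambda>y. pp y $ j)
     (- (kap x * (\<Gamma> *v x) $ i) * E x * (pd j u x - kap x * u x * (\<Gamma> *v x) $ j)
      + E x * (pd i (pd j u) x - ((- kap x * ((\<beta> + 2) / s x) * (\<Gamma> *v x) $ i * u x + kap x * pd i u x) * (\<Gamma> *v x) $ j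
         + kap x * u x * (\<Gamma> *v axis i 1) $ j))) x"
    by (simp add: pp_def gu_def)
  show "- (kap x * (\<Gamma> *v x) $ i) * E x * (pd j u x - kap x * u x * (\<Gamma> *v x) $ j)
      + E x * (pd i (pd j u) x - ((- kap x * ((\<beta> + 2) / s x) * (\<Gamma> *v x) $ i * u x + kap x * pd i u x) * (\<Gamma> *v x) $ j
         + kap x * u x * (\<Gamma> *v axis i 1) $ j)) = HH x i $ j"
    by (simp add: HH_def pp_def gu_def U_def algebra_simps add_divide_distrib diff_divide_distrib)
qed

lemma \<Gamma>_sym_entry: "(\<Gamma> *v axis i 1) $ j = (\<Gamma> *v axis j 1) $ i"
proof -
  have "(\<Gamma> *v axis i 1) \<bullet> axis j 1 = axis i 1 \<bullet> (\<Gamma> *v axis j 1)" by (rule inner\<Gamma>)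
  then show ?thesis by (simp add: inner_axis inner_axis')
qed

lemma HH_sym: "HH x i $ j = HH x j $ i"
proof -
  have "pd i (pd j u) x = pd j (pd i u) x" by (rule pd_commute[OF smooth_u])
  then show ?thesis using \<Gamma>_sym_entry[of i j] by (simp add: HH_def pp_def gu_def U_def algebra_simps)
qed

context
  fixes x :: "real ^ 'n" and D :: "'n \<Rightarrow> real ^ 'n ^ 'n"
  assumes x: "x \<noteq> 0" and D: "\<And>i k l. has_pd i (\<lambda>y. g y $ k $ l) (D i $ k $ l) x"
begin

lemma has_pd_mm: "has_pd i (\<lambda>y. mm y $ k) ((D i *v (\<Gamma> *v x) + g x *v (\<Gamma> *v axis i 1)) $ k) x"
  unfolding mm_def by (rule has_pd_matrix_vector[OF D has_pd_\<Gamma>])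

lemma has_pd_gpp: "has_pd i (\<lambda>y. (g y *v pp y) $ k) ((D i *v pp x + g x *v HH x i) $ k) x"
  by (rule has_pd_matrix_vector[OF D has_pd_pp[OF x]])

lemma has_pd_hh: "has_pd i hh (dhh x $ i) x"
proof (rule has_pd_eq)
  have q0: "q x > 0" "s x > 0" by (rule q_pos[OF x], rule s_pos[OF x])
  show "has_pd i hh ((\<beta> * rho x / s x * (\<Gamma> *v x) $ i * s x + rho x * (2 * (\<Gamma> *v x) $ i)) / q x
      - rho x * s x * (2 * (\<Gamma> *v (g 0 *v (\<Gamma> *v x))) $ i) / (q x)\<^sup>2) x"
    unfolding hh_def[abs_def]
    by (rule has_pd_divide[OF has_pd_mult[OF has_pd_rho[OF x] has_pd_s] has_pd_q]) (use q0 in simp)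
  show "(\<beta> * rho x / s x * (\<Gamma> *v x) $ i * s x + rho x * (2 * (\<Gamma> *v x) $ i)) / q x
      - rho x * s x * (2 * (\<Gamma> *v (g 0 *v (\<Gamma> *v x))) $ i) / (q x)\<^sup>2 = dhh x $ i"
    using q0 by (simp add: dhh_def field_simps power2_eq_square)
qed

lemma has_pd_ll: "has_pd i ll (dll x $ i) x"
proof (rule has_pd_eq)
  show "has_pd i ll ((dhh x $ i * T + hh x * 0) - (2 + \<omega>) * (\<beta> * rho x / s x * (\<Gamma> *v x) $ i)) x"
    unfolding ll_def[abs_def]
    by (intro has_pd_diff has_pd_mult has_pd_hh has_pd_const has_pd_cmult has_pd_rho x)
qed (simp add: dll_def)

lemma has_pd_QQ: "has_pd i QQ (dQQ D x $ i) x"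
proof (rule has_pd_eq)
  show "has_pd i QQ ((D i *v (\<Gamma> *v x) + g x *v (\<Gamma> *v axis i 1)) \<bullet> (\<Gamma> *v x) + mm x \<bullet> (\<Gamma> *v axis i 1)) x"
    unfolding QQ_def[abs_def] by (rule has_pd_inner_const[OF has_pd_mm has_pd_\<Gamma>])
  have "(g x *v (\<Gamma> *v axis i 1)) \<bullet> (\<Gamma> *v x) = (\<Gamma> *v mm x) $ i"
    by (simp only: innerg mm_def[symmetric] inner\<Gamma>) (simp only: inner_axis_comp)
  moreover have "mm x \<bullet> (\<Gamma> *v axis i 1) = (\<Gamma> *v mm x) $ i"
    by (simp only: inner\<Gamma>[symmetric] inner_axis_comp)
  ultimately show "(D i *v (\<Gamma> *v x) + g x *v (\<Gamma> *v axis i 1)) \<bullet> (\<Gamma> *v x) + mm x \<bullet> (\<Gamma> *v axis i 1) = dQQ D x $ i"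
    by (simp add: dQQ_def inner_add_left)
qed

lemma has_pd_kk: "has_pd i kk (dkk D x $ i) x"
proof (rule has_pd_eq)
  have p0: "q x > 0" "s x > 0" "rho x > 0" by (rule q_pos[OF x], rule s_pos[OF x], rule rho_pos[OF x])
  let ?d = "(\<beta> * rho x / s x * (\<Gamma> *v x) $ i * s x + rho x * (2 * (\<Gamma> *v x) $ i)) * q x + rho x * s x * (2 * (\<Gamma> *v (g 0 *v (\<Gamma> *v x))) $ i)"
  show "has_pd i kk (\<tau>\<^sup>2 * \<beta>\<^sup>2 * (dQQ D x $ i / (rho x * s x * q x) - QQ x * ?d / (rho x * s x * q x)\<^sup>2)) x"
    unfolding kk_def[abs_def]
    by (rule has_pd_cmult, rule has_pd_divide[OF has_pd_QQ has_pd_mult[OF has_pd_mult[OF has_pd_rho[OF x] has_pd_s] has_pd_q]])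
      (use p0 in simp)
  have "QQ x * ?d / (rho x * s x * q x)\<^sup>2 = (\<beta> + 2) * QQ x / (rho x * (s x)\<^sup>2 * q x) * (\<Gamma> *v x) $ i
     + 2 * QQ x / (rho x * s x * (q x)\<^sup>2) * (\<Gamma> *v (g 0 *v (\<Gamma> *v x))) $ i"
    using p0 by (simp add: field_simps power2_eq_square)
  then show "\<tau>\<^sup>2 * \<beta>\<^sup>2 * (dQQ D x $ i / (rho x * s x * q x) - QQ x * ?d / (rho x * s x * q x)\<^sup>2) = dkk D x $ i"
    by (simp add: dkk_def algebra_simps)
qed

text \<open>
  Links the analysis to the algebra: the derivatives of the actual flux are those that the
  divergence identity speaks about.
\<close>

theorem has_pd_flux:
  "has_pd i (flux i) (flux_deriv (g x) D \<Gamma> (\<Gamma> *v x) (pp x) (HH x) (vv x) (hh x) (ll x) (kk x) (dhh x) (dll x) (dkk D x) i) x"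
proof (rule has_pd_eq)
  let ?m' = "D i *v (\<Gamma> *v x) + g x *v (\<Gamma> *v axis i 1)"
  let ?gp' = "D i *v pp x + g x *v HH x i"
  have v2: "has_pd i (\<lambda>y. (vv y)\<^sup>2) (pp x $ i * vv x + vv x * pp x $ i) x"
    unfolding power2_eq_square by (rule has_pd_mult[OF has_pd_vv[OF x] has_pd_vv[OF x]])
  show "has_pd i (flux i)
     (((2 * (dhh x $ i * (mm x \<bullet> pp x) + hh x * (?m' \<bullet> pp x + mm x \<bullet> HH x i)) + (dll x $ i * vv x + ll x * pp x $ i)) * (g x *v pp x) $ i
        + (2 * (hh x * (mm x \<bullet> pp x)) + ll x * vv x) * ?gp' $ i)
      - ((dhh x $ i * mm x $ i + hh x * ?m' $ i) * ((g x *v pp x) \<bullet> pp x) + hh x * mm x $ i * (?gp' \<bullet> pp x + (g x *v pp x) \<bullet> HH x i))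
      + ((dkk D x $ i * mm x $ i + kk x * ?m' $ i) * (vv x)\<^sup>2 + kk x * mm x $ i * (pp x $ i * vv x + vv x * pp x $ i))) x"
    unfolding flux_def[abs_def]
    by (intro has_pd_add has_pd_diff has_pd_mult has_pd_cmult has_pd_inner_const has_pd_hh has_pd_ll has_pd_kk has_pd_mm has_pd_pp[OF x]
        has_pd_vv[OF x] has_pd_gpp v2)
qed (simp add: flux_deriv_def Let_def mm_def[symmetric])

lemma laplace_eq: "laplace g u x = (\<Sum>i\<in>UNIV. (D i *v gu x) $ i + (g x *v U x i) $ i)"
proof -
  have "pd i (\<lambda>y. g y $ i $ j * pd j u y) x = D i $ i $ j * pd j u x + g x $ i $ j * pd i (pd j u) x" for i j
    by (rule has_pd_imp_pd, rule has_pd_mult[OF D has_pd_pd_u])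
  then show ?thesis unfolding laplace_def by (simp add: matrix_vector_mult_def gu_def U_def sum.distrib)
qed

text \<open>
  Substitute \<open>E \<nabla>u = \<nabla>v + \<kappa> v y\<close> and the corresponding expression for \<open>E \<nabla>\<^sup>2u\<close> and collect terms.
\<close>

theorem conj_lap_eq: "E x * laplace g u x = conj_lap (g x) D \<Gamma> (\<Gamma> *v x) (pp x) (HH x) (vv x) (kap x) (\<beta> + 2) (s x)"
proof -
  let ?y = "\<Gamma> *v x" and ?k = "kap x" and ?v = "vv x" and ?p = "pp x" and ?a = "g x"
  have Egu: "E x *\<^sub>R gu x = ?p + (?k * ?v) *\<^sub>R ?y"
    by (simp add: pp_def vv_def vec_eq_iff algebra_simps)
  have Eui: "E x * pd i u x = ?p $ i + ?k * ?v * ?y $ i" for i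
    by (simp add: pp_def vv_def gu_def algebra_simps)
  have EU: "E x *\<^sub>R U x i = HH x i + (?k * ?y $ i) *\<^sub>R ?p + (?k * (?p $ i + ?k * ?v * ?y $ i)) *\<^sub>R ?y
      + (?k * ?v) *\<^sub>R (\<Gamma> *v axis i 1) - (?k * (\<beta> + 2) / s x * ?y $ i * ?v) *\<^sub>R ?y" for i
    unfolding HH_def Eui[symmetric] by (simp add: vv_def vec_eq_iff algebra_simps)
  have t: "E x * ((D i *v gu x) $ i + (?a *v U x i) $ i) = ((D i *v ?p) $ i + (?a *v HH x i) $ i)
      + ?k * ?v * ((D i *v ?y) $ i + (?a *v (\<Gamma> *v axis i 1)) $ i)
      + ?k * (?y $ i * (?a *v ?p) $ i) + ?k * (?p $ i * mm x $ i) + ?k\<^sup>2 * ?v * (?y $ i * mm x $ i)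
      - ?k * (\<beta> + 2) / s x * ?v * (?y $ i * mm x $ i)" for i
  proof -
    have "E x * ((D i *v gu x) $ i + (?a *v U x i) $ i) = (D i *v (E x *\<^sub>R gu x)) $ i + (?a *v (E x *\<^sub>R U x i)) $ i"
      by (simp add: matrix_vector_mult_scaleR algebra_simps)
    also have "\<dots> = ((D i *v ?p) $ i + (?a *v HH x i) $ i)
      + ?k * ?v * ((D i *v ?y) $ i + (?a *v (\<Gamma> *v axis i 1)) $ i)
      + ?k * (?y $ i * (?a *v ?p) $ i) + ?k * (?p $ i * mm x $ i) + ?k\<^sup>2 * ?v * (?y $ i * mm x $ i)
      - ?k * (\<beta> + 2) / s x * ?v * (?y $ i * mm x $ i)"
      unfolding Egu EU
      by (simp add: matrix_vector_right_distrib matrix_vector_mult_diff_distrib matrix_vector_mult_scaleR mm_def[symmetric])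
        (simp add: algebra_simps power2_eq_square)
    finally show ?thesis .
  qed
  have in1: "(\<Sum>i\<in>UNIV. w $ i * z $ i) = w \<bullet> z" for w z :: "real ^ 'n" by (simp add: inner_vec_def)
  have "E x * laplace g u x = (\<Sum>i\<in>UNIV. E x * ((D i *v gu x) $ i + (?a *v U x i) $ i))"
    unfolding laplace_eq sum_distrib_left ..
  also have "\<dots> = (\<Sum>i\<in>UNIV. (D i *v ?p) $ i + (?a *v HH x i) $ i)
      + ?k * ?v * (\<Sum>i\<in>UNIV. (D i *v ?y) $ i + (?a *v (\<Gamma> *v axis i 1)) $ i)
      + ?k * (?y \<bullet> (?a *v ?p)) + ?k * (?p \<bullet> mm x) + ?k\<^sup>2 * ?v * (?y \<bullet> mm x)
      - ?k * (\<beta> + 2) / s x * ?v * (?y \<bullet> mm x)"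
    unfolding t in1[symmetric] by (simp add: sum.distrib sum_subtractf sum_distrib_left distrib_left)
  also have "?y \<bullet> (?a *v ?p) = mm x \<bullet> ?p" by (simp only: innerg[symmetric] mm_def)
  also have "?p \<bullet> mm x = mm x \<bullet> ?p" by (rule inner_commute)
  also have "?y \<bullet> mm x = mm x \<bullet> ?y" by (rule inner_commute)
  finally show ?thesis unfolding conj_lap_def mm_def[symmetric] by (simp add: algebra_simps)
qed

end

lemma loc_lip_comp: "loc_lip_at (\<lambda>y. (A *v y) $ k) (x :: real ^ 'n)"
proof -
  have "bounded_linear (\<lambda>y. (A *v y) $ k)"
    by (rule bounded_linear_compose[OF bounded_linear_vec_nth matrix_vector_mul_bounded_linear])
  then obtain B where "B-lipschitz_on UNIV (\<lambda>y. (A *v y) $ k)" by (rule bounded_linear.lipschitz_boundE)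
  then show ?thesis by (rule loc_lip_at_lipschitz)
qed

lemma loc_lip_vec: "loc_lip_at (\<lambda>y. y $ k) (x :: real ^ 'n)"
  using loc_lip_comp[of "mat 1" k x] by simp

lemma loc_lip_inner:
  assumes "\<And>k. loc_lip_at (\<lambda>y. f y $ k) x" "\<And>k. loc_lip_at (\<lambda>y. h y $ k) (x :: real ^ 'n)"
  shows "loc_lip_at (\<lambda>y. f y \<bullet> (h y :: real ^ 'n)) x"
  unfolding inner_vec_def inner_real_def by (intro loc_lip_at_sum loc_lip_at_mult assms)

lemma loc_lip_mv:
  assumes "\<And>k l. loc_lip_at (\<lambda>y. A y $ k $ l) x" "\<And>k. loc_lip_at (\<lambda>y. f y $ k) (x :: real ^ 'n)"
  shows "loc_lip_at (\<lambda>y. (A y *v (f y :: real ^ 'n) :: real ^ 'n) $ k) x"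
proof -
  have "loc_lip_at (\<lambda>y. \<Sum>l\<in>UNIV. A y $ k $ l * f y $ l) x" by (intro loc_lip_at_sum loc_lip_at_mult assms)
  then show ?thesis by (simp add: matrix_vector_mult_def)
qed

lemma loc_lip_s: "loc_lip_at s x" unfolding s_def[abs_def] by (intro loc_lip_inner loc_lip_comp loc_lip_vec)

lemma loc_lip_q: "loc_lip_at q x"
  unfolding q_def[abs_def] by (intro loc_lip_inner loc_lip_comp loc_lip_mv loc_lip_at_const)

lemma loc_lip_u: "loc_lip_at u x" by (rule smooth_loc_lip_at[OF smooth_u])

lemma loc_lip_pd_u: "loc_lip_at (pd j u) x" by (rule smooth_loc_lip_at[OF smooth_pd[OF smooth_u]])

context
  fixes x :: "real ^ 'n"
  assumes x: "x \<noteq> 0"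
begin

lemma weights_nonzero: "s x > 0" "q x \<noteq> 0" "rho x \<noteq> 0" "rho x * s x \<noteq> 0" "rho x * s x * q x \<noteq> 0"
  using s_pos[OF x] q_pos[OF x] rho_pos[OF x] by auto

lemma loc_lip_rho: "loc_lip_at rho x" unfolding rho_def[abs_def] by (intro loc_lip_at_powr loc_lip_s weights_nonzero)

lemma loc_lip_E: "loc_lip_at E x"
  unfolding E_def[abs_def] by (intro loc_lip_at_exp loc_lip_at_divide loc_lip_at_const loc_lip_rho weights_nonzero)

lemma loc_lip_kap: "loc_lip_at kap x"
  unfolding kap_def[abs_def] by (intro loc_lip_at_divide loc_lip_at_mult loc_lip_at_const loc_lip_rho loc_lip_s weights_nonzero)

lemma loc_lip_vv: "loc_lip_at vv x" unfolding vv_def[abs_def] by (intro loc_lip_at_mult loc_lip_E loc_lip_u)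

lemma loc_lip_pp: "loc_lip_at (\<lambda>y. pp y $ k) x"
proof -
  have "loc_lip_at (\<lambda>y. E y * (pd k u y - kap y * u y * (\<Gamma> *v y) $ k)) x"
    by (intro loc_lip_at_mult loc_lip_at_diff loc_lip_E loc_lip_pd_u loc_lip_kap loc_lip_u loc_lip_comp)
  then show ?thesis by (simp add: pp_def gu_def)
qed

lemma loc_lip_hh: "loc_lip_at hh x"
  unfolding hh_def[abs_def] by (intro loc_lip_at_divide loc_lip_at_mult loc_lip_rho loc_lip_s loc_lip_q weights_nonzero)

lemma loc_lip_ll: "loc_lip_at ll x"
  unfolding ll_def[abs_def] by (intro loc_lip_at_diff loc_lip_at_mult loc_lip_at_const loc_lip_rho loc_lip_hh)

end

context
  assumes lipg: "\<And>k l. \<exists>L. L-lipschitz_on UNIV (\<lambda>y. g y $ k $ l)"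
begin

lemma loc_lip_g: "loc_lip_at (\<lambda>y. g y $ k $ l) x"
  using lipg[of k l] loc_lip_at_lipschitz by blast

lemma loc_lip_mm: "loc_lip_at (\<lambda>y. mm y $ k) x" unfolding mm_def by (intro loc_lip_mv loc_lip_g loc_lip_comp)

lemma loc_lip_QQ: "loc_lip_at QQ x" unfolding QQ_def[abs_def] by (intro loc_lip_inner loc_lip_mm loc_lip_comp)

lemma loc_lip_kk: "x \<noteq> 0 \<Longrightarrow> loc_lip_at kk x"
  unfolding kk_def[abs_def] by (intro loc_lip_at_divide loc_lip_at_mult loc_lip_at_const loc_lip_rho loc_lip_s loc_lip_q loc_lip_QQ weights_nonzero)

lemma loc_lip_flux: "x \<noteq> 0 \<Longrightarrow> loc_lip_at (flux i) x"
  unfolding flux_def[abs_def] power2_eq_square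
  by (intro loc_lip_at_add loc_lip_at_diff loc_lip_at_mult loc_lip_at_const loc_lip_inner loc_lip_mv loc_lip_g loc_lip_hh loc_lip_mm loc_lip_pp loc_lip_ll loc_lip_vv loc_lip_kk)

end

end

section \<open>Integration of the pointwise estimate\<close>

lemma norm_mv_le_entries:
  fixes A :: "real ^ 'n ^ 'n"
  assumes "(\<Sum>i\<in>UNIV. \<Sum>j\<in>UNIV. \<bar>A $ i $ j\<bar>) \<le> c"
  shows "norm (A *v x) \<le> c * norm x"
proof -
  have "norm (A *v x) \<le> (\<Sum>i\<in>UNIV. \<bar>(A *v x) $ i\<bar>)" by (rule norm_le_l1_cart)
  also have "\<dots> \<le> (\<Sum>i\<in>UNIV. \<Sum>j\<in>UNIV. \<bar>A $ i $ j\<bar> * norm x)"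
  proof (rule sum_mono)
    fix i
    have "\<bar>(A *v x) $ i\<bar> \<le> (\<Sum>j\<in>UNIV. \<bar>A $ i $ j * x $ j\<bar>)"
      unfolding matrix_vector_mult_def by (simp only: vec_lambda_beta sum_abs)
    also have "\<dots> \<le> (\<Sum>j\<in>UNIV. \<bar>A $ i $ j\<bar> * norm x)"
      by (rule sum_mono) (simp add: abs_mult component_le_norm_cart mult_left_mono)
    finally show "\<bar>(A *v x) $ i\<bar> \<le> (\<Sum>j\<in>UNIV. \<bar>A $ i $ j\<bar> * norm x)" .
  qed
  also have "\<dots> = (\<Sum>i\<in>UNIV. \<Sum>j\<in>UNIV. \<bar>A $ i $ j\<bar>) * norm x" by (simp add: sum_distrib_right)
  also have "\<dots> \<le> c * norm x" by (rule mult_right_mono[OF assms]) simp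
  finally show ?thesis .
qed

text \<open>
  Gives at once the bound on \<open>\<partial>g\<close> required of a frame and the bound on \<open>\<Delta>\<^sub>g u\<close> needed for integrability.
\<close>

lemma has_pd_lipschitz_bound:
  assumes d: "has_pd i f D x" and L: "L-lipschitz_on UNIV f"
  shows "\<bar>D\<bar> \<le> L"
proof (rule tendsto_upperbound)
  have "((\<lambda>t. (f (x + t *\<^sub>R axis i 1) - f x) / t) \<longlongrightarrow> D) (at 0)"
    using d by (simp add: has_pd_def DERIV_def)
  then show "((\<lambda>t. \<bar>(f (x + t *\<^sub>R axis i 1) - f x) / t\<bar>) \<longlongrightarrow> \<bar>D\<bar>) (at 0)" by (rule tendsto_rabs)
  show "\<forall>\<^sub>F t in at 0. \<bar>(f (x + t *\<^sub>R axis i 1) - f x) / t\<bar> \<le> L"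
  proof (rule eventually_at_topological[THEN iffD2], intro exI[of _ UNIV] conjI ballI impI)
    fix t :: real assume t: "t \<noteq> 0"
    have "\<bar>f (x + t *\<^sub>R axis i 1) - f x\<bar> \<le> L * dist (x + t *\<^sub>R axis i 1) x"
      using lipschitz_onD[OF L, of "x + t *\<^sub>R axis i 1" x] by (simp add: dist_real_def)
    also have "dist (x + t *\<^sub>R axis i 1) x = \<bar>t\<bar>" by (simp add: dist_norm)
    finally show "\<bar>(f (x + t *\<^sub>R axis i 1) - f x) / t\<bar> \<le> L" using t by (simp add: abs_divide field_simps)
  qed auto
qed simp

lemma lipschitz_AE_has_pd:
  fixes f :: "real ^ 'n \<Rightarrow> real"
  assumes "L-lipschitz_on UNIV f"
  shows "AE x in lborel. has_pd i f (pd i f x) x"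
  using lipschitz_AE_differentiable_along[OF assms, of "axis i 1"]
proof eventually_elim
  case (elim x)
  then obtain D where "has_pd i f D x" unfolding has_pd_def real_differentiable_def by blast
  then show ?case using has_pd_imp_pd by metis
qed

lemma pd_measurable: "continuous_on UNIV f \<Longrightarrow> pd i f \<in> borel_measurable borel"
  unfolding pd_def[abs_def] by (rule deriv_along_measurable)

text \<open>
  At the origin the weights are singular and, \<open>\<sigma>\<close> being zero there, take default values of \<^const>\<open>powr\<close>.
  Neither matters for functions that vanish near the origin.
\<close>

lemma loc_lip_at_vanishing:
  assumes "closed A" "(0::'a::real_normed_vector) \<notin> A" "\<And>y. y \<notin> A \<Longrightarrow> f y = (0::real)"
    and "\<And>y. y \<noteq> 0 \<Longrightarrow> f y = f' y" "\<And>x. x \<noteq> 0 \<Longrightarrow> loc_lip_at f' x"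
  shows "loc_lip_at f x"
proof (cases "x = 0")
  case True
  show ?thesis
    by (rule loc_lip_at_cong[OF loc_lip_at_const[of 0], of "- A"]) (use True assms(1-3) in auto)
next
  case False
  show ?thesis
    by (rule loc_lip_at_cong[OF assms(5)[OF False], of "- {0}"]) (use False assms(4) in auto)
qed

context carleman_fn
begin

lemma sigma_powr: assumes "x \<noteq> 0" shows "sigma_norm \<Gamma> x powr c = s x powr (c / 2)"
proof -
  have "sigma_norm \<Gamma> x = s x powr (1 / 2)" using s_pos[OF assms] by (simp add: sigma_eq powr_half_sqrt)
  then show ?thesis by (simp add: powr_powr)
qed

lemma sigma_powr_eqs:
  assumes x: "x \<noteq> 0"
  shows "sigma_norm \<Gamma> x powr \<beta> = rho x" "sigma_norm \<Gamma> x powr (- \<beta> - 2) = 1 / (rho x * s x)"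
    "sigma_norm \<Gamma> x powr (2 * \<beta> + 2) = (rho x)\<^sup>2 * s x" "weight \<beta> \<Gamma> x powr (- 2 * \<tau>) = (E x)\<^sup>2"
proof -
  have s0: "s x > 0" by (rule s_pos[OF x])
  show 1: "sigma_norm \<Gamma> x powr \<beta> = rho x" by (simp add: sigma_powr[OF x] rho_def)
  have "sigma_norm \<Gamma> x powr (- \<beta> - 2) = s x powr (- (\<beta> / 2 + 1))" by (simp add: sigma_powr[OF x] diff_divide_distrib)
  also have "\<dots> = 1 / (s x powr (\<beta> / 2 + 1))" by (rule powr_minus_divide)
  finally show "sigma_norm \<Gamma> x powr (- \<beta> - 2) = 1 / (rho x * s x)" using s0 by (simp add: powr_add rho_def)
  have e: "(2 * \<beta> + 2) / 2 = \<beta> / 2 + \<beta> / 2 + 1" by simp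
  have "sigma_norm \<Gamma> x powr (2 * \<beta> + 2) = s x powr (\<beta> / 2) * s x powr (\<beta> / 2) * s x powr 1"
    unfolding sigma_powr[OF x, of "2 * \<beta> + 2"] e unfolding powr_add ..
  then show "sigma_norm \<Gamma> x powr (2 * \<beta> + 2) = (rho x)\<^sup>2 * s x" using s0 by (simp add: rho_def power2_eq_square)
  have "weight \<beta> \<Gamma> x = exp (- (1 / rho x))" unfolding weight_def phi_def powr_minus_divide 1 ..
  then have "weight \<beta> \<Gamma> x powr (- 2 * \<tau>) = exp (2 * \<tau> / rho x)" by (simp add: powr_def)
  also have "\<dots> = (E x)\<^sup>2" by (simp add: E_def power2_eq_square exp_add[symmetric])
  finally show "weight \<beta> \<Gamma> x powr (- 2 * \<tau>) = (E x)\<^sup>2" .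
qed

lemma grad_norm_sq_eq: "grad_norm_sq g u x = (g x *v gu x) \<bullet> gu x"
proof -
  have "grad_norm_sq g u x = (\<Sum>i\<in>UNIV. \<Sum>j\<in>UNIV. g x $ i $ j * gu x $ i * gu x $ j)"
    by (simp add: grad_norm_sq_def gu_def)
  then show ?thesis by (simp only: quadratic_form_sum)
qed

text \<open>
  The two integrands on the left are continuous with compact support, the one on the right is bounded
  almost everywhere and measurable, and the divergence integrates to zero. On the complement of the
  support of \<open>u\<close> all terms vanish, so the pointwise estimate is needed only where \<open>\<sigma>\<close> is positive and
  less than \<open>r0\<close>.
\<close>

theorem integrated_inequality:
  assumes lipg: "\<And>k l. \<exists>L. L-lipschitz_on UNIV (\<lambda>y. g y $ k $ l)"
    and u0: "u \<in> C0_infty (sigma_ball \<Gamma> r0 - {0})" and C: "C \<ge> 0"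
    and pw: "\<And>x D. x \<noteq> 0 \<Longrightarrow> sigma_norm \<Gamma> x < r0 \<Longrightarrow> (\<And>i k l. has_pd i (\<lambda>y. g y $ k $ l) (D i $ k $ l) x) \<Longrightarrow>
      \<tau> * rho x * ((g x *v (E x *\<^sub>R gu x)) \<bullet> (E x *\<^sub>R gu x)) + \<tau> ^ 3 * (vv x)\<^sup>2 / (rho x * s x)
      \<le> C * ((rho x)\<^sup>2 * s x * (E x * laplace g u x)\<^sup>2) - C' * \<tau> * (\<Sum>i\<in>UNIV. pd i (flux i) x)"
  shows "\<tau> * (\<integral>x. sigma_norm \<Gamma> x powr \<beta> * weight \<beta> \<Gamma> x powr (- 2 * \<tau>) * grad_norm_sq g u x \<partial>lborel)
    + \<tau> ^ 3 * (\<integral>x. sigma_norm \<Gamma> x powr (- \<beta> - 2) * weight \<beta> \<Gamma> x powr (- 2 * \<tau>) * (u x)\<^sup>2 \<partial>lborel)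
    \<le> C * (\<integral>x. sigma_norm \<Gamma> x powr (2 * \<beta> + 2) * weight \<beta> \<Gamma> x powr (- 2 * \<tau>) * (laplace g u x)\<^sup>2 \<partial>lborel)"
proof -
  define A where "A = closure {x. u x \<noteq> 0}"
  have A: "compact A" "A \<subseteq> sigma_ball \<Gamma> r0 - {0}" using u0 by (auto simp: C0_infty_def A_def)
  have cA: "closed A" using A(1) by (rule compact_imp_closed)
  have A0: "0 \<notin> A" using A(2) by auto
  obtain R where R: "A \<subseteq> cball 0 R" using compact_imp_bounded[OF A(1)] by (auto simp: bounded_iff subset_iff)
  let ?f1 = "\<lambda>x. sigma_norm \<Gamma> x powr \<beta> * weight \<beta> \<Gamma> x powr (- 2 * \<tau>) * grad_norm_sq g u x"
  let ?f2 = "\<lambda>x. sigma_norm \<Gamma> x powr (- \<beta> - 2) * weight \<beta> \<Gamma> x powr (- 2 * \<tau>) * (u x)\<^sup>2"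
  let ?f3 = "\<lambda>x. sigma_norm \<Gamma> x powr (2 * \<beta> + 2) * weight \<beta> \<Gamma> x powr (- 2 * \<tau>) * (laplace g u x)\<^sup>2"
  have opA: "open (- A)" using cA by auto
  have uz: "u y = 0" if "y \<notin> A" for y using that closure_subset[of "{x. u x \<noteq> 0}"] unfolding A_def by auto
  have pdz: "pd j u y = 0" if "y \<notin> A" for j y
    using pd_cong[OF opA, of y u "\<lambda>_. 0" j] has_pd_imp_pd[OF has_pd_const[of j 0 y]] uz that by simp
  have guz: "gu y = 0" if "y \<notin> A" for y using pdz[OF that] by (simp add: gu_def vec_eq_iff)
  have vvz: "vv y = 0" and ppz: "pp y = 0" if "y \<notin> A" for y using uz[OF that] guz[OF that] by (simp_all add: vv_def pp_def)
  have fluxz: "flux i y = 0" if "y \<notin> A" for i y using vvz[OF that] ppz[OF that] by (simp add: flux_def)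
  have pdfluxz: "pd i (flux i) y = 0" if "y \<notin> A" for i y
    using pd_cong[OF opA, of y "flux i" "\<lambda>_. 0" i] has_pd_imp_pd[OF has_pd_const[of i 0 y]] fluxz that by simp
  have lapz: "laplace g u y = 0" if "y \<notin> A" for y
  proof -
    have "pd i (\<lambda>y. g y $ i $ j * pd j u y) y = 0" for i j
      using pd_cong[OF opA, of y "\<lambda>y. g y $ i $ j * pd j u y" "\<lambda>_. 0" i] has_pd_imp_pd[OF has_pd_const[of i 0 y]] pdz that by simp
    then show ?thesis by (simp add: laplace_def)
  qed
  have offA: "y \<notin> A" if "y \<notin> cball 0 R" for y using that R by auto
  note loc_lips = loc_lip_g[OF lipg] loc_lip_inner loc_lip_mv
  have "loc_lip_at ?f1 x" for x
  proof (rule loc_lip_at_vanishing[OF cA A0, of _ "\<lambda>x. rho x * (E x * E x) * ((g x *v gu x) \<bullet> gu x)"])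
    show "?f1 y = 0" if "y \<notin> A" for y using guz[OF that] by (simp add: grad_norm_sq_eq)
    show "?f1 y = rho y * (E y * E y) * ((g y *v gu y) \<bullet> gu y)" if "y \<noteq> 0" for y
      using sigma_powr_eqs[OF that] by (simp add: grad_norm_sq_eq power2_eq_square)
    have gul: "loc_lip_at (\<lambda>y. gu y $ k) x" for x k unfolding gu_def using loc_lip_pd_u[of k x] by simp
    show "loc_lip_at (\<lambda>x. rho x * (E x * E x) * ((g x *v gu x) \<bullet> gu x)) x" if "x \<noteq> 0" for x
      by (intro loc_lip_at_mult loc_lips gul loc_lip_rho[OF that] loc_lip_E[OF that])
  qed
  then have c1: "continuous_on UNIV ?f1" by (intro continuous_at_imp_continuous_on ballI loc_lip_at_imp_isCont)
  have I1: "integrable lborel ?f1"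
    by (rule integrable_continuous_compact_support[OF c1, of R]) (use offA guz in \<open>simp add: grad_norm_sq_eq\<close>)
  have "loc_lip_at ?f2 x" for x
  proof (rule loc_lip_at_vanishing[OF cA A0, of _ "\<lambda>x. 1 / (rho x * s x) * (E x * E x) * (u x * u x)"])
    show "?f2 y = 0" if "y \<notin> A" for y using uz[OF that] by simp
    show "?f2 y = 1 / (rho y * s y) * (E y * E y) * (u y * u y)" if "y \<noteq> 0" for y
      using sigma_powr_eqs[OF that] by (simp add: power2_eq_square)
    show "loc_lip_at (\<lambda>x. 1 / (rho x * s x) * (E x * E x) * (u x * u x)) x" if "x \<noteq> 0" for x
      by (intro loc_lip_at_mult loc_lip_at_divide loc_lip_at_const loc_lip_s loc_lip_u loc_lip_rho[OF that] loc_lip_E[OF that] weights_nonzero[OF that])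
  qed
  then have c2: "continuous_on UNIV ?f2" by (intro continuous_at_imp_continuous_on ballI loc_lip_at_imp_isCont)
  have I2: "integrable lborel ?f2"
    by (rule integrable_continuous_compact_support[OF c2, of R]) (use offA uz in simp)
  have llfl: "loc_lip_at (flux i) x" for i x
    by (rule loc_lip_at_vanishing[OF cA A0, of _ "flux i"]) (use fluxz loc_lip_flux[OF lipg] in auto)
  have Ifl: "integrable lborel (pd i (flux i))" and Zfl: "(\<integral>x. pd i (flux i) x \<partial>lborel) = 0" for i
  proof -
    have z: "flux i x = 0" if "x \<notin> cball 0 R" for x by (rule fluxz[OF offA[OF that]])
    obtain L where L: "L-lipschitz_on UNIV (flux i)"
      using lipschitz_of_loc_lip_compact_support[OF llfl z] by blast
    show "integrable lborel (pd i (flux i))" "(\<integral>x. pd i (flux i) x \<partial>lborel) = 0"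
      using integral_deriv_along_eq_zero[OF L z, where e="axis i 1"] unfolding pd_def[abs_def] by simp_all
  qed
  \<comment> \<open>The components of the vector field whose divergence is the Laplacian are globally Lipschitz.\<close>
  let ?F = "\<lambda>i j y. g y $ i $ j * pd j u y"
  have llF: "loc_lip_at (?F i j) x" for i j x by (intro loc_lip_at_mult loc_lip_g[OF lipg] loc_lip_pd_u)
  have "\<exists>L. L-lipschitz_on UNIV (?F i j)" for i j
  proof -
    have z: "?F i j x = 0" if "x \<notin> cball 0 R" for x using pdz[OF offA[OF that]] by simp
    show ?thesis using lipschitz_of_loc_lip_compact_support[OF llF z] by blast
  qed
  then obtain LF where LF: "\<And>i j. (LF i j)-lipschitz_on UNIV (?F i j)" by metis
  have lapM: "laplace g u \<in> borel_measurable borel"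
    unfolding laplace_def[abs_def]
  proof (intro borel_measurable_sum)
    fix i j
    show "(\<lambda>x. pd i (?F i j) x) \<in> borel_measurable borel"
      by (rule pd_measurable[OF lipschitz_on_continuous_on[OF LF]])
  qed
  have "continuous_on UNIV (sigma_norm \<Gamma>)"
    unfolding sigma_norm_def[abs_def]
    by (intro continuous_on_real_sqrt continuous_on_inner linear_continuous_on matrix_vector_mul_bounded_linear continuous_on_id)
  then have sgM[measurable]: "sigma_norm \<Gamma> \<in> borel_measurable borel" by (rule borel_measurable_continuous_onI)
  have M3: "?f3 \<in> borel_measurable lborel"
    unfolding weight_def phi_def using lapM by measurable
  define Mlap where "Mlap = (\<Sum>i\<in>UNIV. \<Sum>j\<in>UNIV. LF i j)"
  have lapB: "AE x in lborel. \<bar>laplace g u x\<bar> \<le> Mlap"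
  proof -
    have "AE x in lborel. \<forall>i j. has_pd i (?F i j) (pd i (?F i j) x) x"
      by (intro eventually_all_finite lipschitz_AE_has_pd[OF LF])
    then show ?thesis
    proof eventually_elim
      case (elim x)
      have "\<bar>laplace g u x\<bar> \<le> (\<Sum>i\<in>UNIV. \<Sum>j\<in>UNIV. \<bar>pd i (?F i j) x\<bar>)"
        unfolding laplace_def by (intro order_trans[OF sum_abs] sum_mono sum_abs)
      also have "\<dots> \<le> Mlap" unfolding Mlap_def
        by (intro sum_mono has_pd_lipschitz_bound[OF _ LF]) (use elim in blast)
      finally show ?case .
    qed
  qed
  let ?co = "\<lambda>x. rho x * rho x * s x * (E x * E x)"
  have "continuous_on A ?co"
    by (intro continuous_at_imp_continuous_on ballI loc_lip_at_imp_isCont loc_lip_at_mult loc_lip_s loc_lip_rho loc_lip_E) (use A0 in auto)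
  then have "bounded (?co ` A)" using A(1) by (intro compact_imp_bounded compact_continuous_image)
  then obtain B where B: "B > 0" "\<And>x. x \<in> A \<Longrightarrow> \<bar>?co x\<bar> \<le> B" unfolding bounded_pos by auto
  have I3: "integrable lborel ?f3"
  proof (rule Bochner_Integration.integrable_bound)
    show "integrable lborel (\<lambda>x. B * Mlap\<^sup>2 * indicator (cball 0 R) x :: real)"
      by (intro integrable_mult_right integrable_real_indicator) (use emeasure_bounded_finite[OF bounded_cball] in auto)
    show "AE x in lborel. norm (?f3 x) \<le> norm (B * Mlap\<^sup>2 * indicator (cball 0 R) x :: real)"
      using lapB
    proof eventually_elim
      case (elim x)
      show ?case
      proof (cases "x \<in> A")
        case True
        then have x0: "x \<noteq> 0" using A0 by auto
        have xR: "x \<in> cball 0 R" using True R by auto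
        have "(laplace g u x)\<^sup>2 \<le> Mlap\<^sup>2" using elim by (rule abs_le_square_iff[THEN iffD1, OF order_trans]) simp
        then have b: "\<bar>?co x\<bar> * \<bar>(laplace g u x)\<^sup>2\<bar> \<le> B * Mlap\<^sup>2" using B True by (intro mult_mono) auto
        have e: "?f3 x = ?co x * (laplace g u x)\<^sup>2"
          unfolding sigma_powr_eqs[OF x0] by (simp only: power2_eq_square)
        have "norm (?f3 x) \<le> B * Mlap\<^sup>2" unfolding e real_norm_def abs_mult[of "?co x"] by (rule b)
        then show ?thesis using xR B by simp
      next
        case False
        then show ?thesis using lapz[OF False] by simp
      qed
    qed
  qed (rule M3)
  have gAE: "AE x in lborel. \<forall>i k l. has_pd i (\<lambda>y. g y $ k $ l) (pd i (\<lambda>y. g y $ k $ l) x) x"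
  proof (intro eventually_all_finite)
    fix i k l
    obtain L where "L-lipschitz_on UNIV (\<lambda>y. g y $ k $ l)" using lipg by blast
    then show "AE x in lborel. has_pd i (\<lambda>y. g y $ k $ l) (pd i (\<lambda>y. g y $ k $ l) x) x" by (rule lipschitz_AE_has_pd)
  qed
  have pAE: "AE x in lborel. \<tau> * ?f1 x + \<tau> ^ 3 * ?f2 x \<le> C * ?f3 x - C' * \<tau> * (\<Sum>i\<in>UNIV. pd i (flux i) x)"
    using gAE
  proof eventually_elim
    case (elim x)
    show ?case
    proof (cases "x \<in> A")
      case True
      then have x0: "x \<noteq> 0" and xr: "sigma_norm \<Gamma> x < r0" using A(2) by (auto simp: sigma_ball_def)
      define D where "D = (\<lambda>i. \<chi> k l. pd i (\<lambda>y. g y $ k $ l) x)"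
      have D: "\<And>i k l. has_pd i (\<lambda>y. g y $ k $ l) (D i $ k $ l) x" using elim by (simp add: D_def)
      have a: "\<tau> * ?f1 x = \<tau> * rho x * ((g x *v (E x *\<^sub>R gu x)) \<bullet> (E x *\<^sub>R gu x))"
        using sigma_powr_eqs[OF x0] by (simp add: grad_norm_sq_eq matrix_vector_mult_scaleR power2_eq_square)
      have b: "\<tau> ^ 3 * ?f2 x = \<tau> ^ 3 * (vv x)\<^sup>2 / (rho x * s x)"
        using sigma_powr_eqs[OF x0] by (simp add: vv_def power_mult_distrib)
      have c: "?f3 x = (rho x)\<^sup>2 * s x * (E x * laplace g u x)\<^sup>2"
        using sigma_powr_eqs[OF x0] by (simp add: power_mult_distrib)
      show ?thesis using pw[OF x0 xr D] by (simp only: a b c)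
    next
      case False
      then show ?thesis using guz uz lapz pdfluxz by (simp add: grad_norm_sq_eq)
    qed
  qed
  have IL: "integrable lborel (\<lambda>x. \<tau> * ?f1 x + \<tau> ^ 3 * ?f2 x)"
    by (intro Bochner_Integration.integrable_add integrable_mult_right I1 I2)
  have IR: "integrable lborel (\<lambda>x. C * ?f3 x - C' * \<tau> * (\<Sum>i\<in>UNIV. pd i (flux i) x))"
    by (intro Bochner_Integration.integrable_diff integrable_mult_right I3 Bochner_Integration.integrable_sum Ifl)
  have "(\<integral>x. \<tau> * ?f1 x + \<tau> ^ 3 * ?f2 x \<partial>lborel) \<le> (\<integral>x. C * ?f3 x - C' * \<tau> * (\<Sum>i\<in>UNIV. pd i (flux i) x) \<partial>lborel)"
    by (rule integral_mono_AE[OF IL IR pAE])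
  also have "(\<integral>x. C * ?f3 x - C' * \<tau> * (\<Sum>i\<in>UNIV. pd i (flux i) x) \<partial>lborel)
      = C * (\<integral>x. ?f3 x \<partial>lborel) - C' * \<tau> * (\<Sum>i\<in>UNIV. \<integral>x. pd i (flux i) x \<partial>lborel)"
    by (subst Bochner_Integration.integral_diff)
      (simp_all only: integrable_mult_right I3 Bochner_Integration.integrable_sum Ifl integral_mult_right_zero Bochner_Integration.integral_sum)
  also have "\<dots> = C * (\<integral>x. ?f3 x \<partial>lborel)" by (simp add: Zfl)
  also have "(\<integral>x. \<tau> * ?f1 x + \<tau> ^ 3 * ?f2 x \<partial>lborel) = \<tau> * (\<integral>x. ?f1 x \<partial>lborel) + \<tau> ^ 3 * (\<integral>x. ?f2 x \<partial>lborel)"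
    by (subst Bochner_Integration.integral_add) (simp_all only: integrable_mult_right I1 I2 integral_mult_right_zero)
  finally show ?thesis .
qed

end

section \<open>Uniform constants and the Carleman estimate\<close>

text \<open>
  Tuples of matrices and vectors, with projections named after the parameters of the locale \<open>frames\<close>.
  The set of all tuples that satisfy its assumptions is a single index set for every admissible
  metric, every \<open>\<Gamma>\<close> and every point, which is what makes the constants uniform.
\<close>

type_synonym 'n frame = "(real ^ 'n ^ 'n) \<times> (real ^ 'n ^ 'n) \<times> (real ^ 'n ^ 'n) \<times> ('n \<Rightarrow> real ^ 'n ^ 'n) \<times> (real ^ 'n) \<times> real"

definition fr_a :: "'n::finite frame \<Rightarrow> real ^ 'n ^ 'n" where "fr_a z = fst z"
definition fr_G :: "'n::finite frame \<Rightarrow> real ^ 'n ^ 'n" where "fr_G z = fst (snd z)"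
definition fr_Gam :: "'n::finite frame \<Rightarrow> real ^ 'n ^ 'n" where "fr_Gam z = fst (snd (snd z))"
definition fr_D :: "'n::finite frame \<Rightarrow> 'n \<Rightarrow> real ^ 'n ^ 'n" where "fr_D z = fst (snd (snd (snd z)))"
definition fr_Y :: "'n::finite frame \<Rightarrow> real ^ 'n" where "fr_Y z = fst (snd (snd (snd (snd z))))"
definition fr_r :: "'n::finite frame \<Rightarrow> real" where "fr_r z = snd (snd (snd (snd (snd z))))"

definition all_frames :: "real \<Rightarrow> real \<Rightarrow> 'n::finite frame set" where
  "all_frames K \<omega> = {z. 0 < fr_r z \<and> fr_r z \<le> 1
    \<and> (\<forall>x y. (fr_a z *v x) \<bullet> y = x \<bullet> (fr_a z *v y)) \<and> (\<forall>x y. (fr_G z *v x) \<bullet> y = x \<bullet> (fr_G z *v y))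
    \<and> (\<forall>x y. (fr_Gam z *v x) \<bullet> y = x \<bullet> (fr_Gam z *v y))
    \<and> (\<forall>x. norm (fr_a z *v x) \<le> K * norm x) \<and> (\<forall>x. norm (fr_G z *v x) \<le> K * norm x)
    \<and> (\<forall>x. norm (fr_Gam z *v x) \<le> K * norm x) \<and> (\<forall>i x. norm (fr_D z i *v x) \<le> K * norm x)
    \<and> (\<forall>x. norm (fr_a z *v x - fr_G z *v x) \<le> K * fr_r z * norm x)
    \<and> (\<forall>x. (norm x)\<^sup>2 \<le> K * ((fr_G z *v x) \<bullet> x))
    \<and> norm (fr_Y z) \<le> K \<and> 1 \<le> K * norm (fr_Y z)
    \<and> (\<forall>\<xi>. (fr_G z *v fr_Y z) \<bullet> \<xi> = 0 \<longrightarrow>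
       ((fr_Gam z *v (fr_G z *v fr_Y z)) \<bullet> (fr_G z *v fr_Y z)) / ((fr_G z *v fr_Y z) \<bullet> fr_Y z)\<^sup>2 * ((fr_G z *v \<xi>) \<bullet> \<xi>)
       + ((fr_Gam z *v (fr_G z *v \<xi>)) \<bullet> (fr_G z *v \<xi>)) / ((fr_G z *v fr_Y z) \<bullet> fr_Y z) \<le> (2 + \<omega>) * ((fr_G z *v \<xi>) \<bullet> \<xi>))}"

lemma frames_all_frames:
  assumes "K > 0" "0 \<le> \<omega>" "\<omega> < \<beta>"
  shows "frames (all_frames K \<omega>) fr_a fr_G fr_Gam fr_D fr_Y fr_r K \<beta> \<omega>"
  by unfold_locales ((unfold all_frames_def mem_Collect_eq)?, (use assms in blast))+

theorem theorem4p5: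
  fixes lam Lam m_min m_max \<beta> \<omega> :: real
  assumes "CARD('n::finite) \<ge> 2"
    and "0 < lam" and "lam \<le> 1" and "0 < Lam" and "0 < m_min"
    and "\<beta> > \<omega>"
  shows "\<exists>C \<tau>1 r0 :: real. C \<ge> 1 \<and> \<tau>1 \<ge> 1 \<and> 0 < r0 \<and> r0 \<le> 1 \<and>
    (\<forall>(g :: real ^ 'n \<Rightarrow> real ^ 'n ^ 'n) (\<Gamma> :: real ^ 'n ^ 'n).
      (\<forall>x. transpose (g x) = g x) \<and>
      (\<forall>x \<xi>. lam * (norm \<xi>)\<^sup>2 \<le> (\<Sum>i\<in>UNIV. \<Sum>j\<in>UNIV. g x $ i $ j * \<xi> $ i * \<xi> $ j) \<and>
             (\<Sum>i\<in>UNIV. \<Sum>j\<in>UNIV. g x $ i $ j * \<xi> $ i * \<xi> $ j) \<le> inverse lam * (norm \<xi>)\<^sup>2) \<and>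
      (\<forall>x y. (\<Sum>i\<in>UNIV. \<Sum>j\<in>UNIV. \<bar>g x $ i $ j - g y $ i $ j\<bar>) \<le> Lam * norm (x - y)) \<and>
      transpose \<Gamma> = \<Gamma> \<and>
      (\<forall>x. x \<noteq> 0 \<longrightarrow> 0 < (\<Gamma> *v x) \<bullet> x) \<and>
      m_min \<in> eigenvalues \<Gamma> \<and> m_max \<in> eigenvalues \<Gamma> \<and>
      (\<forall>\<mu>\<in>eigenvalues \<Gamma>. m_min \<le> \<mu> \<and> \<mu> \<le> m_max) \<and>
      omega0 (g 0) \<Gamma> \<le> \<omega>
      \<longrightarrow>
      (\<forall>u \<in> C0_infty (sigma_ball \<Gamma> r0 - {0}). \<forall>\<tau> \<ge> \<tau>1.
        \<tau> * (\<integral>x. sigma_norm \<Gamma> x powr \<beta> * weight \<beta> \<Gamma> x powr (-2 * \<tau>) * grad_norm_sq g u x \<partial>lborel)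
        + \<tau> ^ 3 * (\<integral>x. sigma_norm \<Gamma> x powr (- \<beta> - 2) * weight \<beta> \<Gamma> x powr (-2 * \<tau>) * (u x)\<^sup>2 \<partial>lborel)
        \<le> C * (\<integral>x. sigma_norm \<Gamma> x powr (2 * \<beta> + 2) * weight \<beta> \<Gamma> x powr (-2 * \<tau>)
                     * (laplace g u x)\<^sup>2 \<partial>lborel)))"
proof -
  let ?adm = "\<lambda>(g :: real ^ 'n \<Rightarrow> real ^ 'n ^ 'n) (\<Gamma> :: real ^ 'n ^ 'n).
      (\<forall>x. transpose (g x) = g x) \<and>
      (\<forall>x \<xi>. lam * (norm \<xi>)\<^sup>2 \<le> (\<Sum>i\<in>UNIV. \<Sum>j\<in>UNIV. g x $ i $ j * \<xi> $ i * \<xi> $ j) \<and>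
             (\<Sum>i\<in>UNIV. \<Sum>j\<in>UNIV. g x $ i $ j * \<xi> $ i * \<xi> $ j) \<le> inverse lam * (norm \<xi>)\<^sup>2) \<and>
      (\<forall>x y. (\<Sum>i\<in>UNIV. \<Sum>j\<in>UNIV. \<bar>g x $ i $ j - g y $ i $ j\<bar>) \<le> Lam * norm (x - y)) \<and>
      transpose \<Gamma> = \<Gamma> \<and>
      (\<forall>x. x \<noteq> 0 \<longrightarrow> 0 < (\<Gamma> *v x) \<bullet> x) \<and>
      m_min \<in> eigenvalues \<Gamma> \<and> m_max \<in> eigenvalues \<Gamma> \<and>
      (\<forall>\<mu>\<in>eigenvalues \<Gamma>. m_min \<le> \<mu> \<and> \<mu> \<le> m_max) \<and>
      omega0 (g 0) \<Gamma> \<le> \<omega>"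
  let ?n = "real CARD('n)"
  define sm where "sm = sqrt m_min"
  have sm: "sm > 0" "sm * sm = m_min" using assms(5) by (simp_all add: sm_def)
  let ?X = "{1, inverse lam, m_max, m_max / sm, 1 / sm, 1 / m_min, Lam / sm, ?n * (?n * Lam)}"
  define K where "K = Max ?X"
  have Kge: "c \<le> K" if "c \<in> ?X" for c unfolding K_def by (rule Max_ge) (use that in auto)
  have K1: "K \<ge> 1" by (rule Kge) simp
  then have K: "K > 0" by simp
  have form: "(\<Sum>i\<in>UNIV. \<Sum>j\<in>UNIV. g x $ i $ j * \<xi> $ i * \<xi> $ j) = (g x *v \<xi>) \<bullet> \<xi>" for g :: "real ^ 'n \<Rightarrow> real ^ 'n ^ 'n" and x \<xi>
    by (rule quadratic_form_sum)
  \<comment> \<open>The ellipticity, Lipschitz and eigenvalue constants enter only through K.\<close>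
  have bounds: "norm (g x *v z) \<le> K * norm z" "(norm z)\<^sup>2 \<le> K * ((g x *v z) \<bullet> z)"
      "norm (\<Gamma> *v z) \<le> K * norm z" "(norm z)\<^sup>2 \<le> K * ((\<Gamma> *v z) \<bullet> z)"
      "norm x * sm \<le> sigma_norm \<Gamma> x" "norm (\<Gamma> *v x) \<le> K * sigma_norm \<Gamma> x" "sigma_norm \<Gamma> x \<le> K * norm (\<Gamma> *v x)"
    if adm: "?adm g \<Gamma>" for g \<Gamma> x z
  proof -
    have symg: "transpose (g x) = g x" using adm by blast
    have lo: "lam * (norm v)\<^sup>2 \<le> (g x *v v) \<bullet> v" and hi: "(g x *v v) \<bullet> v \<le> inverse lam * (norm v)\<^sup>2" for v
      using adm unfolding form by blast+
    have psd: "(g x *v v) \<bullet> v \<ge> 0" for v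
    proof -
      have "0 \<le> lam * (norm v)\<^sup>2" using assms(2) by simp
      then show ?thesis using lo[of v] by linarith
    qed
    have "norm (g x *v z) \<le> inverse lam * norm z" by (rule psd_norm_bound[OF symg psd hi])
    also have "\<dots> \<le> K * norm z" by (intro mult_right_mono Kge) auto
    finally show "norm (g x *v z) \<le> K * norm z" .
    have "(norm z)\<^sup>2 \<le> inverse lam * ((g x *v z) \<bullet> z)" using lo[of z] assms(2) by (simp add: field_simps)
    also have "\<dots> \<le> K * ((g x *v z) \<bullet> z)" by (intro mult_right_mono Kge psd) auto
    finally show "(norm z)\<^sup>2 \<le> K * ((g x *v z) \<bullet> z)" .
    have sym\<Gamma>: "transpose \<Gamma> = \<Gamma>" and pos\<Gamma>: "\<And>x. x \<noteq> 0 \<Longrightarrow> 0 < (\<Gamma> *v x) \<bullet> x"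
      and ev: "\<And>\<mu>. \<mu> \<in> eigenvalues \<Gamma> \<Longrightarrow> m_min \<le> \<mu> \<and> \<mu> \<le> m_max" using adm by blast+
    note eb = eigenvalue_bounds[OF sym\<Gamma> pos\<Gamma> ev]
    have n\<Gamma>: "norm (\<Gamma> *v v) \<le> m_max * norm v" for v by (rule eb(3))
    have "m_max * norm z \<le> K * norm z" by (intro mult_right_mono Kge) auto
    then show "norm (\<Gamma> *v z) \<le> K * norm z" using n\<Gamma>[of z] by linarith
    have psd\<Gamma>: "(\<Gamma> *v v) \<bullet> v \<ge> 0" for v using pos\<Gamma>[of v] by (cases "v = 0") auto
    have "(norm z)\<^sup>2 \<le> 1 / m_min * ((\<Gamma> *v z) \<bullet> z)" using eb(1)[of z] assms(5) by (simp add: field_simps)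
    also have "\<dots> \<le> K * ((\<Gamma> *v z) \<bullet> z)" by (intro mult_right_mono Kge psd\<Gamma>) auto
    finally show "(norm z)\<^sup>2 \<le> K * ((\<Gamma> *v z) \<bullet> z)" .
    have "sqrt ((norm x * sm)\<^sup>2) \<le> sqrt ((\<Gamma> *v x) \<bullet> x)"
      using eb(1)[of x] by (intro real_sqrt_le_mono) (simp add: power_mult_distrib power2_eq_square sm(2)[symmetric] mult_ac)
    then show sl: "norm x * sm \<le> sigma_norm \<Gamma> x" using sm by (simp add: sigma_norm_def)
    have s0: "sigma_norm \<Gamma> x \<ge> 0" by (simp add: sigma_norm_def psd\<Gamma>)
    have nx: "norm x \<le> sigma_norm \<Gamma> x / sm" using sl sm by (simp add: field_simps)
    have mm: "m_max \<ge> 0"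
    proof -
      have "m_min \<le> m_max" using adm by blast
      then show ?thesis using assms(5) by simp
    qed
    have "norm (\<Gamma> *v x) \<le> m_max * (sigma_norm \<Gamma> x / sm)"
      using n\<Gamma>[of x] mult_left_mono[OF nx mm] by linarith
    also have "\<dots> = m_max / sm * sigma_norm \<Gamma> x" by simp
    also have "\<dots> \<le> K * sigma_norm \<Gamma> x" by (intro mult_right_mono Kge s0) auto
    finally show "norm (\<Gamma> *v x) \<le> K * sigma_norm \<Gamma> x" .
    show "sigma_norm \<Gamma> x \<le> K * norm (\<Gamma> *v x)"
    proof (cases "sigma_norm \<Gamma> x = 0")
      case True
      then show ?thesis using K by simp
    next
      case False
      have "sigma_norm \<Gamma> x * sigma_norm \<Gamma> x = (\<Gamma> *v x) \<bullet> x" by (simp add: sigma_norm_def psd\<Gamma>)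
      also have "\<dots> \<le> norm (\<Gamma> *v x) * norm x" by (rule norm_cauchy_schwarz)
      also have "\<dots> \<le> norm (\<Gamma> *v x) * (sigma_norm \<Gamma> x / sm)" by (rule mult_left_mono[OF nx]) simp
      finally have "sigma_norm \<Gamma> x * sigma_norm \<Gamma> x \<le> norm (\<Gamma> *v x) * (1 / sm) * sigma_norm \<Gamma> x" by simp
      then have "sigma_norm \<Gamma> x \<le> norm (\<Gamma> *v x) * (1 / sm)"
        by (rule mult_right_le_imp_le) (use False s0 in simp)
      also have "\<dots> \<le> norm (\<Gamma> *v x) * K" by (intro mult_left_mono Kge) auto
      finally show ?thesis by (simp add: mult.commute)
    qed
  qed
  have gram: "gram_pair (g 0) \<Gamma> K" if adm: "?adm g \<Gamma>" for g \<Gamma>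
  proof
    show "transpose (g 0) = g 0" "transpose \<Gamma> = \<Gamma>" using adm by blast+
  qed (rule K bounds[OF adm])+
  show ?thesis
  proof (cases "\<omega> \<ge> 0")
    case False
    \<comment> \<open>No pair is admissible in this case, because the value of omega0 is never negative.\<close>
    have "\<not> ?adm g \<Gamma>" for g \<Gamma>
    proof
      assume adm: "?adm g \<Gamma>"
      have "omega0 (g 0) \<Gamma> \<ge> 0" by (rule gram_pair.omega0_nonneg[OF gram[OF adm] assms(1)])
      moreover have "omega0 (g 0) \<Gamma> \<le> \<omega>" using adm by blast
      ultimately show False using False by simp
    qed
    then have no: "?adm g \<Gamma> \<Longrightarrow> P" for g \<Gamma> P by blast
    show ?thesis by (intro exI[of _ 1] conjI allI impI; ((rule no, assumption) | simp))
  next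
    case True
    interpret F: frames "all_frames K \<omega> :: 'n frame set" fr_a fr_G fr_Gam fr_D fr_Y fr_r K \<beta> \<omega>
      by (rule frames_all_frames[OF K True assms(6)])
    obtain C C' r0 \<tau>1 where C: "C \<ge> 1" "r0 > 0" "\<tau>1 \<ge> 1" and pc: "\<And>z \<rho> \<tau> p v H. z \<in> all_frames K \<omega> \<Longrightarrow> fr_r z \<le> r0 \<Longrightarrow>
       0 < \<rho> \<Longrightarrow> \<rho> \<le> 1 \<Longrightarrow> \<tau>1 \<le> \<tau> \<Longrightarrow> \<forall>i j. H i $ j = H j $ i \<Longrightarrow>
       \<tau> * \<rho> * ((fr_a z *v (p + (F.\<kappa>v z \<rho> \<tau> * v) *\<^sub>R F.yv z)) \<bullet> (p + (F.\<kappa>v z \<rho> \<tau> * v) *\<^sub>R F.yv z)) + \<tau> ^ 3 * v\<^sup>2 / (\<rho> * F.sv z)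
       \<le> C * (\<rho>\<^sup>2 * F.sv z * (F.Av z \<rho> \<tau> p v H)\<^sup>2) - C' * \<tau> * F.divF z \<rho> \<tau> p v H"
      using F.pointwise_carleman by blast
    have main: "\<tau> * (\<integral>x. sigma_norm \<Gamma> x powr \<beta> * weight \<beta> \<Gamma> x powr (-2 * \<tau>) * grad_norm_sq g u x \<partial>lborel)
        + \<tau> ^ 3 * (\<integral>x. sigma_norm \<Gamma> x powr (- \<beta> - 2) * weight \<beta> \<Gamma> x powr (-2 * \<tau>) * (u x)\<^sup>2 \<partial>lborel)
        \<le> C * (\<integral>x. sigma_norm \<Gamma> x powr (2 * \<beta> + 2) * weight \<beta> \<Gamma> x powr (-2 * \<tau>) * (laplace g u x)\<^sup>2 \<partial>lborel)"
      if adm: "?adm g \<Gamma>" and u: "u \<in> C0_infty (sigma_ball \<Gamma> (min r0 1) - {0})" and \<tau>: "\<tau> \<ge> \<tau>1" for g \<Gamma> u \<tau>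
    proof -
      have lip: "Lam-lipschitz_on UNIV (\<lambda>y. g y $ k $ l)" for k l
      proof (rule lipschitz_onI)
        fix x y
        have "\<bar>g x $ k $ l - g y $ k $ l\<bar> \<le> (\<Sum>j\<in>UNIV. \<bar>g x $ k $ j - g y $ k $ j\<bar>)" by (rule member_le_sum) auto
        also have "\<dots> \<le> (\<Sum>i\<in>UNIV. \<Sum>j\<in>UNIV. \<bar>g x $ i $ j - g y $ i $ j\<bar>)"
          by (rule member_le_sum[of k UNIV "\<lambda>i. \<Sum>j\<in>UNIV. \<bar>g x $ i $ j - g y $ i $ j\<bar>"]) (auto intro: sum_nonneg)
        also have "\<dots> \<le> Lam * norm (x - y)" using adm by blast
        finally show "dist (g x $ k $ l) (g y $ k $ l) \<le> Lam * dist x y" by (simp add: dist_real_def dist_norm)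
      qed (use assms(4) in simp)
      have \<beta>: "\<beta> > 0" using True assms(6) by simp
      interpret Cf: carleman_fn g \<Gamma> K u \<beta> \<omega> \<tau>
      proof -
        interpret gram_pair "g 0" \<Gamma> K by (rule gram[OF adm])
        show "carleman_fn g \<Gamma> K u \<beta>"
          by unfold_locales (use u \<beta> adm in \<open>auto simp: C0_infty_def\<close>)
      qed
      show ?thesis
      proof (rule Cf.integrated_inequality[OF _ u])
        show "\<exists>L. L-lipschitz_on UNIV (\<lambda>y. g y $ k $ l)" for k l using lip by blast
        show "C \<ge> 0" using C by simp
        fix x and D :: "'n \<Rightarrow> real ^ 'n ^ 'n"
        assume x: "x \<noteq> 0" and xr: "sigma_norm \<Gamma> x < min r0 1" and D: "\<And>i k l. has_pd i (\<lambda>y. g y $ k $ l) (D i $ k $ l) x"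
        let ?r = "sigma_norm \<Gamma> x" and ?y = "\<Gamma> *v x"
        have r: "?r > 0" by (rule Cf.sigma_pos[OF x])
        have rr: "?r * ?r = Cf.s x" by (rule Cf.sigma_sq)
        have q0: "Cf.q x > 0" by (rule Cf.q_pos[OF x])
        \<comment> \<open>The frame of the metric at the point x.\<close>
        define z :: "'n frame" where "z = (g x, g 0, \<Gamma>, D, (1 / ?r) *\<^sub>R ?y, ?r)"
        have pr: "fr_a z = g x" "fr_G z = g 0" "fr_Gam z = \<Gamma>" "fr_D z = D" "fr_Y z = (1 / ?r) *\<^sub>R ?y" "fr_r z = ?r"
          by (simp_all add: z_def fr_a_def fr_G_def fr_Gam_def fr_D_def fr_Y_def fr_r_def)
        have z: "z \<in> all_frames K \<omega>"
          unfolding all_frames_def mem_Collect_eq pr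
        proof (intro conjI allI impI)
          show "0 < ?r" "?r \<le> 1" using r xr by auto
          show "(g x *v v) \<bullet> w = v \<bullet> (g x *v w)" for v w by (rule Cf.innerg)
          show "(g 0 *v v) \<bullet> w = v \<bullet> (g 0 *v w)" for v w by (rule Cf.innerg)
          show "(\<Gamma> *v v) \<bullet> w = v \<bullet> (\<Gamma> *v w)" for v w by (rule Cf.inner\<Gamma>)
          show "norm (g x *v v) \<le> K * norm v" "norm (g 0 *v v) \<le> K * norm v" "norm (\<Gamma> *v v) \<le> K * norm v"
            "(norm v)\<^sup>2 \<le> K * ((g 0 *v v) \<bullet> v)" for v by (rule bounds[OF adm])+
          show "norm (D i *v v) \<le> K * norm v" for i v
          proof (rule norm_mv_le_entries)
            have "(\<Sum>k\<in>UNIV. \<Sum>l\<in>UNIV. \<bar>D i $ k $ l\<bar>) \<le> (\<Sum>k\<in>(UNIV::'n set). \<Sum>l\<in>(UNIV::'n set). Lam)"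
              by (intro sum_mono has_pd_lipschitz_bound[OF D lip])
            also have "\<dots> = ?n * (?n * Lam)" by simp
            also have "\<dots> \<le> K" by (rule Kge) simp
            finally show "(\<Sum>k\<in>UNIV. \<Sum>l\<in>UNIV. \<bar>D i $ k $ l\<bar>) \<le> K" .
          qed
          show "norm (g x *v v - g 0 *v v) \<le> K * ?r * norm v" for v
          proof -
            have "(\<Sum>i\<in>UNIV. \<Sum>j\<in>UNIV. \<bar>(g x - g 0) $ i $ j\<bar>) \<le> Lam * norm (x - 0)"
              unfolding vector_minus_component using adm by blast
            also have "\<dots> = Lam / sm * (norm x * sm)" using sm by simp
            also have "\<dots> \<le> K * ?r"
            proof (intro mult_mono)
              show "Lam / sm \<le> K" by (rule Kge) simp
            qed (use bounds(5)[OF adm] K sm in auto)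
            finally show ?thesis unfolding matrix_vector_mult_diff_rdistrib[symmetric] by (rule norm_mv_le_entries)
          qed
          show "norm ((1 / ?r) *\<^sub>R ?y) \<le> K" using bounds(6)[OF adm, of x] r by (simp add: field_simps)
          show "1 \<le> K * norm ((1 / ?r) *\<^sub>R ?y)" using bounds(7)[OF adm, of x] r by (simp add: field_simps)
          show "((\<Gamma> *v (g 0 *v ((1 / ?r) *\<^sub>R ?y))) \<bullet> (g 0 *v ((1 / ?r) *\<^sub>R ?y))) / ((g 0 *v ((1 / ?r) *\<^sub>R ?y)) \<bullet> ((1 / ?r) *\<^sub>R ?y))\<^sup>2 * ((g 0 *v \<xi>) \<bullet> \<xi>)
             + ((\<Gamma> *v (g 0 *v \<xi>)) \<bullet> (g 0 *v \<xi>)) / ((g 0 *v ((1 / ?r) *\<^sub>R ?y)) \<bullet> ((1 / ?r) *\<^sub>R ?y)) \<le> (2 + \<omega>) * ((g 0 *v \<xi>) \<bullet> \<xi>)"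
            if orth: "(g 0 *v ((1 / ?r) *\<^sub>R ?y)) \<bullet> \<xi> = 0" for \<xi>
          proof -
            have o: "(g 0 *v ?y) \<bullet> \<xi> = 0" using orth r by (simp add: matrix_vector_mult_scaleR)
            have e1: "(g 0 *v ((1 / ?r) *\<^sub>R ?y)) \<bullet> ((1 / ?r) *\<^sub>R ?y) = Cf.q x / Cf.s x"
              using r by (simp add: matrix_vector_mult_scaleR Cf.q_def rr[symmetric])
            have e2: "(\<Gamma> *v (g 0 *v ((1 / ?r) *\<^sub>R ?y))) \<bullet> (g 0 *v ((1 / ?r) *\<^sub>R ?y)) = Cf.P x / Cf.s x"
              using r by (simp add: matrix_vector_mult_scaleR Cf.P_def rr[symmetric])
            have e3: "Cf.P x / Cf.s x / (Cf.q x / Cf.s x)\<^sup>2 = Cf.s x * Cf.P x / (Cf.q x)\<^sup>2"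
              using Cf.s_pos[OF x] q0 by (simp add: field_simps power2_eq_square)
            have "(2 + omega0 (g 0) \<Gamma>) * ((g 0 *v \<xi>) \<bullet> \<xi>) \<le> (2 + \<omega>) * ((g 0 *v \<xi>) \<bullet> \<xi>)"
              using adm by (intro mult_right_mono Cf.nonnegG) auto
            then show ?thesis using Cf.tangential_form_bound[OF x o] unfolding e1 e2 e3 by (simp add: mult.commute)
          qed
        qed
        \<comment> \<open>The unscaled coefficients of this frame are the functions of the conjugated problem at x.\<close>
        have yv: "F.yv z = ?y" using r by (simp add: F.yv_def pr)
        have sv: "F.sv z = Cf.s x" by (simp add: F.sv_def pr power2_eq_square rr)
        have mv: "F.mv z = Cf.mm x" by (simp add: F.mv_def yv pr Cf.mm_def)
        have qv: "F.qv z = Cf.q x" by (simp add: F.qv_def yv pr Cf.q_def)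
        have Qv: "F.Qv z = Cf.QQ x" by (simp add: F.Qv_def yv mv Cf.QQ_def)
        have T: "F.T z = Cf.T" by (simp add: F.T_def Cf.T_def pr)
        have hv: "F.hv z (Cf.rho x) = Cf.hh x" by (simp add: F.hv_def sv qv Cf.hh_def)
        have lv: "F.lv z (Cf.rho x) = Cf.ll x" by (simp add: F.lv_def hv T Cf.ll_def)
        have kv: "F.kv z (Cf.rho x) \<tau> = Cf.kk x" by (simp add: F.kv_def sv qv Qv Cf.kk_def)
        have dhv: "F.dhv z (Cf.rho x) = Cf.dhh x" by (simp add: F.dhv_def sv qv yv pr Cf.dhh_def)
        have dlv: "F.dlv z (Cf.rho x) = Cf.dll x" by (simp add: F.dlv_def sv T dhv yv Cf.dll_def)
        have dkv: "F.dkv z (Cf.rho x) \<tau> = Cf.dkk D x"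
          by (simp add: F.dkv_def F.dQv_def sv qv yv mv Qv pr Cf.dkk_def Cf.dQQ_def)
        have kap: "F.\<kappa>v z (Cf.rho x) \<tau> = Cf.kap x" by (simp add: F.\<kappa>v_def sv Cf.kap_def)
        have Av: "F.Av z (Cf.rho x) \<tau> (Cf.pp x) (Cf.vv x) (Cf.HH x) = Cf.E x * laplace g u x"
          unfolding F.Av_def pr yv kap sv by (rule Cf.conj_lap_eq[OF x D, symmetric])
        have dF: "F.divF z (Cf.rho x) \<tau> (Cf.pp x) (Cf.vv x) (Cf.HH x) = (\<Sum>i\<in>UNIV. pd i (Cf.flux i) x)"
          unfolding F.divF_def pr yv hv lv kv dhv dlv dkv
          by (intro sum.cong refl has_pd_imp_pd[symmetric] Cf.has_pd_flux[OF x D])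
        have w: "Cf.pp x + (Cf.kap x * Cf.vv x) *\<^sub>R ?y = Cf.E x *\<^sub>R Cf.gu x"
          by (simp add: Cf.pp_def Cf.vv_def vec_eq_iff algebra_simps)
        have \<rho>1: "Cf.rho x \<le> 1"
        proof -
          have "Cf.rho x = ?r powr \<beta>" by (rule Cf.sigma_powr_eqs(1)[OF x, symmetric])
          also have "\<dots> \<le> 1 powr \<beta>" by (rule powr_mono2) (use \<beta> r xr in auto)
          finally show ?thesis by simp
        qed
        have rz: "fr_r z \<le> r0" using xr by (simp add: pr)
        have Hs: "\<forall>i j. Cf.HH x i $ j = Cf.HH x j $ i" by (intro allI Cf.HH_sym)
        show "\<tau> * Cf.rho x * ((g x *v (Cf.E x *\<^sub>R Cf.gu x)) \<bullet> (Cf.E x *\<^sub>R Cf.gu x)) + \<tau> ^ 3 * (Cf.vv x)\<^sup>2 / (Cf.rho x * Cf.s x)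
          \<le> C * ((Cf.rho x)\<^sup>2 * Cf.s x * (Cf.E x * laplace g u x)\<^sup>2) - C' * \<tau> * (\<Sum>i\<in>UNIV. pd i (Cf.flux i) x)"
          using pc[OF z rz Cf.rho_pos[OF x] \<rho>1 \<tau> Hs, of "Cf.pp x" "Cf.vv x"] unfolding kap yv sv Av dF w pr(1) .
      qed
    qed
    show ?thesis
      by (rule exI[of _ C], rule exI[of _ \<tau>1], rule exI[of _ "min r0 1"], intro conjI allI impI ballI)
        (use C main in \<open>auto\<close>)
  qed
qed

end
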